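(* Let $V\in\mathcal{V}^{4}_{\delta_4}$ for some integer $1/\delta_4\in[4,+\infty)$, and let $\rho>0$, $\lambda>0$ be constants such that $$\frac{\rho}{2}\big(1+V(x)\big)^{\rho-2}\Big[2\big(1+V(x)\big)\mathcal{L}V(x)+(\rho-1)\big|D^{(1)}V(x)g(x)\big|^2\Big]\le \lambda\big[1+V^{\rho}(x)\big]\qquad\forall x\in\mathbb{R}^d .$$ Assume that $V(\epsilon x)\le V(x)$ for all $x\in\mathbb{R}^d$ and $0<\epsilon\le 1$. Suppose moreover that there exist a function $\kappa\in\mathcal{K}_\vee$ and a constant $\bar p>0$ such that $$\kappa\big(|x|^{\bar p}\big)\le V^{\rho}(x)\qquad\forall x\in\mathbb{R}^d .$$ Then for any $q\in(0,\bar p)$, $$\lim_{\Delta\to0}\mathbb{E}|X(T)-Y(T)|^q=0\qquad\forall T\ge0,$$ where $X$ is the exact solution of the SDE and $Y(t)$ is the piecewise constant truncated Euler--Maruyama solution with stepsize $\Delta$ defined in the context from $V$.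
   Context: **SDE.** $|\cdot|$ is the Euclidean norm on $\mathbb{R}^d$ and the trace (Frobenius) norm on matrices; $\bar{\mathbb{R}}_+=[0,\infty)$; $a\vee b=\max\{a,b\}$, $a\wedge b=\min\{a,b\}$. On a complete filtered probability space $(\Omega,\mathcal{F},\{\mathcal{F}_t\}_{t\ge0},\mathbb{P})$ satisfying the usual conditions, $B(t)$ is an $m$-dimensional $\mathcal{F}_t$-Brownian motion. Consider $\mathrm{d}X(t)=f(X(t))\mathrm{d}t+g(X(t))\mathrm{d}B(t)$, $X(0)=x_0\in\mathbb{R}^d$, where $f:\mathbb{R}^d\to\mathbb{R}^d$, $g:\mathbb{R}^d\to\mathbb{R}^{d\times m}$ are locally Lipschitz continuous; under the hypotheses of the claim it has a unique global solution $X(t)$. **Lyapunov functions.** $\mathcal{C}^p_\infty(\mathbb{R}^d;\bar{\mathbb{R}}_+)$ is the set of nonnegative $p$-times continuously differentiable functions $V$ on $\mathbb{R}^d$ with $V(x)\to\infty$ as $|x|\to\infty$. For a multiindex $\alpha$, $D^\alpha V$ is the usual partial derivative; $|D^{(n)}V(x)|=\big(\sum_{|\alpha|=n}|D^\alpha V(x)|^2\big)^{1/2}$ for the set $D^{(n)}V$ of $n$th order partial derivatives; $D^{(1)}V$ is the gradient regarded as a row vector and $D^{(2)}V$ the Hessian matrix (with $|D^{(2)}V|$ its Frobenius norm). For integers $p\ge2$ and $1/\delta_p\ge p$, $$\mathcal{V}^{p}_{\delta_p}=\Big\{V\in\mathcal{C}^p_\infty(\mathbb{R}^d;\bar{\mathbb{R}}_+):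 \exists c>0,\ |D^{(n)}V(\cdot)|\le c(1+V(\cdot))^{1-n\delta_p},\ n=1,\dots,p\Big\}.$$ The operator is $\mathcal{L}V(x)=\langle D^{(1)}V(x),f(x)\rangle+\frac12\mathrm{tr}[g^T(x)D^{(2)}V(x)g(x)]$. $\mathcal{K}$ is the family of continuous increasing functions $\kappa:\bar{\mathbb{R}}_+\to\bar{\mathbb{R}}_+$ with $\kappa(0)=0$ and $\kappa(u)>0$ for $u>0$; $\mathcal{K}_\vee$ is the family of convex $\kappa\in\mathcal{K}$. **Scheme.** Choose a strictly increasing continuous $\varphi:\bar{\mathbb{R}}_+\to\bar{\mathbb{R}}_+$ with $\varphi(u)\to\infty$ as $u\to\infty$ and $$\sup_{|x|\le u}\left(\frac{|f(x)|}{(1+V(x))^{\delta_4}}\vee\frac{|g(x)|^2}{(1+V(x))^{2\delta_4}}\right)\le\varphi(u)\qquad\forall u\ge1,$$ with inverse $\varphi^{-1}:[\varphi(1),\infty)\to\bar{\mathbb{R}}_+$. Choose $0<\theta\le 1/2$ and constants $\Delta^*\in(0,1]$, $K>0$ with $K(\Delta^* )^{-\theta}\ge\varphi(|x_0|\vee1)$ ($K$ independent of $k$ and $\Delta$). For $\Delta\in(0,\Delta^*]$ put $\pi_\Delta(x)=\big(|x|\wedge\varphi^{-1}(K\Delta^{-\theta})\big)\frac{x}{|x|}$ (with $x/|x|=\mathbf{0}$ for $x=\mathbf{0}$), $t_k=k\Delta$, $\Delta B_k=B(t_{k+1})-B(t_k)$, and for integers $k\ge0$ $$Y_0=x_0,\quad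 \tilde Y_{k+1}=Y_k+f(Y_k)\Delta+g(Y_k)\Delta B_k,\quad Y_{k+1}=\pi_\Delta(\tilde Y_{k+1}).$$ Set $Y(t)=Y_k$ for $t\in[t_k,t_{k+1})$. *)

theory Defs
  imports "HOL-Probability.Probability"
begin

section \<open>Filtered probability spaces and Brownian motion\<close>

text \<open>Processes and filtrations are indexed by all reals; only times \<open>t \<ge> 0\<close> carry information.
  The values of \<open>F\<close> at negative times are ignored.\<close>

locale usual_filtered_prob_space = prob_space M + complete_measure M +
    filtration "space M" "\<lambda>t. F (max 0 t)"
  for M :: "'a measure" and F :: "real \<Rightarrow> 'a measure" +
  assumes sets_F_subset: "0 \<le> t \<Longrightarrow> sets (F t) \<subseteq> sets M"
    and null_sets_F: "null_sets M \<subseteq> sets (F 0)"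
    and F_right_continuous: "0 \<le> t \<Longrightarrow> sets (F t) = (\<Inter>s\<in>{t<..}. sets (F s))"

definition adapted :: "(real \<Rightarrow> 'a measure) \<Rightarrow> (real \<Rightarrow> 'a \<Rightarrow> 'b::topological_space) \<Rightarrow> bool" where
  "adapted F Z \<longleftrightarrow> (\<forall>t\<ge>0. Z t \<in> borel_measurable (F t))"

definition continuous_process ::
    "'a measure \<Rightarrow> (real \<Rightarrow> 'a \<Rightarrow> 'b::topological_space) \<Rightarrow> bool" where
  "continuous_process M Z \<longleftrightarrow> (AE \<omega> in M. continuous_on {0..} (\<lambda>t. Z t \<omega>))"

text \<open>Increments over \<open>[s,t]\<close> are independent of \<open>F s\<close> and have the density of \<open>N(0, (t - s) I)\<close>.\<close>

definition brownian_motion ::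
    "'a measure \<Rightarrow> (real \<Rightarrow> 'a measure) \<Rightarrow> (real \<Rightarrow> 'a \<Rightarrow> real ^ 'm::finite) \<Rightarrow> bool" where
  "brownian_motion M F B \<longleftrightarrow>
     adapted F B \<and> continuous_process M B \<and> (AE \<omega> in M. B 0 \<omega> = 0) \<and>
     (\<forall>s\<ge>0. \<forall>t>s.
        prob_space.indep_set M (sets (F s))
          {(\<lambda>\<omega>. B t \<omega> - B s \<omega>) -` A \<inter> space M | A. A \<in> sets borel} \<and>
        distributed M lborel (\<lambda>\<omega>. B t \<omega> - B s \<omega>)
          (\<lambda>x. ennreal (\<Prod>i\<in>UNIV. normal_density 0 (sqrt (t - s)) (x $ i))))"

section \<open>It\^o integral and stochastic differential equations\<close>

definition conv_in_prob ::
    "'a measure \<Rightarrow> (nat \<Rightarrow> 'a \<Rightarrow> 'b::metric_space) \<Rightarrow> ('a \<Rightarrow> 'b) \<Rightarrow> bool" where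
  "conv_in_prob M Z z \<longleftrightarrow>
     (\<forall>n. Z n \<in> borel_measurable M) \<and> z \<in> borel_measurable M \<and>
     (\<forall>\<epsilon>>0. (\<lambda>n. measure M {\<omega> \<in> space M. \<epsilon> < dist (Z n \<omega>) (z \<omega>)}) \<longlonglongrightarrow> 0)"

text \<open>The triple \<open>n\<close>, \<open>\<tau>\<close>, \<open>\<xi>\<close> represents the simple process
  \<open>\<Sum>i<n. \<xi> i * indicator {\<tau> i<..\<tau> (i + 1)}\<close>.\<close>

definition simple_integrand ::
    "'a measure \<Rightarrow> (real \<Rightarrow> 'a measure) \<Rightarrow> nat \<Rightarrow> (nat \<Rightarrow> real) \<Rightarrow>
     (nat \<Rightarrow> 'a \<Rightarrow> real ^ 'm::finite ^ 'd::finite) \<Rightarrow> bool" where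
  "simple_integrand M F n \<tau> \<xi> \<longleftrightarrow>
     0 \<le> \<tau> 0 \<and> (\<forall>i<n. \<tau> i \<le> \<tau> (Suc i)) \<and>
     (\<forall>i<n. \<xi> i \<in> borel_measurable (F (\<tau> i)) \<and> bounded (\<xi> i ` space M))"

definition simple_process ::
    "nat \<Rightarrow> (nat \<Rightarrow> real) \<Rightarrow> (nat \<Rightarrow> 'a \<Rightarrow> real ^ 'm::finite ^ 'd::finite) \<Rightarrow>
     real \<Rightarrow> 'a \<Rightarrow> real ^ 'm ^ 'd" where
  "simple_process n \<tau> \<xi> s \<omega> = (\<Sum>i<n. indicator {\<tau> i<..\<tau> (Suc i)} s *\<^sub>R \<xi> i \<omega>)"

definition simple_ito_integral ::
    "(real \<Rightarrow> 'a \<Rightarrow> real ^ 'm::finite) \<Rightarrow> nat \<Rightarrow> (nat \<Rightarrow> real) \<Rightarrow>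
     (nat \<Rightarrow> 'a \<Rightarrow> real ^ 'm ^ 'd::finite) \<Rightarrow> real \<Rightarrow> 'a \<Rightarrow> real ^ 'd" where
  "simple_ito_integral B n \<tau> \<xi> t \<omega> =
     (\<Sum>i<n. \<xi> i \<omega> *v (B (min t (\<tau> (Suc i))) \<omega> - B (min t (\<tau> i)) \<omega>))"

text \<open>\<open>J\<close> is (a version of) the It\^o integral of \<open>H\<close> over \<open>[0,t]\<close>, for adapted integrands with
  almost surely square integrable paths: the limit in probability of the integrals of simple
  processes whose pathwise \<open>L\<^sup>2([0,t])\<close> distance to \<open>H\<close> tends to \<open>0\<close> in probability.
  The limit is almost surely independent of the approximating sequence.\<close>

definition has_ito_integral ::
    "'a measure \<Rightarrow> (real \<Rightarrow> 'a measure) \<Rightarrow> (real \<Rightarrow> 'a \<Rightarrow> real ^ 'm::finite) \<Rightarrow>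
     (real \<Rightarrow> 'a \<Rightarrow> real ^ 'm ^ 'd::finite) \<Rightarrow> real \<Rightarrow> ('a \<Rightarrow> real ^ 'd) \<Rightarrow> bool" where
  "has_ito_integral M F B H t J \<longleftrightarrow>
     adapted F H \<and>
     (AE \<omega> in M. set_borel_measurable lborel {0..t} (\<lambda>s. H s \<omega>) \<and>
                 set_integrable lborel {0..t} (\<lambda>s. (norm (H s \<omega>))\<^sup>2)) \<and>
     (\<exists>n \<tau> \<xi>. (\<forall>k. simple_integrand M F (n k) (\<tau> k) (\<xi> k)) \<and>
        conv_in_prob M
          (\<lambda>k \<omega>. LBINT s:{0..t}. (norm (simple_process (n k) (\<tau> k) (\<xi> k) s \<omega> - H s \<omega>))\<^sup>2)
          (\<lambda>_. 0) \<and>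
        conv_in_prob M (\<lambda>k. simple_ito_integral B (n k) (\<tau> k) (\<xi> k) t) J)"

text \<open>Global strong solution of \<open>dX = f(X) dt + g(X) dB\<close>, \<open>X(0) = x\<^sub>0\<close>. For a continuous adapted
  \<open>X\<close> and continuous \<open>f\<close> and \<open>g\<close> both integrals are well defined.\<close>

definition sde_solution ::
    "'a measure \<Rightarrow> (real \<Rightarrow> 'a measure) \<Rightarrow> (real \<Rightarrow> 'a \<Rightarrow> real ^ 'm::finite) \<Rightarrow>
     (real ^ 'd::finite \<Rightarrow> real ^ 'd) \<Rightarrow> (real ^ 'd \<Rightarrow> real ^ 'm ^ 'd) \<Rightarrow> real ^ 'd \<Rightarrow>
     (real \<Rightarrow> 'a \<Rightarrow> real ^ 'd) \<Rightarrow> bool" where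
  "sde_solution M F B f g x0 X \<longleftrightarrow>
     adapted F X \<and> continuous_process M X \<and>
     (AE \<omega> in M. X 0 \<omega> = x0) \<and>
     (\<forall>t\<ge>0. \<exists>J. has_ito_integral M F B (\<lambda>s \<omega>. g (X s \<omega>)) t J \<and>
        (AE \<omega> in M. set_integrable lborel {0..t} (\<lambda>s. f (X s \<omega>)) \<and>
                    X t \<omega> = x0 + (LBINT s:{0..t}. f (X s \<omega>)) + J \<omega>))"

definition locally_lipschitz :: "('b::real_normed_vector \<Rightarrow> 'c::real_normed_vector) \<Rightarrow> bool" where
  "locally_lipschitz h \<longleftrightarrow> (\<forall>r. \<exists>L. L-lipschitz_on (cball 0 r) h)"

section \<open>Lyapunov functions\<close>

definition partial_deriv :: "'d::finite \<Rightarrow> (real ^ 'd \<Rightarrow> real) \<Rightarrow> real ^ 'd \<Rightarrow> real" where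
  "partial_deriv i V x = frechet_derivative V (at x) (axis i 1)"

text \<open>Multiindices are tuples of coordinates: the list \<open>[i\<^sub>1, \<dots>, i\<^sub>n]\<close> stands for
  the derivative of order \<open>n\<close> with respect to the coordinates \<open>i\<^sub>1, \<dots>, i\<^sub>n\<close>.\<close>

definition iter_partial :: "'d::finite list \<Rightarrow> (real ^ 'd \<Rightarrow> real) \<Rightarrow> real ^ 'd \<Rightarrow> real" where
  "iter_partial is V = foldr partial_deriv is V"

fun cont_diff :: "nat \<Rightarrow> (real ^ 'd::finite \<Rightarrow> real) \<Rightarrow> bool" where
  "cont_diff 0 V \<longleftrightarrow> continuous_on UNIV V"
| "cont_diff (Suc p) V \<longleftrightarrow> V differentiable_on UNIV \<and> (\<forall>i. cont_diff p (partial_deriv i V))"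

text \<open>Since multiindices are tuples, mixed derivatives are counted once for each ordering, so that
  for \<open>n = 2\<close> this is the Frobenius norm of the Hessian.\<close>

definition norm_deriv :: "nat \<Rightarrow> (real ^ 'd::finite \<Rightarrow> real) \<Rightarrow> real ^ 'd \<Rightarrow> real" where
  "norm_deriv n V x = sqrt (\<Sum>is | length is = n. (iter_partial is V x)\<^sup>2)"

definition gradient :: "(real ^ 'd::finite \<Rightarrow> real) \<Rightarrow> real ^ 'd \<Rightarrow> real ^ 'd" where
  "gradient V x = (\<chi> i. partial_deriv i V x)"

definition hessian :: "(real ^ 'd::finite \<Rightarrow> real) \<Rightarrow> real ^ 'd \<Rightarrow> real ^ 'd ^ 'd" where
  "hessian V x = (\<chi> i j. iter_partial [i, j] V x)"

definition lyapunov_class :: "nat \<Rightarrow> real \<Rightarrow> (real ^ 'd::finite \<Rightarrow> real) set" where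
  "lyapunov_class p \<delta> =
     {V. cont_diff p V \<and> (\<forall>x. 0 \<le> V x) \<and> filterlim V at_top at_infinity \<and>
         (\<exists>c>0. \<forall>n\<in>{1..p}. \<forall>x. norm_deriv n V x \<le> c * (1 + V x) powr (1 - real n * \<delta>))}"

definition sde_generator ::
    "(real ^ 'd::finite \<Rightarrow> real ^ 'd) \<Rightarrow> (real ^ 'd \<Rightarrow> real ^ 'm::finite ^ 'd) \<Rightarrow>
     (real ^ 'd \<Rightarrow> real) \<Rightarrow> real ^ 'd \<Rightarrow> real" where
  "sde_generator f g V x =
     gradient V x \<bullet> f x + 1 / 2 * trace (transpose (g x) ** hessian V x ** g x)"

definition class_K :: "(real \<Rightarrow> real) set" where
  "class_K = {\<kappa>. continuous_on {0..} \<kappa> \<and> mono_on {0..} \<kappa> \<and> \<kappa> 0 = 0 \<and> (\<forall>u>0. 0 < \<kappa> u)}"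

definition class_K_convex :: "(real \<Rightarrow> real) set" where
  "class_K_convex = {\<kappa> \<in> class_K. convex_on {0..} \<kappa>}"

section \<open>Truncated Euler--Maruyama scheme\<close>

text \<open>\<open>sgn x\<close> is \<open>x / |x|\<close>, and \<open>0\<close> for \<open>x = 0\<close>; \<open>the_inv_into {0..} \<phi>\<close> is the inverse of
  \<open>\<phi> : [0,\<infinity>) \<rightarrow> [0,\<infinity>)\<close>, which is only evaluated in the range of \<open>\<phi>\<close>.\<close>

definition truncation ::
    "(real \<Rightarrow> real) \<Rightarrow> real \<Rightarrow> real \<Rightarrow> real \<Rightarrow> real ^ 'd::finite \<Rightarrow> real ^ 'd" where
  "truncation \<phi> K \<theta> \<Delta> x =
     min (norm x) (the_inv_into {0..} \<phi> (K * \<Delta> powr (- \<theta>))) *\<^sub>R sgn x"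

primrec truncated_EM ::
    "(real \<Rightarrow> 'a \<Rightarrow> real ^ 'm::finite) \<Rightarrow> (real ^ 'd::finite \<Rightarrow> real ^ 'd) \<Rightarrow>
     (real ^ 'd \<Rightarrow> real ^ 'm ^ 'd) \<Rightarrow> real ^ 'd \<Rightarrow> (real \<Rightarrow> real) \<Rightarrow> real \<Rightarrow> real \<Rightarrow> real \<Rightarrow>
     nat \<Rightarrow> 'a \<Rightarrow> real ^ 'd" where
  "truncated_EM B f g x0 \<phi> K \<theta> \<Delta> 0 \<omega> = x0"
| "truncated_EM B f g x0 \<phi> K \<theta> \<Delta> (Suc k) \<omega> =
     (let y = truncated_EM B f g x0 \<phi> K \<theta> \<Delta> k \<omega>
      in truncation \<phi> K \<theta> \<Delta>
           (y + \<Delta> *\<^sub>R f y + g y *v (B (real (Suc k) * \<Delta>) \<omega> - B (real k * \<Delta>) \<omega>)))"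

definition truncated_EM_process ::
    "(real \<Rightarrow> 'a \<Rightarrow> real ^ 'm::finite) \<Rightarrow> (real ^ 'd::finite \<Rightarrow> real ^ 'd) \<Rightarrow>
     (real ^ 'd \<Rightarrow> real ^ 'm ^ 'd) \<Rightarrow> real ^ 'd \<Rightarrow> (real \<Rightarrow> real) \<Rightarrow> real \<Rightarrow> real \<Rightarrow> real \<Rightarrow>
     real \<Rightarrow> 'a \<Rightarrow> real ^ 'd" where
  "truncated_EM_process B f g x0 \<phi> K \<theta> \<Delta> t = truncated_EM B f g x0 \<phi> K \<theta> \<Delta> (nat \<lfloor>t / \<Delta>\<rfloor>)"

end

theory Submission
  imports Defs
begin

text \<open>Write \<open>U = 1 + V\<close>, \<open>W = U powr \<rho>\<close>. Since \<open>U powr \<delta>\<close> is Lipschitz and the \<open>n\<close>-th derivatives of \<open>W\<close> are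
  \<open>O(W / U powr (n * \<delta>))\<close>, a fourth-order Taylor expansion relative to the scale \<open>U powr \<delta>\<close>, symmetrised in the
  Gaussian increment so that the odd terms cancel, turns the Khasminskii condition into
  \<open>E W(Y\<^sub>k\<^sub>+\<^sub>1) \<le> (1 + C \<Delta>) E W(Y\<^sub>k)\<close>; the growth restriction by \<open>\<phi>\<close> and \<open>\<theta> \<le> 1/2\<close> make the remainder \<open>O(\<Delta>)\<close>.
  Convexity of \<open>\<kappa>\<close> converts this into a uniform bound of the \<open>pbar\<close>-th moments of \<open>Y\<close>.
  Convergence in probability follows by comparing \<open>X\<close> and \<open>Y\<close> on the grid up to the first time either gets large:
  the It\^o integral of \<open>g(X)\<close> is approximated by Riemann sums uniformly on the grid, by a maximal inequality for
  step integrands, and a discrete Gronwall argument in \<open>L\<^sup>2\<close> controls the stopped difference.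
  Both facts together give convergence of all moments of order below \<open>pbar\<close>.\<close>

section \<open>Taylor estimates for powers of a Lyapunov function\<close>

text \<open>The obstacle is that f and g may grow faster than linearly, so the effect of one step is
  not uniform in its starting point y. What is uniform is the step relative to the length
  \<open>U powr \<delta>\<close> at y: inside the truncation ball the choice of
  \<open>\<phi>\<close> gives |f| <= K \<Delta>^(-\<theta>) \<open>U powr \<delta>\<close> and |g|^2
  <= K \<Delta>^(-\<theta>) \<open>U powr (2 * \<delta>)\<close>. With \<theta> <= 1/2 the relative
  drift is O(\<Delta>^(1/2)), but the relative noise is only of size \<Delta>^(1/4). A remainder of
  order three would then be \<Delta>^(3/4), too large to be summed over 1/\<Delta> steps; order four
  gives exactly \<Delta>, hence four derivatives of V. Steps longer than the length scale are
  covered by a high power of their relative size, whose Gaussian moment is again O(\<Delta>). The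
  truncation does no harm, because it only shrinks vectors and V does not increase under shrinking.
  The moment of order pbar of X is inherited from the scheme by Fatou's lemma once convergence in
  probability is known, so the latter may be proved with constants that depend arbitrarily on the
  radius of a ball.\<close>

lemma cont_diff_iter_partial:
  "cont_diff (length is + p) V \<Longrightarrow> cont_diff p (iter_partial is V)"
\<comment> \<open>The induction runs from the end of the list: \<open>foldr\<close> applies the last
  coordinate first, and that is the derivative which \<open>cont_diff\<close> peels off.\<close>
proof (induction "is" arbitrary: V rule: rev_induct)
  case Nil then show ?case by (simp add: iter_partial_def)
next
  case (snoc i js)
  then have "cont_diff (length js + p) (partial_deriv i V)" by simp
  from snoc.IH[OF this] show ?case by (simp add: iter_partial_def)
qed

lemma iter_partial_differentiable:
  assumes "cont_diff n V" "length is < n"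
  shows "iter_partial is V differentiable (at x)"
proof -
  have "cont_diff (length is + Suc (n - length is - 1)) V" using assms by simp
  from cont_diff_iter_partial[OF this] show ?thesis
    by (simp add: differentiable_on_def)
qed

lemma iter_partial_le_norm_deriv:
  fixes V :: "real ^ 'd::finite \<Rightarrow> real"
  assumes "length is = n"
  shows "\<bar>iter_partial is V x\<bar> \<le> norm_deriv n V x"
proof -
  have fin: "finite {is :: 'd list. length is = n}"
    using finite_lists_length_eq[of "UNIV :: 'd set" n] by simp
  have "(iter_partial is V x)\<^sup>2 \<le> (\<Sum>is | length is = n. (iter_partial is V x)\<^sup>2)"
    by (rule member_le_sum[OF _ _ fin]) (use assms in auto)
  then show ?thesis unfolding norm_deriv_def by (simp add: real_le_rsqrt)
qed

text \<open>The derivative of \<open>V\<close> in the coordinates \<open>is\<close> and then the directions \<open>vs\<close>, where the last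
  element of \<open>vs\<close> is differentiated last.\<close>

fun mixed_deriv :: "(real ^ 'd::finite \<Rightarrow> real) \<Rightarrow> (real ^ 'd) list \<Rightarrow> 'd list \<Rightarrow> real ^ 'd \<Rightarrow> real" where
  "mixed_deriv V [] is x = iter_partial is V x"
| "mixed_deriv V (v # vs) is x = (\<Sum>i\<in>UNIV. v $ i * mixed_deriv V vs (i # is) x)"

text \<open>A further derivative appends its direction at the end of the list. Only the base case
  differentiates, by expanding the Frechet derivative in the coordinate axes; the rest is linear in
  the earlier directions.\<close>

lemma has_real_derivative_mixed_deriv:
  fixes V :: "real ^ 'd::finite \<Rightarrow> real"
  assumes V: "cont_diff n V" and len: "length vs + length is < n"
  shows "((\<lambda>s. mixed_deriv V vs is (y + s *\<^sub>R c)) has_real_derivative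
           mixed_deriv V (vs @ [c]) is (y + s *\<^sub>R c)) (at s)"
  using len
proof (induction vs arbitrary: "is")
  case Nil
  let ?E = "iter_partial is V"
  let ?x = "y + s *\<^sub>R c"
  have "(?E has_derivative frechet_derivative ?E (at ?x)) (at ?x)"
    using iter_partial_differentiable[OF V] Nil by (simp add: frechet_derivative_works)
  then have D: "((\<lambda>s. ?E (y + s *\<^sub>R c)) has_derivative (\<lambda>h. frechet_derivative ?E (at ?x) (h *\<^sub>R c))) (at s)"
    by (intro has_derivative_compose[where f = "\<lambda>s. y + s *\<^sub>R c" and g = ?E])
      (auto intro!: derivative_eq_intros)
  have lin: "linear (frechet_derivative ?E (at ?x))"
    using iter_partial_differentiable[OF V] Nil by (intro linear_frechet_derivative) simp
  have "frechet_derivative ?E (at ?x) c = frechet_derivative ?E (at ?x) (\<Sum>i\<in>UNIV. c $ i *\<^sub>R axis i 1)"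
    using basis_expansion[of c, unfolded scalar_mult_eq_scaleR] by simp
  also have "\<dots> = (\<Sum>i\<in>UNIV. c $ i * frechet_derivative ?E (at ?x) (axis i 1))"
    using lin by (simp add: linear_sum linear_scale)
  also have "\<dots> = (\<Sum>i\<in>UNIV. c $ i * iter_partial (i # is) V ?x)"
    by (simp add: iter_partial_def partial_deriv_def)
  finally have eq: "frechet_derivative ?E (at ?x) c = \<dots>" .
  have "(\<lambda>h. frechet_derivative ?E (at ?x) (h *\<^sub>R c)) = (*) (\<Sum>i\<in>UNIV. c $ i * iter_partial (i # is) V ?x)"
    using lin eq by (simp add: linear_scale fun_eq_iff)
  with D show ?case by (simp add: has_field_derivative_def)
next
  case (Cons v vs)
  show ?case
    using Cons by (auto intro!: derivative_eq_intros sum.cong)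
qed

text \<open>Every direction costs a factor d: it has d coordinates, each at most its norm.\<close>

lemma mixed_deriv_bound:
  fixes V :: "real ^ 'd::finite \<Rightarrow> real"
  shows "\<bar>mixed_deriv V vs is x\<bar> \<le>
    (\<Prod>v\<leftarrow>vs. real CARD('d) * norm v) * norm_deriv (length vs + length is) V x"
proof (induction vs arbitrary: "is")
  case Nil then show ?case by (simp add: iter_partial_le_norm_deriv)
next
  case (Cons v vs)
  let ?B = "(\<Prod>v\<leftarrow>vs. real CARD('d) * norm v) * norm_deriv (Suc (length vs + length is)) V x"
  have "\<bar>mixed_deriv V (v # vs) is x\<bar> \<le> (\<Sum>i\<in>UNIV. \<bar>v $ i * mixed_deriv V vs (i # is) x\<bar>)"
    by simp
  also have "\<dots> \<le> (\<Sum>i\<in>(UNIV::'d set). norm v * ?B)"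
  proof (rule sum_mono)
    fix i
    have "\<bar>mixed_deriv V vs (i # is) x\<bar> \<le> ?B" using Cons[of "i # is"] by simp
    then show "\<bar>v $ i * mixed_deriv V vs (i # is) x\<bar> \<le> norm v * ?B"
      unfolding abs_mult by (intro mult_mono component_le_norm_cart) auto
  qed
  also have "\<dots> = (\<Prod>v\<leftarrow>v # vs. real CARD('d) * norm v) * norm_deriv (length (v # vs) + length is) V x"
    by simp
  finally show ?case .
qed

lemma has_real_derivative_powr_chain:
  assumes "(v has_real_derivative v') (at s)" "v s > 0"
  shows "((\<lambda>s. v s powr r) has_real_derivative r * v s powr (r - 1) * v') (at s)"
  using DERIV_fun_powr[OF assms, of r] by (simp add: mult_ac)

declare mixed_deriv.simps(2) [simp del]

section \<open>The length scale of a Lyapunov function and its derivatives measured in that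
  scale\<close>

locale lyapunov =
  fixes V :: "real ^ 'd::finite \<Rightarrow> real" and \<delta> c :: real
  assumes \<delta>_pos: "0 < \<delta>" and c_pos: "0 < c"
    and smooth: "cont_diff 4 V" and V_nonneg: "\<And>x. 0 \<le> V x"
    and norm_deriv_le: "\<And>n x. n \<in> {1..4} \<Longrightarrow> norm_deriv n V x \<le> c * (1 + V x) powr (1 - real n * \<delta>)"
begin

definition U :: "real ^ 'd \<Rightarrow> real" where "U x = 1 + V x"

abbreviation P :: "(real ^ 'd) list \<Rightarrow> real ^ 'd \<Rightarrow> real" where "P vs x \<equiv> mixed_deriv V vs [] x"

text \<open>The natural length at x: the class condition says that the nth derivative of V is at
  most c U / u^n, so displacements are always measured relative to u.\<close>

abbreviation u :: "real ^ 'd \<Rightarrow> real" where "u x \<equiv> U x powr \<delta>"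

lemma U_ge_1: "1 \<le> U x" using V_nonneg[of x] by (simp add: U_def)

lemma U_pos: "0 < U x" using U_ge_1[of x] by linarith

lemma U_nz [simp]: "U x \<noteq> 0" using U_pos[of x] by linarith

lemma u_ge_1: "1 \<le> u x" using U_ge_1 \<delta>_pos by (simp add: ge_one_powr_ge_zero)

lemma u_nz [simp]: "u x \<noteq> 0" using u_ge_1[of x] by linarith

lemma u_pos: "0 < u x" using u_ge_1[of x] by linarith

lemma P_derivative:
  "length vs < 4 \<Longrightarrow> ((\<lambda>s. P vs (y + s *\<^sub>R h)) has_real_derivative P (vs @ [h]) (y + s *\<^sub>R h)) (at s)"
  using has_real_derivative_mixed_deriv[OF smooth, of vs "[]"] by simp

lemma U_derivative:
  "((\<lambda>s. U (y + s *\<^sub>R h)) has_real_derivative P [h] (y + s *\<^sub>R h)) (at s)"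
proof -
  have "((\<lambda>s. V (y + s *\<^sub>R h)) has_real_derivative P [h] (y + s *\<^sub>R h)) (at s)"
    using P_derivative[of "[]" y h s] by (simp add: iter_partial_def)
  then show ?thesis unfolding U_def by (auto intro!: derivative_eq_intros)
qed

lemma P_bound:
  assumes "length vs \<in> {1..4}"
  shows "\<bar>P vs x\<bar> \<le> c * U x * (\<Prod>v\<leftarrow>vs. real CARD('d) * norm v / u x)"
proof -
  have e: "(\<Prod>v\<leftarrow>vs. real CARD('d) * norm v / u x) =
      (\<Prod>v\<leftarrow>vs. real CARD('d) * norm v) / u x ^ length vs"
    by (induction vs) (auto simp: field_simps)
  have "(1 + V x) powr (1 - real (length vs) * \<delta>) = U x / u x ^ length vs"
    using U_pos[of x] by (simp add: powr_diff powr_powr powr_realpow[symmetric] mult.commute flip: U_def)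
  then have n: "norm_deriv (length vs) V x \<le> c * (U x / u x ^ length vs)"
    using norm_deriv_le[OF assms, of x] by simp
  have p: "0 \<le> (\<Prod>v\<leftarrow>vs. real CARD('d) * norm v)" by (induction vs) auto
  have "\<bar>P vs x\<bar> \<le> (\<Prod>v\<leftarrow>vs. real CARD('d) * norm v) * norm_deriv (length vs) V x"
    using mixed_deriv_bound[of V vs "[]" x] by simp
  also have "\<dots> \<le> (\<Prod>v\<leftarrow>vs. real CARD('d) * norm v) * (c * (U x / u x ^ length vs))"
    by (rule mult_left_mono[OF n p])
  finally show ?thesis unfolding e by (simp add: mult_ac)
qed

definition Lip :: real where "Lip = \<delta> * c * real CARD('d)"

lemma Lip_pos: "0 < Lip" unfolding Lip_def using \<delta>_pos c_pos by simp

text \<open>The powers of U cancel: the derivative of U^\<delta> is \<delta> U^(\<delta>-1) DV, and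
  |DV| is at most c U^(1-\<delta>). Hence the scale itself varies in a controlled way however fast V
  grows.\<close>

lemma u_lipschitz: "\<bar>u (y + h) - u y\<bar> \<le> Lip * norm h"
proof -
  have D: "((\<lambda>s. u (y + s *\<^sub>R h)) has_real_derivative
      \<delta> * U (y + s *\<^sub>R h) powr (\<delta> - 1) * P [h] (y + s *\<^sub>R h)) (at s)" for s
    by (rule has_real_derivative_powr_chain[OF U_derivative U_pos])
  obtain s where s: "u (y + 1 *\<^sub>R h) - u (y + 0 *\<^sub>R h) =
      (1 - 0) * (\<delta> * U (y + s *\<^sub>R h) powr (\<delta> - 1) * P [h] (y + s *\<^sub>R h))"
    using MVT2[of 0 1 "\<lambda>s. u (y + s *\<^sub>R h)", OF _ D] by auto
  let ?x = "y + s *\<^sub>R h"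
  have "\<bar>P [h] ?x\<bar> \<le> c * U ?x * (real CARD('d) * norm h / u ?x)"
    using P_bound[of "[h]" ?x] by simp
  then have "\<delta> * U ?x powr (\<delta> - 1) * \<bar>P [h] ?x\<bar> \<le>
     \<delta> * U ?x powr (\<delta> - 1) * (c * U ?x * (real CARD('d) * norm h / u ?x))"
    using \<delta>_pos by (intro mult_left_mono) auto
  also have "\<dots> = Lip * norm h"
    using U_pos[of ?x] by (simp add: Lip_def powr_diff)
  finally show ?thesis using s \<delta>_pos by (simp add: abs_mult)
qed

text \<open>A factor 2 per direction pays for passing from the scale at x to the one at y, a factor
  d per direction comes from \<open>mixed_deriv_bound\<close>, and there are at most four
  directions. The summand 1 gives \<open>1 \<le> C0\<close>, so that lower powers of
  \<open>C0\<close> may be raised to the fourth.\<close>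

definition C0 :: real where "C0 = 1 + c * (2 * real CARD('d)) ^ 4"

lemma C0_ge_1: "1 \<le> C0" unfolding C0_def using c_pos by simp

text \<open>Taylor remainders are evaluated at an intermediate point x, while the estimates have to
  be stated in the scale of the starting point y.\<close>

lemma P_bound_near:
  assumes len: "length vs \<in> {1..4}" and near: "u y / 2 \<le> u x"
  shows "\<bar>P vs x\<bar> \<le> C0 * U x * (\<Prod>v\<leftarrow>vs. norm v / u y)"
proof -
  have q: "1 / u x \<le> 2 / u y" using near u_pos[of y] u_pos[of x] by (simp add: field_simps)
  have "(\<Prod>v\<leftarrow>vs. real CARD('d) * norm v / u x) \<le> (\<Prod>v\<leftarrow>vs. (2 * real CARD('d)) * (norm v / u y)) \<and>
      0 \<le> (\<Prod>v\<leftarrow>vs. real CARD('d) * norm v / u x)"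
  proof (induction vs)
    case (Cons v vs)
    have "real CARD('d) * norm v / u x \<le> (2 * real CARD('d)) * (norm v / u y)"
      using mult_left_mono[OF q, of "real CARD('d) * norm v"] by (simp add: mult_ac)
    moreover have "0 \<le> real CARD('d) * norm v / u x" "0 \<le> 2 * real CARD('d) * (norm v / u y)" by auto
    ultimately show ?case
      unfolding list.map prod_list.Cons using Cons by (intro conjI mult_mono mult_nonneg_nonneg) auto
  qed simp
  then have 1: "(\<Prod>v\<leftarrow>vs. real CARD('d) * norm v / u x) \<le> (\<Prod>v\<leftarrow>vs. (2 * real CARD('d)) * (norm v / u y))" ..
  have 2: "(\<Prod>v\<leftarrow>vs. (2 * real CARD('d)) * (norm v / u y)) = (2 * real CARD('d)) ^ length vs * (\<Prod>v\<leftarrow>vs. norm v / u y)"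
    by (induction vs) auto
  have card: "1 \<le> real CARD('d)" using zero_less_card_finite[where 'a='d] by linarith
  have "1 \<le> 2 * real CARD('d)" using card by linarith
  then have 3: "(2 * real CARD('d)) ^ length vs \<le> (2 * real CARD('d)) ^ 4"
    using len by (intro power_increasing) simp_all
  have pos: "0 \<le> (\<Prod>v\<leftarrow>vs. norm v / u y)" by (induction vs) auto
  have "\<bar>P vs x\<bar> \<le> c * U x * (\<Prod>v\<leftarrow>vs. real CARD('d) * norm v / u x)"
    by (rule P_bound[OF len])
  also have "\<dots> \<le> c * U x * ((2 * real CARD('d)) ^ 4 * (\<Prod>v\<leftarrow>vs. norm v / u y))"
    using 1 2 3 pos c_pos U_pos[of x] by (intro mult_left_mono) (auto intro: order_trans mult_right_mono)
  also have "\<dots> = (c * (2 * real CARD('d)) ^ 4) * (U x * (\<Prod>v\<leftarrow>vs. norm v / u y))" by simp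
  also have "\<dots> \<le> C0 * (U x * (\<Prod>v\<leftarrow>vs. norm v / u y))"
    unfolding C0_def using pos U_pos[of x] by (intro mult_right_mono) auto
  finally show ?thesis by (simp add: mult_ac)
qed

text \<open>This fixes the regime in which Taylor's formula is used: displacements of at most
  \<open>u y / (2 * Lip)\<close> change the scale by a factor of at most 2.\<close>

lemma near_bounds:
  assumes "Lip * norm h \<le> u y / 2"
  shows "u y / 2 \<le> u (y + h)" "u (y + h) \<le> 2 * u y"
  using u_lipschitz[of y h] u_pos[of y] assms by linarith+

end

section \<open>Derivatives of the power W up to order four\<close>

lemma abs_mult_le_mono: "\<bar>a\<bar> \<le> A \<Longrightarrow> \<bar>b\<bar> \<le> B \<Longrightarrow> \<bar>a * b\<bar> \<le> A * (B::real)"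
  unfolding abs_mult by (intro mult_mono) auto

lemma abs_add_le_mono: "\<bar>a\<bar> \<le> A \<Longrightarrow> \<bar>b\<bar> \<le> B \<Longrightarrow> \<bar>a + b\<bar> \<le> A + (B::real)"
  by linarith

text \<open>Faa di Bruno's formula for the outer function \<open>\<lambda>v. v powr \<rho>\<close>.
  The integer coefficients count set partitions by block sizes: 1, 3, 1 at order three and 1, 6, 3 +
  4, 1 at order four.\<close>

lemma powr_derivatives:
  fixes v v1 v2 v3 v4 :: "real \<Rightarrow> real"
  assumes pos: "\<And>s. v s > 0"
    and v: "\<And>s. (v has_real_derivative v1 s) (at s)"
    and v1: "\<And>s. (v1 has_real_derivative v2 s) (at s)"
    and v2: "\<And>s. (v2 has_real_derivative v3 s) (at s)"
    and v3: "\<And>s. (v3 has_real_derivative v4 s) (at s)"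
  shows "((\<lambda>s. v s powr \<rho>) has_real_derivative \<rho> * v s powr (\<rho> - 1) * v1 s) (at s)"
    and "((\<lambda>s. \<rho> * v s powr (\<rho> - 1) * v1 s) has_real_derivative
      \<rho> * (\<rho> - 1) * v s powr (\<rho> - 2) * (v1 s)\<^sup>2 + \<rho> * v s powr (\<rho> - 1) * v2 s) (at s)"
    and "((\<lambda>s. \<rho> * (\<rho> - 1) * v s powr (\<rho> - 2) * (v1 s)\<^sup>2 + \<rho> * v s powr (\<rho> - 1) * v2 s)
      has_real_derivative
      \<rho> * (\<rho> - 1) * (\<rho> - 2) * v s powr (\<rho> - 3) * v1 s ^ 3
        + 3 * (\<rho> * (\<rho> - 1) * v s powr (\<rho> - 2) * (v1 s * v2 s)) + \<rho> * v s powr (\<rho> - 1) * v3 s) (at s)"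
    and "((\<lambda>s. \<rho> * (\<rho> - 1) * (\<rho> - 2) * v s powr (\<rho> - 3) * v1 s ^ 3
        + 3 * (\<rho> * (\<rho> - 1) * v s powr (\<rho> - 2) * (v1 s * v2 s)) + \<rho> * v s powr (\<rho> - 1) * v3 s)
      has_real_derivative
      \<rho> * (\<rho> - 1) * (\<rho> - 2) * (\<rho> - 3) * v s powr (\<rho> - 4) * v1 s ^ 4
        + 6 * (\<rho> * (\<rho> - 1) * (\<rho> - 2) * v s powr (\<rho> - 3) * ((v1 s)\<^sup>2 * v2 s))
        + \<rho> * (\<rho> - 1) * v s powr (\<rho> - 2) * (3 * (v2 s)\<^sup>2 + 4 * (v1 s * v3 s))
        + \<rho> * v s powr (\<rho> - 1) * v4 s) (at s)"
proof -
  have D: "((\<lambda>s. v s powr r) has_real_derivative r * v s powr (r - 1) * v1 s) (at s)" for r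
    by (rule has_real_derivative_powr_chain[OF v pos])
  note D1 = D[of "\<rho>-1"] and D2 = D[of "\<rho>-2"] and D3 = D[of "\<rho>-3"]
  note * = D1 D2 D3 v1 v2 v3
  show "((\<lambda>s. v s powr \<rho>) has_real_derivative \<rho> * v s powr (\<rho> - 1) * v1 s) (at s)" by (rule D)
  show "((\<lambda>s. \<rho> * v s powr (\<rho> - 1) * v1 s) has_real_derivative
      \<rho> * (\<rho> - 1) * v s powr (\<rho> - 2) * (v1 s)\<^sup>2 + \<rho> * v s powr (\<rho> - 1) * v2 s) (at s)"
    by (rule derivative_eq_intros * refl)+ (simp add: algebra_simps power2_eq_square)
  show "((\<lambda>s. \<rho> * (\<rho> - 1) * v s powr (\<rho> - 2) * (v1 s)\<^sup>2 + \<rho> * v s powr (\<rho> - 1) * v2 s)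
      has_real_derivative
      \<rho> * (\<rho> - 1) * (\<rho> - 2) * v s powr (\<rho> - 3) * v1 s ^ 3
        + 3 * (\<rho> * (\<rho> - 1) * v s powr (\<rho> - 2) * (v1 s * v2 s)) + \<rho> * v s powr (\<rho> - 1) * v3 s) (at s)"
    by (rule derivative_eq_intros * refl)+ (simp add: algebra_simps power2_eq_square power3_eq_cube)
  show "((\<lambda>s. \<rho> * (\<rho> - 1) * (\<rho> - 2) * v s powr (\<rho> - 3) * v1 s ^ 3
        + 3 * (\<rho> * (\<rho> - 1) * v s powr (\<rho> - 2) * (v1 s * v2 s)) + \<rho> * v s powr (\<rho> - 1) * v3 s)
      has_real_derivative
      \<rho> * (\<rho> - 1) * (\<rho> - 2) * (\<rho> - 3) * v s powr (\<rho> - 4) * v1 s ^ 4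
        + 6 * (\<rho> * (\<rho> - 1) * (\<rho> - 2) * v s powr (\<rho> - 3) * ((v1 s)\<^sup>2 * v2 s))
        + \<rho> * (\<rho> - 1) * v s powr (\<rho> - 2) * (3 * (v2 s)\<^sup>2 + 4 * (v1 s * v3 s))
        + \<rho> * v s powr (\<rho> - 1) * v4 s) (at s)"
    by (rule derivative_eq_intros * refl)+
      (simp add: algebra_simps power2_eq_square power3_eq_cube eval_nat_numeral)
qed

text \<open>Homogeneity: a term with \<open>v powr (\<rho> - j)\<close> contains j derivatives of v,
  each of which supplies one factor v, so that every term is of the same degree \<rho> in v.\<close>

lemma powr_term_bound:
  assumes "\<bar>k\<bar> \<le> K" "\<bar>z\<bar> \<le> v ^ j * Z" "0 < (v::real)"
  shows "\<bar>k * v powr (\<rho> - real j) * z\<bar> \<le> K * Z * v powr \<rho>"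
proof -
  have "\<bar>k * v powr (\<rho> - real j) * z\<bar> \<le> (K * v powr (\<rho> - real j)) * (v ^ j * Z)"
    by (intro abs_mult_le_mono assms) simp
  also have "\<dots> = K * Z * v powr \<rho>"
    using assms(3) by (simp add: powr_diff powr_realpow)
  finally show ?thesis .
qed

text \<open>The base \<rho> + 4 dominates each factor |\<rho> - i| and exceeds 1, so a single fourth
  power also covers the shorter products.\<close>

lemma abs_coeff_bounds:
  assumes "0 < (\<rho>::real)"
  shows "\<bar>\<rho>\<bar> \<le> (\<rho> + 4) ^ 4" "\<bar>\<rho> * (\<rho> - 1)\<bar> \<le> (\<rho> + 4) ^ 4"
    "\<bar>\<rho> * (\<rho> - 1) * (\<rho> - 2)\<bar> \<le> (\<rho> + 4) ^ 4"
    "\<bar>\<rho> * (\<rho> - 1) * (\<rho> - 2) * (\<rho> - 3)\<bar> \<le> (\<rho> + 4) ^ 4"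
proof -
  let ?k = "\<rho> + 4"
  have b: "\<bar>\<rho>\<bar> \<le> ?k" "\<bar>\<rho> - 1\<bar> \<le> ?k" "\<bar>\<rho> - 2\<bar> \<le> ?k" "\<bar>\<rho> - 3\<bar> \<le> ?k"
    using assms by auto
  have m: "?k ^ i \<le> ?k ^ 4" if "i \<le> 4" for i
    using assms that by (intro power_increasing) auto
  have "\<bar>\<rho>\<bar> \<le> ?k ^ 1" using b by simp
  also note m
  finally show "\<bar>\<rho>\<bar> \<le> ?k ^ 4" by simp
  have "\<bar>\<rho> * (\<rho> - 1)\<bar> \<le> ?k * ?k" by (intro abs_mult_le_mono b)
  also have "\<dots> = ?k ^ 2" by (simp add: power2_eq_square)
  also note m
  finally show "\<bar>\<rho> * (\<rho> - 1)\<bar> \<le> ?k ^ 4" by simp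
  have "\<bar>\<rho> * (\<rho> - 1) * (\<rho> - 2)\<bar> \<le> ?k * ?k * ?k" by (intro abs_mult_le_mono b)
  also have "\<dots> = ?k ^ 3" by (simp add: power3_eq_cube)
  also note m
  finally show "\<bar>\<rho> * (\<rho> - 1) * (\<rho> - 2)\<bar> \<le> ?k ^ 4" by simp
  have "\<bar>\<rho> * (\<rho> - 1) * (\<rho> - 2) * (\<rho> - 3)\<bar> \<le> ?k * ?k * ?k * ?k" by (intro abs_mult_le_mono b)
  also have "\<dots> = ?k ^ 4" by (simp add: eval_nat_numeral)
  finally show "\<bar>\<rho> * (\<rho> - 1) * (\<rho> - 2) * (\<rho> - 3)\<bar> \<le> ?k ^ 4" .
qed

lemma cubic_identity1: "(A * (C * r))\<^sup>2 * (A * (C * (r * r))) = A ^ 3 * (C ^ 3 * (r::real) ^ 4)"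
  by (simp add: eval_nat_numeral mult_ac)

lemma cubic_identity2: "(A * (C * r)) * (A * (C * q))\<^sup>2 = A ^ 3 * (C ^ 3 * (r * (q::real)\<^sup>2))"
  by (simp add: eval_nat_numeral mult_ac)

locale lyapunov_power = lyapunov +
  fixes \<rho> :: real
  assumes \<rho>_pos: "0 < \<rho>"
begin

definition W :: "real ^ 'a \<Rightarrow> real" where "W x = U x powr \<rho>"

definition W1 :: "real ^ 'a \<Rightarrow> real ^ 'a \<Rightarrow> real" where
  "W1 x h = \<rho> * U x powr (\<rho> - 1) * P [h] x"

definition W2 :: "real ^ 'a \<Rightarrow> real ^ 'a \<Rightarrow> real" where
  "W2 x h = \<rho> * (\<rho> - 1) * U x powr (\<rho> - 2) * (P [h] x)\<^sup>2 + \<rho> * U x powr (\<rho> - 1) * P [h, h] x"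

lemma W_pos: "0 < W x" unfolding W_def using U_pos[of x] by simp

lemma W_eq_u: "W x = u x powr (\<rho> / \<delta>)"
  unfolding W_def using \<delta>_pos by (simp add: powr_powr)

text \<open>15 = 1 + 6 + 7 + 1 counts the terms of the fourth derivative,
  \<open>(\<rho> + 4) ^ 4\<close> bounds the falling factorials, \<open>C0 ^ 4\<close> the
  derivatives of V, and \<open>2 powr (\<rho> / \<delta>)\<close> compares W at two points whose
  scales differ by a factor of at most 2.\<close>

definition C1 :: real where "C1 = 15 * (\<rho> + 4) ^ 4 * C0 ^ 4 * 2 powr (\<rho> / \<delta>)"

lemma W_near:
  assumes "u x \<le> 2 * u y" shows "W x \<le> 2 powr (\<rho> / \<delta>) * W y"
proof -
  have "u x powr (\<rho> / \<delta>) \<le> (2 * u y) powr (\<rho> / \<delta>)"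
    using assms \<rho>_pos \<delta>_pos u_pos[of x] by (intro powr_mono2) auto
  then show ?thesis unfolding W_eq_u using u_pos[of y] by (simp add: powr_mult)
qed

abbreviation rel :: "real ^ 'a \<Rightarrow> real ^ 'a \<Rightarrow> real" where "rel y h \<equiv> norm h / u y"

lemma rel_nonneg: "0 \<le> rel y h" using u_pos[of y] by simp

lemma C0_pow: "C0 ^ i \<le> C0 ^ j" if "i \<le> j" using that C0_ge_1 by (intro power_increasing)

lemma C1_bound:
  assumes "z \<le> 15 * (\<rho> + 4) ^ 4 * C0 ^ 4 * R * W x" "u x \<le> 2 * u y" "0 \<le> R"
  shows "z \<le> C1 * R * W y"
proof -
  note assms(1)
  also have "15 * (\<rho> + 4) ^ 4 * C0 ^ 4 * R * W x \<le> 15 * (\<rho> + 4) ^ 4 * C0 ^ 4 * R * (2 powr (\<rho> / \<delta>) * W y)"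
    using \<rho>_pos C0_ge_1 assms by (intro mult_left_mono[OF W_near]) auto
  also have "\<dots> = C1 * R * W y" by (simp add: C1_def)
  finally show ?thesis .
qed

lemma P_le:
  assumes "u y / 2 \<le> u x"
  shows "\<bar>P [h] x\<bar> \<le> U x * (C0 * rel y h)"
    "\<bar>P [h, k] x\<bar> \<le> U x * (C0 * (rel y h * rel y k))"
    "\<bar>P [h, k, l] x\<bar> \<le> U x * (C0 * (rel y h * (rel y k * rel y l)))"
    "\<bar>P [h, k, l, m] x\<bar> \<le> U x * (C0 * (rel y h * (rel y k * (rel y l * rel y m))))"
  using P_bound_near[OF _ assms, of "[h]"] P_bound_near[OF _ assms, of "[h,k]"]
    P_bound_near[OF _ assms, of "[h,k,l]"] P_bound_near[OF _ assms, of "[h,k,l,m]"]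
  by (simp_all add: mult_ac)

lemma W2_le:
  assumes near: "u y / 2 \<le> u x"
  shows "\<bar>W2 x h\<bar> \<le> 15 * (\<rho> + 4) ^ 4 * C0 ^ 4 * (rel y h)\<^sup>2 * W x"
proof -
  note P = P_le[OF near]
  let ?k = "(\<rho> + 4) ^ 4"
  have "\<bar>W2 x h\<bar> \<le> ?k * (C0 ^ 4 * (rel y h)\<^sup>2) * W x + ?k * (C0 ^ 4 * (rel y h)\<^sup>2) * W x"
    unfolding W2_def W_def
  proof (intro abs_add_le_mono)
    have "\<bar>(P [h] x)\<^sup>2\<bar> \<le> (U x * (C0 * rel y h))\<^sup>2"
      using power_mono[OF P(1)[of h], of 2] by simp
    also have "\<dots> = U x ^ 2 * (C0 ^ 2 * (rel y h)\<^sup>2)" unfolding power_mult_distrib ..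
    also have "\<dots> \<le> U x ^ 2 * (C0 ^ 4 * (rel y h)\<^sup>2)"
      by (intro mult_left_mono mult_right_mono C0_pow) auto
    finally show "\<bar>\<rho> * (\<rho> - 1) * U x powr (\<rho> - 2) * (P [h] x)\<^sup>2\<bar> \<le> ?k * (C0 ^ 4 * (rel y h)\<^sup>2) * U x powr \<rho>"
      using powr_term_bound[of _ ?k _ "U x" 2] abs_coeff_bounds(2)[OF \<rho>_pos] U_pos[of x] by simp
    have "\<bar>P [h, h] x\<bar> \<le> U x * (C0 * (rel y h * rel y h))" by (rule P)
    also have "\<dots> = U x * (C0 ^ 1 * (rel y h)\<^sup>2)" by (simp add: power2_eq_square)
    also have "\<dots> \<le> U x * (C0 ^ 4 * (rel y h)\<^sup>2)"
      using U_pos[of x] by (intro mult_left_mono mult_right_mono C0_pow) auto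
    finally show "\<bar>\<rho> * U x powr (\<rho> - 1) * P [h, h] x\<bar> \<le> ?k * (C0 ^ 4 * (rel y h)\<^sup>2) * U x powr \<rho>"
      using powr_term_bound[of _ ?k _ "U x" 1] abs_coeff_bounds(1)[OF \<rho>_pos] U_pos[of x] by simp
  qed
  also have "\<dots> = 2 * (?k * (C0 ^ 4 * (rel y h)\<^sup>2) * W x)" by simp
  also have "\<dots> \<le> 15 * (?k * (C0 ^ 4 * (rel y h)\<^sup>2) * W x)"
    using \<rho>_pos C0_ge_1 W_pos[of x] by (intro mult_right_mono) auto
  finally show ?thesis by (simp add: mult_ac)
qed

definition W3 :: "real ^ 'a \<Rightarrow> real ^ 'a \<Rightarrow> real" where
  "W3 x h = \<rho> * (\<rho> - 1) * (\<rho> - 2) * U x powr (\<rho> - 3) * P [h] x ^ 3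
    + 3 * (\<rho> * (\<rho> - 1) * U x powr (\<rho> - 2) * (P [h] x * P [h, h] x))
    + \<rho> * U x powr (\<rho> - 1) * P [h, h, h] x"

definition W4 :: "real ^ 'a \<Rightarrow> real ^ 'a \<Rightarrow> real" where
  "W4 x h = \<rho> * (\<rho> - 1) * (\<rho> - 2) * (\<rho> - 3) * U x powr (\<rho> - 4) * P [h] x ^ 4
        + 6 * (\<rho> * (\<rho> - 1) * (\<rho> - 2) * U x powr (\<rho> - 3) * ((P [h] x)\<^sup>2 * P [h, h] x))
        + \<rho> * (\<rho> - 1) * U x powr (\<rho> - 2) * (3 * (P [h, h] x)\<^sup>2 + 4 * (P [h] x * P [h, h, h] x))
        + \<rho> * U x powr (\<rho> - 1) * P [h, h, h, h] x"

lemma W_derivatives: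
  "((\<lambda>s. W (y + s *\<^sub>R h)) has_real_derivative W1 (y + s *\<^sub>R h) h) (at s)"
  "((\<lambda>s. W1 (y + s *\<^sub>R h) h) has_real_derivative W2 (y + s *\<^sub>R h) h) (at s)"
  "((\<lambda>s. W2 (y + s *\<^sub>R h) h) has_real_derivative W3 (y + s *\<^sub>R h) h) (at s)"
  "((\<lambda>s. W3 (y + s *\<^sub>R h) h) has_real_derivative W4 (y + s *\<^sub>R h) h) (at s)"
proof -
  have D: "((\<lambda>s. P [h] (y + s *\<^sub>R h)) has_real_derivative P [h, h] (y + s *\<^sub>R h)) (at s)"
    "((\<lambda>s. P [h, h] (y + s *\<^sub>R h)) has_real_derivative P [h, h, h] (y + s *\<^sub>R h)) (at s)"
    "((\<lambda>s. P [h, h, h] (y + s *\<^sub>R h)) has_real_derivative P [h, h, h, h] (y + s *\<^sub>R h)) (at s)" for s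
    using P_derivative[of "[h]" y h s] P_derivative[of "[h,h]" y h s]
      P_derivative[of "[h,h,h]" y h s] by simp_all
  note PD = powr_derivatives[OF U_pos U_derivative[of y h] D, where \<rho> = \<rho>]
  show "((\<lambda>s. W (y + s *\<^sub>R h)) has_real_derivative W1 (y + s *\<^sub>R h) h) (at s)"
    unfolding W_def W1_def by (rule PD(1))
  show "((\<lambda>s. W1 (y + s *\<^sub>R h) h) has_real_derivative W2 (y + s *\<^sub>R h) h) (at s)"
    unfolding W1_def W2_def by (rule PD(2))
  show "((\<lambda>s. W2 (y + s *\<^sub>R h) h) has_real_derivative W3 (y + s *\<^sub>R h) h) (at s)"
    unfolding W2_def W3_def by (rule PD(3))
  show "((\<lambda>s. W3 (y + s *\<^sub>R h) h) has_real_derivative W4 (y + s *\<^sub>R h) h) (at s)"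
    unfolding W3_def W4_def by (rule PD(4))
qed

lemma W4_le:
  assumes near: "u y / 2 \<le> u x"
  shows "\<bar>W4 x h\<bar> \<le> 15 * (\<rho> + 4) ^ 4 * C0 ^ 4 * rel y h ^ 4 * W x"
proof -
  note P = P_le[OF near]
  let ?k = "(\<rho> + 4) ^ 4"
  let ?r = "rel y h"
  let ?Z = "C0 ^ 4 * ?r ^ 4"
  have Z: "C0 ^ i * ?r ^ 4 \<le> ?Z" if "i \<le> 4" for i
    using that by (intro mult_right_mono C0_pow) (auto simp: rel_nonneg)
  note coeff = abs_coeff_bounds[OF \<rho>_pos]
  have 1: "\<bar>P [h] x ^ 4\<bar> \<le> U x ^ 4 * ?Z"
  proof -
    have "\<bar>P [h] x ^ 4\<bar> \<le> (U x * (C0 * ?r)) ^ 4"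
      unfolding power_abs by (intro power_mono P) auto
    also have "\<dots> = U x ^ 4 * ?Z" unfolding power_mult_distrib ..
    finally show ?thesis .
  qed
  have 2: "\<bar>(P [h] x)\<^sup>2 * P [h, h] x\<bar> \<le> U x ^ 3 * ?Z"
  proof -
    have "\<bar>(P [h] x)\<^sup>2 * P [h, h] x\<bar> \<le> (U x * (C0 * ?r))\<^sup>2 * (U x * (C0 * (?r * ?r)))"
      by (intro abs_mult_le_mono P, unfold power_abs, intro power_mono P) auto
    also have "\<dots> = U x ^ 3 * (C0 ^ 3 * ?r ^ 4)" by (rule cubic_identity1)
    also have "\<dots> \<le> U x ^ 3 * ?Z" using U_pos[of x] by (intro mult_left_mono Z) auto
    finally show ?thesis .
  qed
  have 3: "\<bar>3 * (P [h, h] x)\<^sup>2 + 4 * (P [h] x * P [h, h, h] x)\<bar> \<le> U x ^ 2 * (7 * ?Z)"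
  proof -
    have "\<bar>3 * (P [h, h] x)\<^sup>2 + 4 * (P [h] x * P [h, h, h] x)\<bar> \<le>
      3 * (U x * (C0 * (?r * ?r)))\<^sup>2 + 4 * ((U x * (C0 * ?r)) * (U x * (C0 * (?r * (?r * ?r)))))"
      by (intro abs_add_le_mono abs_mult_le_mono P, simp, unfold power_abs, intro power_mono P) auto
    also have "\<dots> = U x ^ 2 * (7 * (C0 ^ 2 * ?r ^ 4))"
      by (simp add: eval_nat_numeral mult_ac)
    also have "\<dots> \<le> U x ^ 2 * (7 * ?Z)" using U_pos[of x] by (intro mult_left_mono Z) auto
    finally show ?thesis .
  qed
  have 4: "\<bar>P [h, h, h, h] x\<bar> \<le> U x ^ 1 * ?Z"
  proof -
    have "\<bar>P [h, h, h, h] x\<bar> \<le> U x * (C0 * (?r * (?r * (?r * ?r))))" by (rule P)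
    also have "\<dots> = U x ^ 1 * (C0 ^ 1 * ?r ^ 4)" by (simp add: eval_nat_numeral)
    also have "\<dots> \<le> U x ^ 1 * ?Z" using U_pos[of x] by (intro mult_left_mono Z) auto
    finally show ?thesis .
  qed
  have "\<bar>W4 x h\<bar> \<le> ?k * ?Z * W x + 6 * (?k * ?Z * W x) + ?k * (7 * ?Z) * W x + ?k * ?Z * W x"
    unfolding W4_def W_def
    by (intro abs_add_le_mono abs_mult_le_mono[where A = 6])
      (use powr_term_bound[OF coeff(4) 1 U_pos, of \<rho>] powr_term_bound[OF coeff(3) 2 U_pos, of \<rho>]
          powr_term_bound[OF coeff(2) 3 U_pos, of \<rho>] powr_term_bound[OF coeff(1) 4 U_pos, of \<rho>] in simp_all)
  then show ?thesis by (simp add: mult_ac)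
qed

lemma W2_derivative_mixed:
  "((\<lambda>s. W2 (y + s *\<^sub>R a) b) has_real_derivative
    (let x = y + s *\<^sub>R a in
      \<rho> * (\<rho> - 1) * (\<rho> - 2) * U x powr (\<rho> - 3) * (P [a] x * (P [b] x)\<^sup>2)
      + \<rho> * (\<rho> - 1) * U x powr (\<rho> - 2) * (2 * (P [b] x * P [b, a] x) + P [a] x * P [b, b] x)
      + \<rho> * U x powr (\<rho> - 1) * P [b, b, a] x)) (at s)"
proof -
  have D: "((\<lambda>s. U (y + s *\<^sub>R a) powr r) has_real_derivative
      r * U (y + s *\<^sub>R a) powr (r - 1) * P [a] (y + s *\<^sub>R a)) (at s)" for r
    by (rule has_real_derivative_powr_chain[OF U_derivative U_pos])
  have E: "((\<lambda>s. P [b] (y + s *\<^sub>R a)) has_real_derivative P [b, a] (y + s *\<^sub>R a)) (at s)"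
    "((\<lambda>s. P [b, b] (y + s *\<^sub>R a)) has_real_derivative P [b, b, a] (y + s *\<^sub>R a)) (at s)"
    using P_derivative[of "[b]" y a s] P_derivative[of "[b,b]" y a s] by simp_all
  show ?thesis
    unfolding W2_def Let_def
    by (rule derivative_eq_intros D[of "\<rho> - 1"] D[of "\<rho> - 2"] E refl)+
      (simp add: algebra_simps power2_eq_square)
qed

text \<open>The noise b is expanded around y + a, the point reached by the drift. Moving its
  quadratic term back to y costs one derivative in direction a, hence a third-order term that is
  linear in a and quadratic in b.\<close>

lemma W2_shift:
  assumes small: "Lip * norm a \<le> u y / 2"
  shows "\<bar>W2 (y + a) b - W2 y b\<bar> \<le> C1 * (rel y a * (rel y b)\<^sup>2) * W y"
proof -
  let ?D = "\<lambda>x. \<rho> * (\<rho> - 1) * (\<rho> - 2) * U x powr (\<rho> - 3) * (P [a] x * (P [b] x)\<^sup>2)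
      + \<rho> * (\<rho> - 1) * U x powr (\<rho> - 2) * (2 * (P [b] x * P [b, a] x) + P [a] x * P [b, b] x)
      + \<rho> * U x powr (\<rho> - 1) * P [b, b, a] x"
  obtain s where s: "0 < s" "s < 1" "W2 (y + 1 *\<^sub>R a) b - W2 (y + 0 *\<^sub>R a) b = (1 - 0) * ?D (y + s *\<^sub>R a)"
    using MVT2[of 0 1 "\<lambda>s. W2 (y + s *\<^sub>R a) b", OF _ W2_derivative_mixed] by (auto simp: Let_def)
  define x where "x = y + s *\<^sub>R a"
  have "Lip * norm (s *\<^sub>R a) \<le> Lip * norm a"
    using s Lip_pos by (intro mult_left_mono) (auto simp: mult_left_le_one_le)
  then have "Lip * norm (s *\<^sub>R a) \<le> u y / 2" using small by linarith
  note near = near_bounds[OF this, folded x_def]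
  note P = P_le[OF near(1)]
  let ?k = "(\<rho> + 4) ^ 4"
  let ?R = "rel y a * (rel y b)\<^sup>2"
  let ?Z = "C0 ^ 4 * ?R"
  have Z: "C0 ^ i * ?R \<le> ?Z" if "i \<le> 4" for i
    using that by (intro mult_right_mono C0_pow mult_nonneg_nonneg) (auto simp: rel_nonneg)
  have Z0: "0 \<le> ?Z" using C0_ge_1 by (intro mult_nonneg_nonneg) (auto simp: rel_nonneg)
  note coeff = abs_coeff_bounds[OF \<rho>_pos]
  have 1: "\<bar>P [a] x * (P [b] x)\<^sup>2\<bar> \<le> U x ^ 3 * ?Z"
  proof -
    have "\<bar>P [a] x * (P [b] x)\<^sup>2\<bar> \<le> (U x * (C0 * rel y a)) * (U x * (C0 * rel y b))\<^sup>2"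
      by (intro abs_mult_le_mono P, unfold power_abs, intro power_mono P) auto
    also have "\<dots> = U x ^ 3 * (C0 ^ 3 * ?R)" by (rule cubic_identity2)
    also have "\<dots> \<le> U x ^ 3 * ?Z" using U_pos[of x] by (intro mult_left_mono Z) auto
    finally show ?thesis .
  qed
  have 2: "\<bar>2 * (P [b] x * P [b, a] x) + P [a] x * P [b, b] x\<bar> \<le> U x ^ 2 * (3 * ?Z)"
  proof -
    have "\<bar>2 * (P [b] x * P [b, a] x) + P [a] x * P [b, b] x\<bar> \<le>
      2 * ((U x * (C0 * rel y b)) * (U x * (C0 * (rel y b * rel y a))))
       + (U x * (C0 * rel y a)) * (U x * (C0 * (rel y b * rel y b)))"
      by (intro abs_add_le_mono abs_mult_le_mono P) simp
    also have "\<dots> = U x ^ 2 * (3 * (C0 ^ 2 * ?R))" by (simp add: eval_nat_numeral mult_ac)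
    also have "\<dots> \<le> U x ^ 2 * (3 * ?Z)" using U_pos[of x] by (intro mult_left_mono Z) auto
    finally show ?thesis .
  qed
  have 3: "\<bar>P [b, b, a] x\<bar> \<le> U x ^ 1 * ?Z"
  proof -
    have "\<bar>P [b, b, a] x\<bar> \<le> U x * (C0 * (rel y b * (rel y b * rel y a)))" by (rule P)
    also have "\<dots> = U x ^ 1 * (C0 ^ 1 * ?R)" by (simp add: eval_nat_numeral mult_ac)
    also have "\<dots> \<le> U x ^ 1 * ?Z" using U_pos[of x] by (intro mult_left_mono Z) auto
    finally show ?thesis .
  qed
  have "\<bar>?D x\<bar> \<le> ?k * ?Z * W x + ?k * (3 * ?Z) * W x + ?k * ?Z * W x"
    unfolding W_def
    by (intro abs_add_le_mono)
      (use powr_term_bound[OF coeff(3) 1 U_pos, of \<rho>] powr_term_bound[OF coeff(2) 2 U_pos, of \<rho>]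
         powr_term_bound[OF coeff(1) 3 U_pos, of \<rho>] in simp_all)
  also have "\<dots> = 5 * (?k * ?Z * W x)" by simp
  also have "\<dots> \<le> 15 * (?k * ?Z * W x)"
    using \<rho>_pos Z0 W_pos[of x] by (intro mult_right_mono mult_nonneg_nonneg) auto
  finally have "\<bar>?D x\<bar> \<le> 15 * ?k * C0 ^ 4 * ?R * W x" by (simp add: mult_ac)
  from C1_bound[OF this near(2)] show ?thesis
    using s(3) rel_nonneg unfolding x_def by simp
qed

section \<open>Taylor expansion of W over one step, for steps below and above the length
  scale\<close>

lemma W_first_order:
  assumes small: "Lip * norm a \<le> u y / 2"
  shows "\<bar>W (y + a) - W y - W1 y a\<bar> \<le> C1 * (rel y a)\<^sup>2 * W y"
proof -
  \<comment> \<open>A list lookup packs the successive derivatives into one family indexed by the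
    order, the form in which Maclaurin's formula takes them.\<close>
  define d where "d m = (\<lambda>s. [W (y + s *\<^sub>R a), W1 (y + s *\<^sub>R a) a, W2 (y + s *\<^sub>R a) a] ! m)" for m :: nat
  have "\<forall>m t. m < 2 \<and> \<bar>t\<bar> \<le> \<bar>1::real\<bar> \<longrightarrow> DERIV (d m) t :> d (Suc m) t"
    using W_derivatives(1,2)[of y a] unfolding d_def
    by (auto simp: less_2_cases_iff)
  from Maclaurin_bi_le[OF refl this]
  obtain t where t: "\<bar>t\<bar> \<le> 1" "d 0 1 = (\<Sum>m<2. d m 0 / fact m * 1 ^ m) + d 2 t / fact 2 * 1 ^ 2"
    by auto
  then have eq: "W (y + a) - W y - W1 y a = W2 (y + t *\<^sub>R a) a / 2"
    by (simp add: d_def numeral_2_eq_2)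
  have "Lip * norm (t *\<^sub>R a) \<le> Lip * norm a"
    using t(1) Lip_pos by (intro mult_left_mono) (auto simp: mult_left_le_one_le)
  then have "Lip * norm (t *\<^sub>R a) \<le> u y / 2" using small by linarith
  note near = near_bounds[OF this]
  have "\<bar>W2 (y + t *\<^sub>R a) a\<bar> \<le> C1 * (rel y a)\<^sup>2 * W y"
    by (rule C1_bound[OF W2_le[OF near(1)] near(2)]) simp
  then show ?thesis unfolding eq by simp
qed

lemma W_third_order:
  assumes small: "Lip * (norm a + norm b) \<le> u y / 2"
  shows "\<bar>W (y + a + b) - (W (y + a) + W1 (y + a) b + W2 (y + a) b / 2 + W3 (y + a) b / 6)\<bar>
    \<le> C1 * rel y b ^ 4 * W y"
proof -
  define d where "d m = (\<lambda>s. [W (y + a + s *\<^sub>R b), W1 (y + a + s *\<^sub>R b) b, W2 (y + a + s *\<^sub>R b) b,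
    W3 (y + a + s *\<^sub>R b) b, W4 (y + a + s *\<^sub>R b) b] ! m)" for m :: nat
  have "m = 0 \<or> m = 1 \<or> m = 2 \<or> m = 3" if "m < 4" for m :: nat using that by linarith
  then have "\<forall>m t. m < 4 \<and> \<bar>t\<bar> \<le> \<bar>1::real\<bar> \<longrightarrow> DERIV (d m) t :> d (Suc m) t"
    using W_derivatives[of "y + a" b] unfolding d_def
    by (fastforce simp: eval_nat_numeral)
  from Maclaurin_bi_le[OF refl this]
  obtain t where t: "\<bar>t\<bar> \<le> 1" "d 0 1 = (\<Sum>m<4. d m 0 / fact m * 1 ^ m) + d 4 t / fact 4 * 1 ^ 4"
    by auto
  then have eq: "W (y + a + b) - (W (y + a) + W1 (y + a) b + W2 (y + a) b / 2 + W3 (y + a) b / 6)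
      = W4 (y + a + t *\<^sub>R b) b / 24"
    by (simp add: d_def eval_nat_numeral fact_numeral)
  have "norm (a + t *\<^sub>R b) \<le> norm a + \<bar>t\<bar> * norm b" using norm_triangle_ineq[of a "t *\<^sub>R b"] by simp
  also have "\<dots> \<le> norm a + norm b" using t(1) by (simp add: mult_left_le_one_le)
  finally have "Lip * norm (a + t *\<^sub>R b) \<le> Lip * (norm a + norm b)"
    using Lip_pos by (intro mult_left_mono) auto
  then have "Lip * norm (a + t *\<^sub>R b) \<le> u y / 2" using small by linarith
  note near = near_bounds[OF this, unfolded add.assoc[symmetric]]
  have "\<bar>W4 (y + a + t *\<^sub>R b) b\<bar> \<le> C1 * rel y b ^ 4 * W y"
    by (rule C1_bound[OF W4_le[OF near(1)] near(2)]) (simp add: rel_nonneg)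
  then show ?thesis unfolding eq by simp
qed

lemma mixed_deriv_uminus:
  "P [- h] x = - P [h] x" "P [- h, - h] x = P [h, h] x" "P [- h, - h, - h] x = - P [h, h, h] x"
  by (simp_all add: mixed_deriv.simps(2) sum_negf)

lemma W_uminus: "W1 x (- h) = - W1 x h" "W2 x (- h) = W2 x h" "W3 x (- h) = - W3 x h"
  unfolding W1_def W2_def W3_def mixed_deriv_uminus by (simp_all add: algebra_simps)

text \<open>W is expanded to first order in the drift a at y, and in the noise b at y + a with a
  remainder of order four. Averaging over b and -b cancels the first and third derivatives at y + a,
  so only the quadratic term has to be moved back to y.\<close>

lemma Taylor_small:
  assumes small: "Lip * (norm a + norm b) \<le> u y / 2"
  shows "(W (y + a + b) + W (y + a - b)) / 2 \<le> W y + W1 y a + W2 y b / 2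
    + 3 * C1 * W y * ((rel y a)\<^sup>2 + rel y b ^ 4)"
proof -
  let ?A = "rel y a" and ?B = "rel y b"
  have C1: "0 \<le> C1 * W y" using W_pos[of y] \<rho>_pos C0_ge_1 unfolding C1_def by simp
  have "Lip * norm a \<le> Lip * (norm a + norm b)" using Lip_pos by (intro mult_left_mono) auto
  then have small_a: "Lip * norm a \<le> u y / 2" using small by linarith
  have 1: "W (y + a) \<le> W y + W1 y a + C1 * ?A\<^sup>2 * W y"
    using W_first_order[OF small_a] by linarith
  have 2: "W2 (y + a) b \<le> W2 y b + C1 * (?A * ?B\<^sup>2) * W y"
    using W2_shift[OF small_a, of b] by linarith
  have 3: "W (y + a + b) \<le> W (y + a) + W1 (y + a) b + W2 (y + a) b / 2 + W3 (y + a) b / 6 + C1 * ?B ^ 4 * W y"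
    using W_third_order[OF small] by linarith
  have 4: "W (y + a - b) \<le> W (y + a) - W1 (y + a) b + W2 (y + a) b / 2 - W3 (y + a) b / 6 + C1 * ?B ^ 4 * W y"
    using W_third_order[of a "- b" y] small by (simp add: W_uminus)
  \<comment> \<open>Young's inequality distributes the mixed term over the square of the drift and
    the fourth power of the noise.\<close>
  have "r * q\<^sup>2 \<le> (r\<^sup>2 + q ^ 4) / 2" for r q :: real
    using zero_le_power2[of "r - q\<^sup>2"] by (simp add: power2_diff)
  from this[of ?A ?B] have "?A * ?B\<^sup>2 \<le> (?A\<^sup>2 + ?B ^ 4) / 2" .
  then have "(C1 * W y) * (?A * ?B\<^sup>2) \<le> (C1 * W y) * ((?A\<^sup>2 + ?B ^ 4) / 2)"
    by (rule mult_left_mono[OF _ C1])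
  moreover have "0 \<le> (C1 * W y) * ?A\<^sup>2" "0 \<le> (C1 * W y) * ?B ^ 4"
    by (intro mult_nonneg_nonneg C1; simp add: rel_nonneg)+
  ultimately show ?thesis using 1 2 3 4 by (simp add: algebra_simps)
qed

text \<open>Pays for the value of W after the step and for the possibly negative terms W1 and W2,
  both of absolute value at most \<open>15 * (\<rho> + 4) ^ 4 * C0 ^ 4\<close> times R^N W, where R
  is the majorant of the next proof.\<close>

definition C2 :: real where "C2 = 2 + 15 * (\<rho> + 4) ^ 4 * C0 ^ 4 * 2"

text \<open>Beyond the length scale the sum of the relative sizes is bounded below, so every
  constant is dominated by a power of it. Since u is Lipschitz and W = u^(\<rho>/\<delta>), the
  growth of W is at most that power as soon as N >= \<rho>/\<delta>. W1 and W2 are kept on the right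
  so that the bound has the shape of the one for small steps.\<close>

lemma Taylor_large:
  assumes large: "u y / 2 < Lip * (norm a + norm b)" and N: "\<rho> / \<delta> \<le> real N" "2 \<le> N"
  shows "(W (y + a + b) + W (y + a - b)) / 2 \<le> W y + W1 y a + W2 y b / 2
    + C2 * (1 + 3 * Lip) ^ N * 2 ^ N * W y * (rel y a ^ N + rel y b ^ N)"
proof -
  let ?A = "rel y a" and ?B = "rel y b"
  let ?L = "1 + 3 * Lip"
  \<comment> \<open>As Lip (A + B) > 1/2, two of the three summands Lip (A + B) exceed 1 and the
    third remains, so R >= 1 + Lip (A + B), the growth factor of u. The summand 1 in ?L makes R at
    least A and B.\<close>
  define R where "R = ?L * (?A + ?B)"
  have AB: "0 \<le> ?A" "0 \<le> ?B" by (rule rel_nonneg)+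
  have half: "1 / 2 < Lip * (?A + ?B)"
    using large u_pos[of y] by (simp add: field_simps)
  have R1: "1 + Lip * (?A + ?B) \<le> R" "1 \<le> R"
  proof -
    have "R = (?A + ?B) + 3 * (Lip * (?A + ?B))" by (simp add: R_def algebra_simps)
    with half AB show "1 + Lip * (?A + ?B) \<le> R" by linarith
    with half show "1 \<le> R" by linarith
  qed
  have AR: "?A \<le> R" "?B \<le> R"
    unfolding R_def using AB Lip_pos by (simp_all add: algebra_simps)
  have R0: "0 \<le> R" using R1 by simp
  have RN: "R \<le> R ^ N" "R\<^sup>2 \<le> R ^ N" "1 \<le> R ^ N"
    using power_increasing[of 1 N R] power_increasing[of 2 N R] N(2) R1 by auto
  have Wle: "W (y + h) \<le> R ^ N * W y" if "norm h \<le> norm a + norm b" for h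
  proof -
    have "u (y + h) \<le> u y + Lip * norm h" using u_lipschitz[of y h] by linarith
    also have "\<dots> \<le> u y + Lip * (norm a + norm b)"
      using that Lip_pos by simp
    also have "\<dots> = u y * (1 + Lip * (?A + ?B))" by (simp add: field_simps)
    also have "\<dots> \<le> u y * R" using u_pos[of y] by (intro mult_left_mono R1) auto
    finally have "u (y + h) powr (\<rho> / \<delta>) \<le> (u y * R) powr (\<rho> / \<delta>)"
      using \<rho>_pos \<delta>_pos u_pos[of "y + h"] by (intro powr_mono2) auto
    also have "\<dots> = W y * R powr (\<rho> / \<delta>)"
      unfolding W_eq_u using u_pos[of y] R0 by (simp add: powr_mult)
    also have "\<dots> \<le> W y * R powr (real N)"
      using W_pos[of y] R1(2) N by (intro mult_left_mono powr_mono) auto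
    also have "\<dots> = R ^ N * W y" using R1 by (simp add: powr_realpow)
    finally show ?thesis unfolding W_eq_u by simp
  qed
  have plus: "W (y + a + b) \<le> R ^ N * W y"
    using Wle[of "a + b"] norm_triangle_ineq[of a b] by (simp add: add.assoc)
  have minus: "W (y + a - b) \<le> R ^ N * W y"
    using Wle[of "a - b"] norm_triangle_ineq4[of a b] by (simp add: algebra_simps)
  let ?K = "15 * (\<rho> + 4) ^ 4 * C0 ^ 4"
  have K: "0 \<le> ?K" using \<rho>_pos C0_ge_1 by simp
  have w1: "\<bar>W1 y a\<bar> \<le> ?K * R ^ N * W y"
  proof -
    have "\<bar>P [a] y\<bar> \<le> U y * (C0 * ?A)" using u_pos[of y] by (intro P_le) auto
    also have "\<dots> \<le> U y ^ 1 * (C0 ^ 4 * R)"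
      using U_pos[of y] C0_ge_1 C0_pow[of 1 4] AB AR
      unfolding power_one_right by (intro mult_mono) auto
    finally have "\<bar>W1 y a\<bar> \<le> (\<rho> + 4) ^ 4 * (C0 ^ 4 * R) * W y"
      unfolding W1_def W_def using powr_term_bound[of _ "(\<rho> + 4) ^ 4" _ "U y" 1]
        abs_coeff_bounds(1)[OF \<rho>_pos] U_pos[of y] by simp
    also have "\<dots> \<le> (\<rho> + 4) ^ 4 * (C0 ^ 4 * R ^ N) * W y"
      using C0_ge_1 \<rho>_pos W_pos[of y] RN by (intro mult_right_mono mult_left_mono) auto
    also have "\<dots> = (\<rho> + 4) ^ 4 * C0 ^ 4 * R ^ N * W y" by simp
    also have "\<dots> \<le> ?K * R ^ N * W y"
      using C0_ge_1 \<rho>_pos W_pos[of y] R0 by (intro mult_right_mono) auto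
    finally show ?thesis .
  qed
  have w2: "\<bar>W2 y b\<bar> \<le> ?K * R ^ N * W y"
  proof -
    have "\<bar>W2 y b\<bar> \<le> ?K * ?B\<^sup>2 * W y" using u_pos[of y] by (intro W2_le) simp
    also have "\<dots> \<le> ?K * R ^ N * W y"
      using K W_pos[of y] power_mono[OF AR(2) AB(2), of 2] RN(2)
      by (intro mult_right_mono mult_left_mono) auto
    finally show ?thesis .
  qed
  have "(W (y + a + b) + W (y + a - b)) / 2 \<le> R ^ N * W y" using plus minus by simp
  also have "\<dots> \<le> W y + W1 y a + W2 y b / 2 + C2 * R ^ N * W y"
  proof -
    have "0 \<le> R ^ N * W y" using W_pos[of y] R0 by simp
    moreover have "C2 * R ^ N * W y = 2 * (R ^ N * W y) + 2 * (?K * R ^ N * W y)"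
      unfolding C2_def by (simp add: algebra_simps)
    ultimately show ?thesis using w1 w2 W_pos[of y] by linarith
  qed
  also have "R ^ N \<le> ?L ^ N * (2 ^ N * (?A ^ N + ?B ^ N))"
  proof -
    have "(?A + ?B) ^ N \<le> (2 * max ?A ?B) ^ N" using AB by (intro power_mono) auto
    also have "\<dots> = 2 ^ N * max ?A ?B ^ N" by (simp add: power_mult_distrib)
    also have "\<dots> \<le> 2 ^ N * (?A ^ N + ?B ^ N)"
      using AB by (intro mult_left_mono) (auto simp: max_def)
    finally show ?thesis
      unfolding R_def power_mult_distrib using Lip_pos by (intro mult_left_mono) auto
  qed
  then have "C2 * R ^ N * W y \<le> C2 * (?L ^ N * (2 ^ N * (?A ^ N + ?B ^ N))) * W y"
    using K W_pos[of y] unfolding C2_def by (intro mult_right_mono mult_left_mono) auto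
  finally show ?thesis by (simp add: mult_ac)
qed

lemma Taylor:
  assumes N: "\<rho> / \<delta> \<le> real N" "2 \<le> N"
  obtains C where "0 \<le> C" "\<And>y a b. (W (y + a + b) + W (y + a - b)) / 2 \<le> W y + W1 y a + W2 y b / 2
    + C * W y * ((rel y a)\<^sup>2 + rel y a ^ N + rel y b ^ 4 + rel y b ^ N)"
proof
  let ?C = "3 * C1 + C2 * (1 + 3 * Lip) ^ N * 2 ^ N"
  have pos: "0 \<le> 3 * C1" "0 \<le> C2 * (1 + 3 * Lip) ^ N * 2 ^ N"
    unfolding C1_def C2_def using \<rho>_pos C0_ge_1 Lip_pos by auto
  then show "0 \<le> ?C" by simp
  fix y a b
  have r: "0 \<le> rel y a" "0 \<le> rel y b" by (rule rel_nonneg)+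
  let ?S = "(rel y a)\<^sup>2 + rel y a ^ N + rel y b ^ 4 + rel y b ^ N"
  have "3 * C1 * W y * ((rel y a)\<^sup>2 + rel y b ^ 4) \<le> ?C * W y * ?S"
    using pos W_pos[of y] r by (intro mult_mono) (auto intro!: mult_nonneg_nonneg add_nonneg_nonneg)
  moreover have "C2 * (1 + 3 * Lip) ^ N * 2 ^ N * W y * (rel y a ^ N + rel y b ^ N) \<le> ?C * W y * ?S"
    using pos W_pos[of y] r by (intro mult_mono) (auto intro!: mult_nonneg_nonneg add_nonneg_nonneg)
  ultimately show "(W (y + a + b) + W (y + a - b)) / 2 \<le> W y + W1 y a + W2 y b / 2 + ?C * W y * ?S"
    using Taylor_small[of a b y] Taylor_large[of y a b, OF _ N] by linarith
qed

end

section \<open>Gaussian increments\<close>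

lemma Basis_vec_eq_range: "(Basis :: (real ^ 'm::finite) set) = range (\<lambda>i. axis i 1)"
  by (auto simp: Basis_vec_def)

lemma inj_axis_1: "inj (\<lambda>i::'m::finite. axis i (1::real))"
  by (auto simp: inj_on_def axis_eq_axis)

lemma nn_integral_lborel_vec_prod:
  fixes h :: "'m::finite \<Rightarrow> real \<Rightarrow> ennreal"
  assumes [measurable]: "\<And>i. h i \<in> borel_measurable borel"
  shows "(\<integral>\<^sup>+ x. (\<Prod>i\<in>UNIV. h i (x $ i)) \<partial>(lborel :: (real ^ 'm) measure)) = (\<Prod>i\<in>UNIV. \<integral>\<^sup>+ x. h i x \<partial>lborel)"
proof -
  define idx where "idx = inv (\<lambda>i::'m. axis i (1::real))"
  have idx [simp]: "idx (axis i 1) = i" for i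
    unfolding idx_def by (rule inv_f_f[OF inj_axis_1])
  have "(\<integral>\<^sup>+ x. (\<Prod>b\<in>Basis. h (idx b) (x \<bullet> b)) \<partial>(lborel :: (real ^ 'm) measure)) = (\<Prod>b\<in>(Basis :: (real ^ 'm) set). \<integral>\<^sup>+ x. h (idx b) x \<partial>lborel)"
    by (rule nn_integral_lborel_prod) auto
  then show ?thesis
    by (simp add: Basis_vec_eq_range prod.reindex[OF inj_axis_1] inner_axis)
qed

definition gauss :: "real \<Rightarrow> (real ^ 'm::finite) measure" where
  "gauss \<tau> = density lborel (\<lambda>x. ennreal (\<Prod>i\<in>UNIV. normal_density 0 (sqrt \<tau>) (x $ i)))"

lemma sets_gauss [measurable_cong, simp]: "sets (gauss \<tau>) = sets borel"
  by (simp add: gauss_def)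

lemma space_gauss [simp]: "space (gauss \<tau>) = UNIV"
  by (simp add: gauss_def)

lemma nn_integral_gauss_prod:
  fixes h :: "'m::finite \<Rightarrow> real \<Rightarrow> ennreal"
  assumes [measurable]: "\<And>i. h i \<in> borel_measurable borel"
  shows "(\<integral>\<^sup>+ x. (\<Prod>i\<in>UNIV. h i (x $ i)) \<partial>gauss \<tau>) =
    (\<Prod>i\<in>UNIV. \<integral>\<^sup>+ x. ennreal (normal_density 0 (sqrt \<tau>) x) * h i x \<partial>lborel)"
proof -
  have "(\<integral>\<^sup>+ x. (\<Prod>i\<in>UNIV. h i (x $ i)) \<partial>gauss \<tau>) =
     (\<integral>\<^sup>+ x. (\<Prod>i\<in>UNIV. ennreal (normal_density 0 (sqrt \<tau>) (x $ i)) * h i (x $ i)) \<partial>lborel)"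
    unfolding gauss_def by (subst nn_integral_density) (auto simp: prod_ennreal[symmetric] prod.distrib)
  also have "\<dots> = (\<Prod>i\<in>UNIV. \<integral>\<^sup>+ x. ennreal (normal_density 0 (sqrt \<tau>) x) * h i x \<partial>lborel)"
    by (rule nn_integral_lborel_vec_prod) auto
  finally show ?thesis .
qed

lemma nn_integral_normal_density: "0 < \<tau> \<Longrightarrow> (\<integral>\<^sup>+ x. ennreal (normal_density 0 (sqrt \<tau>) x) \<partial>lborel) = 1"
  by (subst nn_integral_eq_integral) auto

lemma prob_space_gauss: "0 < \<tau> \<Longrightarrow> prob_space (gauss \<tau> :: (real ^ 'm::finite) measure)"
proof
  assume "0 < \<tau>"
  then have "(\<integral>\<^sup>+ x. (\<Prod>i\<in>(UNIV::'m set). (\<lambda>_ _. 1) i (x $ i)) \<partial>gauss \<tau>) = 1"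
    by (subst nn_integral_gauss_prod) (auto simp: nn_integral_normal_density)
  then show "emeasure (gauss \<tau>) (space (gauss \<tau> :: (real ^ 'm) measure)) = 1"
    by simp
qed

text \<open>The double factorial (2k-1)!!, the moment of order 2k of a standard normal
  variable.\<close>

definition gauss_moment :: "nat \<Rightarrow> real" where "gauss_moment k = fact (2 * k) / (2 ^ k * fact k)"

lemma gauss_moment_pos: "0 < gauss_moment k" by (simp add: gauss_moment_def)

lemma nn_integral_gauss_coord:
  assumes \<tau>: "0 < \<tau>"
  shows "(\<integral>\<^sup>+ x. ennreal (x $ i ^ (2 * k)) \<partial>(gauss \<tau> :: (real ^ 'm::finite) measure)) = ennreal (gauss_moment k * \<tau> ^ k)"
proof -
  have hb: "has_bochner_integral lborel (\<lambda>x. normal_density 0 (sqrt \<tau>) x * x ^ (2 * k)) (gauss_moment k * \<tau> ^ k)"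
    using normal_moment_even[of "sqrt \<tau>" 0 k] \<tau>
    by (simp add: gauss_moment_def power_divide mult_ac)
  let ?h = "\<lambda>j x. if j = i then ennreal (x ^ (2 * k)) else 1"
  have "(\<integral>\<^sup>+ x. ennreal (x $ i ^ (2 * k)) \<partial>gauss \<tau>) = (\<integral>\<^sup>+ x. (\<Prod>j\<in>UNIV. ?h j (x $ j)) \<partial>(gauss \<tau> :: (real ^ 'm) measure))"
    by (intro nn_integral_cong) (simp add: prod.delta)
  also have "\<dots> = (\<Prod>j\<in>(UNIV::'m set). \<integral>\<^sup>+ x. ennreal (normal_density 0 (sqrt \<tau>) x) * ?h j x \<partial>lborel)"
    by (rule nn_integral_gauss_prod) auto
  also have "\<dots> = (\<Prod>j\<in>(UNIV::'m set). if j = i then \<integral>\<^sup>+ x. ennreal (normal_density 0 (sqrt \<tau>) x * x ^ (2 * k)) \<partial>lborel else 1)"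
    by (intro prod.cong) (auto simp: nn_integral_normal_density[OF \<tau>] ennreal_mult)
  also have "\<dots> = (\<integral>\<^sup>+ x. ennreal (normal_density 0 (sqrt \<tau>) x * x ^ (2 * k)) \<partial>lborel)"
    by (simp add: prod.delta)
  also have "\<dots> = ennreal (gauss_moment k * \<tau> ^ k)"
    using hb by (subst nn_integral_eq_integral) (auto simp: has_bochner_integral_iff)
  finally show ?thesis .
qed

text \<open>The largest coordinate controls the norm up to a factor m in the square, and its even
  power is one of the summands on the right.\<close>

lemma norm_even_power_le:
  "norm (x :: real ^ 'm::finite) ^ (2 * k) \<le> real CARD('m) ^ k * (\<Sum>i\<in>UNIV. x $ i ^ (2 * k))"
proof -
  obtain j where j: "\<And>i. (x $ i)\<^sup>2 \<le> (x $ j)\<^sup>2"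
  proof -
    have "Max (range (\<lambda>i. (x $ i)\<^sup>2)) \<in> range (\<lambda>i. (x $ i)\<^sup>2)" by (rule Max_in) auto
    then obtain j where j: "Max (range (\<lambda>i. (x $ i)\<^sup>2)) = (x $ j)\<^sup>2" by (rule rangeE)
    have "(x $ i)\<^sup>2 \<le> Max (range (\<lambda>i. (x $ i)\<^sup>2))" for i by (rule Max_ge) auto
    then show ?thesis unfolding j by (rule that)
  qed
  have "norm x ^ 2 = (\<Sum>i\<in>UNIV. (x $ i)\<^sup>2)"
    by (simp add: norm_vec_def L2_set_def sum_nonneg)
  also have "\<dots> \<le> (\<Sum>i\<in>(UNIV::'m set). (x $ j)\<^sup>2)" by (intro sum_mono j)
  finally have "norm x ^ 2 \<le> real CARD('m) * (x $ j)\<^sup>2" by simp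
  then have "(norm x ^ 2) ^ k \<le> (real CARD('m) * (x $ j)\<^sup>2) ^ k" by (rule power_mono) simp
  then have "norm x ^ (2 * k) \<le> real CARD('m) ^ k * x $ j ^ (2 * k)"
    by (simp add: power_mult power_mult_distrib)
  also have "x $ j ^ (2 * k) \<le> (\<Sum>i\<in>UNIV. x $ i ^ (2 * k))"
    by (rule member_le_sum) auto
  finally show ?thesis by (simp add: mult_left_mono)
qed

text \<open>A function of the dimension, hence the type argument. The power m^k is the loss in
  \<open>norm_even_power_le\<close>, the further m counts the coordinates. The constant is crude: at
  k = 1 it is m^2, where the exact second moment of the norm is m \<tau>.\<close>

definition gauss_const :: "'m itself \<Rightarrow> nat \<Rightarrow> real" where
  "gauss_const _ k = real CARD('m) ^ k * (real CARD('m) * gauss_moment k)"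

lemma gauss_const_nonneg: "0 \<le> gauss_const TYPE('m) k"
  using gauss_moment_pos[of k] by (simp add: gauss_const_def)

lemma nn_integral_gauss_norm:
  assumes \<tau>: "0 < \<tau>"
  shows "(\<integral>\<^sup>+ x. ennreal (norm x ^ (2 * k)) \<partial>(gauss \<tau> :: (real ^ 'm::finite) measure))
    \<le> ennreal (gauss_const TYPE('m) k * \<tau> ^ k)"
proof -
  have "(\<integral>\<^sup>+ x. ennreal (norm x ^ (2 * k)) \<partial>(gauss \<tau> :: (real ^ 'm) measure)) \<le>
    (\<integral>\<^sup>+ x. ennreal (real CARD('m) ^ k) * (\<Sum>i\<in>UNIV. ennreal (x $ i ^ (2 * k))) \<partial>(gauss \<tau> :: (real ^ 'm) measure))"
    using norm_even_power_le
    by (intro nn_integral_mono) (simp add: sum_ennreal ennreal_mult[symmetric] sum_nonneg)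
  also have "\<dots> = ennreal (real CARD('m) ^ k) * (\<Sum>i\<in>(UNIV::'m set). ennreal (gauss_moment k * \<tau> ^ k))"
    by (simp add: nn_integral_cmult nn_integral_sum nn_integral_gauss_coord[OF \<tau>] del: sum_ennreal)
  also have "\<dots> = ennreal (gauss_const TYPE('m) k * \<tau> ^ k)"
    using \<tau> gauss_moment_pos[of k]
    by (simp add: gauss_const_def ennreal_of_nat_eq_real_of_nat ennreal_mult[symmetric] mult_ac)
  finally show ?thesis .
qed

lemma distr_lborel_flip:
  fixes \<sigma> :: "'m::finite \<Rightarrow> real"
  assumes \<sigma>: "\<And>i. \<bar>\<sigma> i\<bar> = 1"
  shows "distr lborel borel (\<lambda>x :: real ^ 'm. \<chi> i. \<sigma> i * x $ i) = lborel"
proof -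
  define idx where "idx = inv (\<lambda>i::'m. axis i (1::real))"
  have idx [simp]: "idx (axis i 1) = i" for i
    unfolding idx_def by (rule inv_f_f[OF inj_axis_1])
  have nz: "\<sigma> i \<noteq> 0" for i using \<sigma>[of i] by auto
  have T: "(\<Sum>j\<in>Basis. (\<sigma> (idx j) * (x \<bullet> j)) *\<^sub>R j) = (\<chi> i. \<sigma> i * x $ i)" for x :: "real ^ 'm"
    unfolding Basis_vec_eq_range sum.reindex[OF inj_axis_1] o_def
    by (simp add: inner_axis vec_eq_iff) (simp add: axis_def if_distrib cong: if_cong)
  have "lborel = density (distr lborel borel (\<lambda>x :: real ^ 'm. 0 + (\<Sum>j\<in>Basis. (\<sigma> (idx j) * (x \<bullet> j)) *\<^sub>R j)))
   (\<lambda>x. ennreal (\<Prod>j\<in>(Basis :: (real ^ 'm) set). \<bar>\<sigma> (idx j)\<bar>))"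
    by (rule lborel_affine_euclidean) (rule nz)
  then show ?thesis by (simp add: T \<sigma> density_1)
qed

text \<open>Used with all signs negative, to symmetrise in the increment, and with one sign
  negative, to make the mixed second moments vanish.\<close>

lemma distr_gauss_flip:
  fixes \<sigma> :: "'m::finite \<Rightarrow> real"
  assumes \<sigma>: "\<And>i. \<bar>\<sigma> i\<bar> = 1"
  shows "distr (gauss \<tau>) borel (\<lambda>x. \<chi> i. \<sigma> i * x $ i) = gauss \<tau>"
proof -
  let ?T = "\<lambda>x :: real ^ 'm. \<chi> i. \<sigma> i * x $ i"
  have [measurable]: "?T \<in> borel_measurable borel"
    by (intro borel_measurable_continuous_onI continuous_intros)
  let ?g = "\<lambda>x :: real ^ 'm. ennreal (\<Prod>i\<in>UNIV. normal_density 0 (sqrt \<tau>) (x $ i))"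
  have "(\<sigma> i * z)\<^sup>2 = z\<^sup>2" for i z
    using \<sigma>[of i] by (metis abs_mult mult_1 power2_abs)
  then have g: "?g (?T x) = ?g x" for x by (simp add: normal_density_def)
  show ?thesis
  proof (rule measure_eqI)
    fix A :: "(real ^ 'm) set" assume "A \<in> sets (distr (gauss \<tau>) borel ?T)"
    then have [measurable]: "A \<in> sets borel" by simp
    have "emeasure (gauss \<tau>) A = (\<integral>\<^sup>+ x. ?g x * indicator A x \<partial>distr lborel borel ?T)"
      unfolding gauss_def distr_lborel_flip[OF \<sigma>] by (rule emeasure_density) auto
    also have "\<dots> = (\<integral>\<^sup>+ x. ?g (?T x) * indicator A (?T x) \<partial>lborel)"
      by (rule nn_integral_distr) measurable
    also have "\<dots> = (\<integral>\<^sup>+ x. ?g x * indicator A (?T x) \<partial>lborel)"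
      by (simp only: g)
    also have "\<dots> = (\<integral>\<^sup>+ x. ?g x * indicator (?T -` A) x \<partial>lborel)"
      by (intro nn_integral_cong) (auto split: split_indicator)
    also have "\<dots> = emeasure (gauss \<tau>) (?T -` A)"
      unfolding gauss_def using measurable_sets[of ?T borel borel A] by (subst emeasure_density) auto
    finally show "emeasure (distr (gauss \<tau>) borel ?T) A = emeasure (gauss \<tau>) A"
      by (simp add: emeasure_distr)
  qed simp
qed

lemma distr_gauss_uminus: "distr (gauss \<tau>) borel uminus = (gauss \<tau> :: (real ^ 'm::finite) measure)"
proof -
  have "(\<lambda>x :: real ^ 'm. \<chi> i. (\<lambda>_. - 1) i * x $ i) = uminus" by (simp add: fun_eq_iff vec_eq_iff)
  with distr_gauss_flip[of "\<lambda>_::'m. - 1" \<tau>] show ?thesis by simp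
qed

text \<open>Stated in \<open>ennreal\<close>, so that odd terms can be cancelled pointwise before
  anything is known to be integrable.\<close>

lemma nn_integral_gauss_symmetric:
  fixes h :: "real ^ 'm::finite \<Rightarrow> ennreal"
  assumes [measurable]: "h \<in> borel_measurable borel"
  shows "(\<integral>\<^sup>+ x. h x \<partial>gauss \<tau>) = (\<integral>\<^sup>+ x. (h x + h (- x)) / 2 \<partial>gauss \<tau>)"
proof -
  have "(\<integral>\<^sup>+ x. h (- x) \<partial>gauss \<tau>) = (\<integral>\<^sup>+ x. h x \<partial>distr (gauss \<tau>) borel uminus)"
    by (subst nn_integral_distr) auto
  then have "(\<integral>\<^sup>+ x. h (- x) \<partial>gauss \<tau>) = (\<integral>\<^sup>+ x. h x \<partial>gauss \<tau>)" by (simp add: distr_gauss_uminus)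
  moreover have "(a + a) / 2 = a" for a :: ennreal
    by (simp add: mult_2_right[symmetric] mult_divide_eq_ennreal)
  ultimately show ?thesis
    by (subst nn_integral_divide) (auto simp: nn_integral_add)
qed

lemma integrable_gauss_coord2:
  assumes \<tau>: "0 < \<tau>"
  shows "integrable (gauss \<tau> :: (real ^ 'm::finite) measure) (\<lambda>x. x $ i * x $ j)"
proof (rule integrableI_bounded)
  have "(\<integral>\<^sup>+ x. ennreal (norm (x $ i * x $ j)) \<partial>(gauss \<tau> :: (real ^ 'm) measure)) \<le>
    (\<integral>\<^sup>+ x. ennreal (norm x ^ (2 * 1)) \<partial>(gauss \<tau> :: (real ^ 'm) measure))"
    by (intro nn_integral_mono ennreal_leI)
      (auto simp: abs_mult power2_eq_square intro!: mult_mono component_le_norm_cart)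
  also have "\<dots> \<le> ennreal (gauss_const TYPE('m) 1 * \<tau> ^ 1)"
    by (rule nn_integral_gauss_norm[OF \<tau>])
  also have "\<dots> < \<infinity>" by simp
  finally show "(\<integral>\<^sup>+ x. ennreal (norm (x $ i * x $ j)) \<partial>(gauss \<tau> :: (real ^ 'm) measure)) < \<infinity>" .
qed auto

lemma integral_gauss_coord2:
  assumes \<tau>: "0 < \<tau>"
  shows "(\<integral> x. x $ i * x $ j \<partial>(gauss \<tau> :: (real ^ 'm::finite) measure)) = (if i = j then \<tau> else 0)"
proof (cases "i = j")
  case True
  have "(\<integral>\<^sup>+ x. ennreal (x $ i ^ (2 * 1)) \<partial>(gauss \<tau> :: (real ^ 'm) measure)) = ennreal \<tau>"
    unfolding nn_integral_gauss_coord[OF \<tau>] by (simp add: gauss_moment_def)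
  then have "(\<integral> x. x $ i ^ (2 * 1) \<partial>(gauss \<tau> :: (real ^ 'm) measure)) = \<tau>"
    using \<tau> by (subst integral_eq_nn_integral) auto
  then show ?thesis using True by (simp add: power2_eq_square)
next
  case False
  \<comment> \<open>Reflecting the ith coordinate alone preserves the law and changes the sign of
    the product, so the mean equals its own negative.\<close>
  let ?\<sigma> = "\<lambda>k. if k = i then - 1 else 1 :: real"
  let ?G = "gauss \<tau> :: (real ^ 'm) measure"
  have [measurable]: "(\<lambda>x :: real ^ 'm. \<chi> k. ?\<sigma> k * x $ k) \<in> borel_measurable borel"
    by (intro borel_measurable_continuous_onI continuous_intros)
  have "(\<integral> x. x $ i * x $ j \<partial>?G) = (\<integral> x. x $ i * x $ j \<partial>distr ?G borel (\<lambda>x. \<chi> k. ?\<sigma> k * x $ k))"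
    by (subst distr_gauss_flip) auto
  also have "\<dots> = (\<integral> x. (\<chi> k. ?\<sigma> k * x $ k) $ i * (\<chi> k. ?\<sigma> k * x $ k) $ j \<partial>?G)"
    by (rule integral_distr) measurable
  also have "\<dots> = - (\<integral> x. x $ i * x $ j \<partial>?G)" using False by simp
  finally show ?thesis using False by simp
qed

text \<open>The norm of a vector of rows is the Frobenius norm; Cauchy-Schwarz is applied to each
  row.\<close>

lemma norm_matrix_vector_mult_le: "norm (A *v x) \<le> norm A * norm (x :: real ^ 'm::finite)"
  for A :: "real ^ 'm ^ 'd::finite"
proof -
  have "norm (A *v x) \<le> L2_set (\<lambda>i. norm (A $ i) * norm x) UNIV"
    unfolding norm_vec_def[of "A *v x"]
    by (rule L2_set_mono) (simp_all only: matrix_vector_mul_component real_norm_def Cauchy_Schwarz_ineq2 abs_ge_zero)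
  also have "\<dots> = norm A * norm x"
    by (simp add: L2_set_left_distrib norm_vec_def[of A])
  finally show ?thesis .
qed

section \<open>Brownian increments and their independence of the past\<close>

locale brownian = usual_filtered_prob_space M F for M :: "'a measure" and F +
  fixes B :: "real \<Rightarrow> 'a \<Rightarrow> real ^ 'm::finite"
  assumes bm: "brownian_motion M F B"
begin

lemma space_Ft: "0 \<le> t \<Longrightarrow> space (F t) = space M"
  using space_F[of t] by simp

lemma sets_Ft_mono: "0 \<le> s \<Longrightarrow> s \<le> t \<Longrightarrow> sets (F s) \<subseteq> sets (F t)"
  using sets_F_mono[of s t] by simp

lemma measurable_F_mono:
  "h \<in> F s \<rightarrow>\<^sub>M N \<Longrightarrow> 0 \<le> s \<Longrightarrow> s \<le> t \<Longrightarrow> h \<in> F t \<rightarrow>\<^sub>M N"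
  using sets_Ft_mono[of s t] by (auto simp: measurable_def space_Ft)

lemma measurable_F_M:
  "h \<in> F s \<rightarrow>\<^sub>M N \<Longrightarrow> 0 \<le> s \<Longrightarrow> h \<in> M \<rightarrow>\<^sub>M N"
  using sets_F_subset[of s] by (auto simp: measurable_def space_Ft)

lemma B_measurable_F: "0 \<le> s \<Longrightarrow> s \<le> t \<Longrightarrow> B s \<in> borel_measurable (F t)"
  using bm measurable_F_mono[of "B s" s borel t] by (auto simp: brownian_motion_def adapted_def)

lemma B_measurable [measurable]: "0 \<le> s \<Longrightarrow> B s \<in> borel_measurable M"
  using B_measurable_F[of s s] measurable_F_M by blast

lemma distr_increment: "0 \<le> s \<Longrightarrow> s < t \<Longrightarrow> distr M borel (\<lambda>\<omega>. B t \<omega> - B s \<omega>) = gauss (t - s)"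
  using bm distr_cong[of M M borel lborel "\<lambda>\<omega>. B t \<omega> - B s \<omega>" "\<lambda>\<omega>. B t \<omega> - B s \<omega>"]
  unfolding brownian_motion_def distributed_def gauss_def by simp

text \<open>Takes the place of conditioning on F s: independence makes the joint law of Z and the
  increment a product, as is checked on rectangles, and Tonelli's theorem then integrates out the
  increment with Z frozen.\<close>

lemma nn_integral_indep_increment:
  fixes Z :: "'a \<Rightarrow> 'b::second_countable_topology" and \<Phi> :: "'b \<Rightarrow> real ^ 'm \<Rightarrow> ennreal"
  assumes st: "0 \<le> s" "s < t" and Z: "Z \<in> borel_measurable (F s)"
    and \<Phi>: "case_prod \<Phi> \<in> borel_measurable borel"
  shows "(\<integral>\<^sup>+ \<omega>. \<Phi> (Z \<omega>) (B t \<omega> - B s \<omega>) \<partial>M) = (\<integral>\<^sup>+ \<omega>. (\<integral>\<^sup>+ \<xi>. \<Phi> (Z \<omega>) \<xi> \<partial>gauss (t - s)) \<partial>M)"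
proof -
  let ?D = "\<lambda>\<omega>. B t \<omega> - B s \<omega>"
  have D [measurable]: "?D \<in> borel_measurable M" using st by simp
  have Zm [measurable]: "Z \<in> borel_measurable M" using measurable_F_M[OF Z st(1)] .
  have \<Phi>' [measurable]: "case_prod \<Phi> \<in> borel_measurable (borel \<Otimes>\<^sub>M borel)"
    using \<Phi> by (simp add: borel_prod)
  have ind: "indep_set (sets (F s)) {?D -` A \<inter> space M | A. A \<in> sets borel}"
    using bm st by (simp add: brownian_motion_def)

  interpret G: prob_space "distr M borel ?D" by (rule prob_space_distr) simp
  interpret Z: prob_space "distr M borel Z" by (rule prob_space_distr) simp
  have eq: "distr M borel Z \<Otimes>\<^sub>M distr M borel ?D = distr M (borel \<Otimes>\<^sub>M borel) (\<lambda>\<omega>. (Z \<omega>, ?D \<omega>))"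
  proof (rule pair_measure_eqI)
    fix A :: "'b set" and C :: "(real ^ 'm) set"
    assume "A \<in> sets (distr M borel Z)" "C \<in> sets (distr M borel ?D)"
    then have [measurable]: "A \<in> sets borel" "C \<in> sets borel" by auto
    have "Z -` A \<inter> space M \<in> sets (F s)"
      using measurable_sets[OF Z, of A] space_Ft[OF st(1)] by simp
    moreover have "?D -` C \<inter> space M \<in> {?D -` A \<inter> space M | A. A \<in> sets borel}"
      by (rule CollectI, rule exI[of _ C]) simp
    ultimately have "prob ((Z -` A \<inter> space M) \<inter> (?D -` C \<inter> space M)) = prob (Z -` A \<inter> space M) * prob (?D -` C \<inter> space M)"
      by (rule indep_setD[OF ind])
    moreover have "(\<lambda>\<omega>. (Z \<omega>, ?D \<omega>)) -` (A \<times> C) \<inter> space M = (Z -` A \<inter> space M) \<inter> (?D -` C \<inter> space M)"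
      by auto
    ultimately show "emeasure (distr M borel Z) A * emeasure (distr M borel ?D) C =
        emeasure (distr M (borel \<Otimes>\<^sub>M borel) (\<lambda>\<omega>. (Z \<omega>, ?D \<omega>))) (A \<times> C)"
      by (simp add: emeasure_distr emeasure_eq_measure ennreal_mult[symmetric])
  qed (unfold_locales, simp_all)
  have "(\<integral>\<^sup>+ \<omega>. \<Phi> (Z \<omega>) (?D \<omega>) \<partial>M) = (\<integral>\<^sup>+ p. case_prod \<Phi> p \<partial>distr M (borel \<Otimes>\<^sub>M borel) (\<lambda>\<omega>. (Z \<omega>, ?D \<omega>)))"
    by (subst nn_integral_distr) auto
  also have "\<dots> = (\<integral>\<^sup>+ z. (\<integral>\<^sup>+ \<xi>. case_prod \<Phi> (z, \<xi>) \<partial>distr M borel ?D) \<partial>distr M borel Z)"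
    unfolding eq[symmetric] by (rule G.nn_integral_fst[symmetric]) simp
  also have "\<dots> = (\<integral>\<^sup>+ \<omega>. (\<integral>\<^sup>+ \<xi>. \<Phi> (Z \<omega>) \<xi> \<partial>distr M borel ?D) \<partial>M)"
    by (subst nn_integral_distr) auto
  finally show ?thesis unfolding distr_increment[OF st] .
qed

end

text \<open>The mean of x^T Q x is \<tau> tr Q, because the coordinates are uncorrelated with
  variance \<tau>. This is the source of the trace in the generator.\<close>

lemma gauss_quadratic_form:
  fixes Q :: "'m::finite \<Rightarrow> 'm \<Rightarrow> real"
  assumes \<tau>: "0 < \<tau>"
  shows "integrable (gauss \<tau> :: (real ^ 'm) measure) (\<lambda>x. \<Sum>k\<in>UNIV. \<Sum>l\<in>UNIV. Q k l * (x $ k * x $ l))"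
    and "(\<integral> x. (\<Sum>k\<in>UNIV. \<Sum>l\<in>UNIV. Q k l * (x $ k * x $ l)) \<partial>(gauss \<tau> :: (real ^ 'm) measure)) = \<tau> * (\<Sum>k\<in>UNIV. Q k k)"
proof -
  note [simp] = integrable_gauss_coord2[OF \<tau>] integral_gauss_coord2[OF \<tau>]
  show "integrable (gauss \<tau> :: (real ^ 'm) measure) (\<lambda>x. \<Sum>k\<in>UNIV. \<Sum>l\<in>UNIV. Q k l * (x $ k * x $ l))"
    by (intro Bochner_Integration.integrable_sum integrable_mult_right) simp
  have "(\<integral> x. (\<Sum>k\<in>UNIV. \<Sum>l\<in>UNIV. Q k l * (x $ k * x $ l)) \<partial>(gauss \<tau> :: (real ^ 'm) measure)) =
     (\<Sum>k\<in>UNIV. \<Sum>l\<in>UNIV. Q k l * (if k = l then \<tau> else 0))"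
    by (simp add: Bochner_Integration.integral_sum)
  then show "(\<integral> x. (\<Sum>k\<in>UNIV. \<Sum>l\<in>UNIV. Q k l * (x $ k * x $ l)) \<partial>(gauss \<tau> :: (real ^ 'm) measure)) = \<tau> * (\<Sum>k\<in>UNIV. Q k k)"
    by (simp add: sum_distrib_left mult.commute if_distrib cong: if_cong)
qed

lemma gauss_norm_moment:
  assumes \<tau>: "0 < \<tau>"
  shows "integrable (gauss \<tau> :: (real ^ 'm::finite) measure) (\<lambda>x. norm x ^ (2 * k))"
    and "(\<integral> x. norm x ^ (2 * k) \<partial>(gauss \<tau> :: (real ^ 'm) measure)) \<le> gauss_const TYPE('m) k * \<tau> ^ k"
proof -
  note le = nn_integral_gauss_norm[OF \<tau>, of k, where ?'m = 'm]
  show *: "integrable (gauss \<tau> :: (real ^ 'm::finite) measure) (\<lambda>x. norm x ^ (2 * k))"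
    using le by (intro integrableI_bounded) (auto simp: ennreal_less_top intro: le_less_trans)
  show "(\<integral> x. norm x ^ (2 * k) \<partial>(gauss \<tau> :: (real ^ 'm) measure)) \<le> gauss_const TYPE('m) k * \<tau> ^ k"
    using le * \<tau> gauss_const_nonneg[of k, where ?'m = 'm]
    by (subst (asm) nn_integral_eq_integral) auto
qed

section \<open>Averaging the Taylor expansion over one Gaussian step\<close>

context lyapunov_power
begin

lemma P_gradient: "P [h] x = gradient V x \<bullet> h"
  by (simp add: mixed_deriv.simps(2) gradient_def inner_vec_def iter_partial_def mult.commute)

lemma P_hessian: "P [h, k] x = (\<Sum>i\<in>UNIV. \<Sum>j\<in>UNIV. h $ i * k $ j * hessian V x $ j $ i)"
  by (simp add: mixed_deriv.simps(2) hessian_def sum_distrib_left mult_ac)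

lemma P_gradient_quadratic:
  "(P [g *v \<xi>] x)\<^sup>2 = (\<Sum>k\<in>UNIV. \<Sum>l\<in>UNIV. ((gradient V x v* g) $ k * (gradient V x v* g) $ l) * (\<xi> $ k * \<xi> $ l))"
proof -
  have "P [g *v \<xi>] x = (\<Sum>k\<in>UNIV. (gradient V x v* g) $ k * \<xi> $ k)"
    unfolding P_gradient inner_vec_def matrix_vector_mult_def vector_matrix_mult_def
    by (simp add: sum_distrib_left sum_distrib_right mult_ac) (rule sum.swap)
  then show ?thesis by (simp add: power2_eq_square sum_product mult_ac)
qed

lemma P_hessian_quadratic:
  "P [g *v \<xi>, g *v \<xi>] x = (\<Sum>k\<in>UNIV. \<Sum>l\<in>UNIV. (\<Sum>i\<in>UNIV. \<Sum>j\<in>UNIV. g $ i $ k * g $ j $ l * hessian V x $ j $ i) * (\<xi> $ k * \<xi> $ l))"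
proof -
  have "P [g *v \<xi>, g *v \<xi>] x = (\<Sum>i\<in>UNIV. \<Sum>j\<in>UNIV. \<Sum>k\<in>UNIV. \<Sum>l\<in>UNIV. g $ i $ k * g $ j $ l * hessian V x $ j $ i * (\<xi> $ k * \<xi> $ l))"
    unfolding P_hessian matrix_vector_mult_def
    by (simp add: sum_product sum_distrib_left sum_distrib_right mult_ac)
      (rule sum.cong[OF refl], rule sum.cong[OF refl], subst sum.swap, simp add: mult_ac)
  also have "\<dots> = (\<Sum>i\<in>UNIV. \<Sum>k\<in>UNIV. \<Sum>j\<in>UNIV. \<Sum>l\<in>UNIV. g $ i $ k * g $ j $ l * hessian V x $ j $ i * (\<xi> $ k * \<xi> $ l))"
    by (intro sum.cong refl sum.swap)
  also have "\<dots> = (\<Sum>k\<in>UNIV. \<Sum>i\<in>UNIV. \<Sum>l\<in>UNIV. \<Sum>j\<in>UNIV. g $ i $ k * g $ j $ l * hessian V x $ j $ i * (\<xi> $ k * \<xi> $ l))"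
    by (subst sum.swap) (intro sum.cong refl sum.swap)
  also have "\<dots> = (\<Sum>k\<in>UNIV. \<Sum>l\<in>UNIV. \<Sum>i\<in>UNIV. \<Sum>j\<in>UNIV. g $ i $ k * g $ j $ l * hessian V x $ j $ i * (\<xi> $ k * \<xi> $ l))"
    by (intro sum.cong refl sum.swap)
  finally show ?thesis by (simp add: sum_distrib_right)
qed

lemma trace_eq: "trace (transpose g ** hessian V x ** g) = (\<Sum>k\<in>UNIV. \<Sum>i\<in>UNIV. \<Sum>j\<in>UNIV. g $ i $ k * g $ j $ k * hessian V x $ j $ i)"
  by (simp add: trace_def matrix_matrix_mult_def transpose_def sum_distrib_right sum_distrib_left mult_ac)

text \<open>Half of this mean is \<tau> times the diffusion part of the generator applied to W.
  Together with W1 in the direction of the drift it produces the expression in the Khasminskii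
  condition.\<close>

lemma W2_gauss:
  fixes g :: "real ^ 'm::finite ^ 'a"
  assumes \<tau>: "0 < \<tau>"
  shows "integrable (gauss \<tau>) (\<lambda>\<xi>. W2 y (g *v \<xi>))"
    and "(\<integral> \<xi>. W2 y (g *v \<xi>) \<partial>gauss \<tau>) =
      \<tau> * (\<rho> * (\<rho> - 1) * U y powr (\<rho> - 2) * (norm (gradient V y v* g))\<^sup>2
        + \<rho> * U y powr (\<rho> - 1) * trace (transpose g ** hessian V y ** g))"
proof -
  let ?G = "gradient V y v* g"
  note q1 = gauss_quadratic_form[OF \<tau>, of "\<lambda>k l. ?G $ k * ?G $ l"]
  note q2 = gauss_quadratic_form[OF \<tau>, of "\<lambda>k l. \<Sum>i\<in>UNIV. \<Sum>j\<in>UNIV. g $ i $ k * g $ j $ l * hessian V y $ j $ i"]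
  have n: "(norm ?G)\<^sup>2 = (\<Sum>k\<in>UNIV. ?G $ k * ?G $ k)"
    by (simp add: power2_norm_eq_inner inner_vec_def)
  show "integrable (gauss \<tau>) (\<lambda>\<xi>. W2 y (g *v \<xi>))"
    unfolding W2_def P_gradient_quadratic P_hessian_quadratic
    by (intro Bochner_Integration.integrable_add integrable_mult_right q1(1) q2(1))
  show "(\<integral> \<xi>. W2 y (g *v \<xi>) \<partial>gauss \<tau>) =
      \<tau> * (\<rho> * (\<rho> - 1) * U y powr (\<rho> - 2) * (norm ?G)\<^sup>2
        + \<rho> * U y powr (\<rho> - 1) * trace (transpose g ** hessian V y ** g))"
    unfolding W2_def P_gradient_quadratic P_hessian_quadratic n trace_eq
    by (subst Bochner_Integration.integral_add)
      (simp_all only: integrable_mult_right q1 q2 integral_mult_right_zero, simp_all add: algebra_simps)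
qed

lemma continuous_W: "continuous_on UNIV W"
proof -
  have "V differentiable_on UNIV" using smooth by (simp add: eval_nat_numeral)
  then have "continuous_on UNIV V" by (rule differentiable_imp_continuous_on)
  then show ?thesis unfolding W_def[abs_def] U_def[abs_def]
    using V_nonneg by (intro continuous_intros) (auto simp: add_nonneg_eq_0_iff)
qed

lemma W_borel [measurable]: "W \<in> borel_measurable borel"
  using continuous_W by (rule borel_measurable_continuous_onI)

text \<open>Here r is the square root of the stepsize. The growth hypotheses give a relative drift
  of at most K0 r and a relative noise of at most G |\<xi>| with G^2 <= K0 / r. As |\<xi>|^2 is of
  order r^2, the square of the relative noise is of order r only, and its fourth power is of order
  r^2, the length of the step.\<close>

lemma one_step_moment:
  fixes f :: "real ^ 'a \<Rightarrow> real ^ 'a" and g :: "real ^ 'a \<Rightarrow> real ^ 'm::finite ^ 'a"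
  assumes K: "\<And>x. \<rho> / 2 * U x powr (\<rho> - 2) *
          (2 * U x * sde_generator f g V x + (\<rho> - 1) * (norm (gradient V x v* g x))\<^sup>2)
        \<le> lam * W x" and lam: "0 \<le> lam" and K0: "0 < K0"
  obtains C where "0 \<le> C" "\<And>r y. 0 < r \<Longrightarrow> r \<le> 1 \<Longrightarrow> norm (f y) * r \<le> K0 * u y \<Longrightarrow> (norm (g y))\<^sup>2 * r \<le> K0 * (u y)\<^sup>2 \<Longrightarrow>
     (\<integral>\<^sup>+ \<xi>. ennreal (W (y + r\<^sup>2 *\<^sub>R f y + g y *v \<xi>)) \<partial>gauss (r\<^sup>2)) \<le> ennreal ((1 + C * r\<^sup>2) * W y)"
proof -
  \<comment> \<open>The ceiling makes 2k an admissible exponent for large steps; the summand 2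
    guarantees r^k <= r^2 below.\<close>
  define k where "k = nat \<lceil>\<rho> / \<delta>\<rceil> + 2"
  have k: "2 \<le> k" by (simp add: k_def)
  have "\<rho> / \<delta> \<le> real k" unfolding k_def by linarith
  then have k2: "\<rho> / \<delta> \<le> real (2 * k)" by simp
  obtain C where C: "0 \<le> C" and T: "\<And>y a b. (W (y + a + b) + W (y + a - b)) / 2 \<le> W y + W1 y a + W2 y b / 2
    + C * W y * ((rel y a)\<^sup>2 + rel y a ^ (2 * k) + rel y b ^ 4 + rel y b ^ (2 * k))"
    using Taylor[of "2 * k"] k k2 by auto
  let ?g = "gauss_const TYPE('m)"
  let ?E = "K0\<^sup>2 + K0 ^ (2 * k) + K0\<^sup>2 * ?g 2 + K0 ^ k * ?g k"
  note gc = gauss_const_nonneg[where ?'m = 'm]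
  have E: "0 \<le> ?E" using K0 gc by (intro add_nonneg_nonneg mult_nonneg_nonneg) auto
  show ?thesis
  proof (rule that[of "lam + C * ?E"])
    show "0 \<le> lam + C * ?E" using lam C E by auto
    fix r y assume r: "0 < r" "r \<le> 1" and fy: "norm (f y) * r \<le> K0 * u y" and gy: "(norm (g y))\<^sup>2 * r \<le> K0 * (u y)\<^sup>2"
    define a where "a = r\<^sup>2 *\<^sub>R f y"
    define G where "G = norm (g y) / u y"
    let ?\<mu> = "gauss (r\<^sup>2) :: (real ^ 'm) measure"
    have r2: "0 < r\<^sup>2" using r by simp
    interpret prob_space ?\<mu> by (rule prob_space_gauss[OF r2])
    have A: "rel y a \<le> K0 * r"
    proof -
      have "norm a = (norm (f y) * r) * r" unfolding a_def by (simp add: power2_eq_square)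
      also have "\<dots> \<le> (K0 * u y) * r" using fy r by (intro mult_right_mono) auto
      finally show ?thesis using u_pos[of y] by (simp add: field_simps)
    qed
    have G2: "G\<^sup>2 \<le> K0 / r"
      using gy r u_pos[of y] unfolding G_def by (simp add: power_divide field_simps)
    have Bb: "rel y (g y *v \<xi>) \<le> G * norm \<xi>" for \<xi>
      using norm_matrix_vector_mult_le[of "g y" \<xi>] u_pos[of y] unfolding G_def by (simp add: field_simps)
    \<comment> \<open>An integrable majorant of the symmetrised value: the relative sizes are
      replaced by their bounds, so that all that remains random is a quadratic form and two powers
      of the norm of \<xi>.\<close>
    define R where "R \<xi> = W y + W1 y a + W2 y (g y *v \<xi>) / 2
      + C * W y * ((K0 * r)\<^sup>2 + (K0 * r) ^ (2 * k) + (G * norm \<xi>) ^ (2 * 2) + (G * norm \<xi>) ^ (2 * k))" for \<xi> :: "real ^ 'm"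
    have minus: "g y *v (- \<xi>) = - (g y *v \<xi>)" for \<xi>
      by (simp add: matrix_vector_mult_def vec_eq_iff sum_negf)
    have pw: "(W (y + a + g y *v \<xi>) + W (y + a + g y *v (- \<xi>))) / 2 \<le> R \<xi>" for \<xi>
    proof -
      let ?b = "g y *v \<xi>"
      have "(rel y a)\<^sup>2 + rel y a ^ (2 * k) + rel y ?b ^ 4 + rel y ?b ^ (2 * k) \<le>
         (K0 * r)\<^sup>2 + (K0 * r) ^ (2 * k) + (G * norm \<xi>) ^ (2 * 2) + (G * norm \<xi>) ^ (2 * k)"
        using A Bb[of \<xi>] rel_nonneg by (intro add_mono power_mono, simp_all) (intro power_mono, auto)
      then have "C * W y * ((rel y a)\<^sup>2 + rel y a ^ (2 * k) + rel y ?b ^ 4 + rel y ?b ^ (2 * k)) \<le>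
         C * W y * ((K0 * r)\<^sup>2 + (K0 * r) ^ (2 * k) + (G * norm \<xi>) ^ (2 * 2) + (G * norm \<xi>) ^ (2 * k))"
        using C W_pos[of y] by (intro mult_left_mono) auto
      then show ?thesis using T[of y a ?b] unfolding R_def by (simp add: minus)
    qed
    \<comment> \<open>R contains terms of either sign; it is nonnegative because it lies above an
      average of values of W. This allows its Lebesgue and its nonnegative integral to be
      identified.\<close>
    have R0: "0 \<le> R \<xi>" for \<xi>
      by (rule order_trans[OF _ pw[of \<xi>]]) (simp add: add_nonneg_nonneg less_imp_le[OF W_pos])
    note mom = gauss_norm_moment[OF r2, where ?'m = 'm]
    have intR: "integrable ?\<mu> R"
      unfolding R_def power_mult_distrib by (intro Bochner_Integration.integrable_add integrable_mult_right
        integrable_divide W2_gauss[OF r2] mom) auto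
    have m4: "(\<integral> \<xi>. (G * norm \<xi>) ^ (2 * 2) \<partial>?\<mu>) \<le> r\<^sup>2 * (K0\<^sup>2 * ?g 2)"
    proof -
      have "(\<integral> \<xi>. (G * norm \<xi>) ^ (2 * 2) \<partial>?\<mu>) = (G\<^sup>2)\<^sup>2 * (\<integral> \<xi>. norm \<xi> ^ (2 * 2) \<partial>?\<mu>)"
        unfolding power_mult_distrib by (subst integral_mult_right_zero) (simp add: power_mult[symmetric])
      also have "\<dots> \<le> (K0 / r)\<^sup>2 * (?g 2 * (r\<^sup>2) ^ 2)"
        using gc by (intro mult_mono power_mono G2 mom) auto
      also have "\<dots> = r\<^sup>2 * (K0\<^sup>2 * ?g 2)" using r by (simp add: power_divide field_simps eval_nat_numeral)
      finally show ?thesis .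
    qed
    have mk: "(\<integral> \<xi>. (G * norm \<xi>) ^ (2 * k) \<partial>?\<mu>) \<le> r\<^sup>2 * (K0 ^ k * ?g k)"
    proof -
      have "(\<integral> \<xi>. (G * norm \<xi>) ^ (2 * k) \<partial>?\<mu>) = (G\<^sup>2) ^ k * (\<integral> \<xi>. norm \<xi> ^ (2 * k) \<partial>?\<mu>)"
        unfolding power_mult_distrib by (subst integral_mult_right_zero) (simp add: power_mult)
      also have "\<dots> \<le> (K0 / r) ^ k * (?g k * (r\<^sup>2) ^ k)"
        using gc K0 r by (intro mult_mono power_mono G2 mom) auto
      \<comment> \<open>The base is K0 r, so this moment is O(r^k), and k >= 2 brings it down to the
        order of the step.\<close>
      also have "\<dots> = (K0 / r * r\<^sup>2) ^ k * ?g k" unfolding power_mult_distrib by (simp only: mult_ac)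
      also have "\<dots> = r ^ k * (K0 ^ k * ?g k)" using r by (simp add: power2_eq_square power_mult_distrib)
      also have "\<dots> \<le> r\<^sup>2 * (K0 ^ k * ?g k)"
        using r k gc K0 by (intro mult_right_mono power_decreasing) auto
      finally show ?thesis .
    qed
    \<comment> \<open>The terms of order r^2 that are not remainder are exactly r^2 times the left
      side of the Khasminskii condition, after U^(\<rho>-2) has been factored out.\<close>
    have gen: "W1 y a + r\<^sup>2 * (\<rho> * (\<rho> - 1) * U y powr (\<rho> - 2) * (norm (gradient V y v* g y))\<^sup>2
        + \<rho> * U y powr (\<rho> - 1) * trace (transpose (g y) ** hessian V y ** g y)) / 2 \<le> r\<^sup>2 * (lam * W y)"
    proof -
      have pw: "U y powr (\<rho> - 1) = U y powr (\<rho> - 2) * U y"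
        using U_pos[of y] powr_add[of "U y" "\<rho> - 2" 1] by simp
      have "W1 y a = r\<^sup>2 * (\<rho> * (U y powr (\<rho> - 2) * U y) * (gradient V y \<bullet> f y))"
        unfolding W1_def a_def P_gradient pw by simp
      then have "W1 y a + r\<^sup>2 * (\<rho> * (\<rho> - 1) * U y powr (\<rho> - 2) * (norm (gradient V y v* g y))\<^sup>2
        + \<rho> * U y powr (\<rho> - 1) * trace (transpose (g y) ** hessian V y ** g y)) / 2 =
         r\<^sup>2 * (\<rho> / 2 * U y powr (\<rho> - 2) *
          (2 * U y * sde_generator f g V y + (\<rho> - 1) * (norm (gradient V y v* g y))\<^sup>2))"
        unfolding sde_generator_def pw by (simp add: field_simps)
      also have "\<dots> \<le> r\<^sup>2 * (lam * W y)" by (intro mult_left_mono K) simp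
      finally show ?thesis .
    qed
    have iR: "(\<integral> \<xi>. R \<xi> \<partial>?\<mu>) \<le> (1 + (lam + C * ?E) * r\<^sup>2) * W y"
    proof -
      have i: "integrable ?\<mu> (\<lambda>\<xi>. (G * norm \<xi>) ^ (2 * 2))" "integrable ?\<mu> (\<lambda>\<xi>. (G * norm \<xi>) ^ (2 * k))"
        unfolding power_mult_distrib by (intro integrable_mult_right mom)+
      have "(\<integral> \<xi>. R \<xi> \<partial>?\<mu>) = W y + W1 y a + (\<integral> \<xi>. W2 y (g y *v \<xi>) \<partial>?\<mu>) / 2
         + C * W y * ((K0 * r)\<^sup>2 + (K0 * r) ^ (2 * k) + (\<integral> \<xi>. (G * norm \<xi>) ^ (2 * 2) \<partial>?\<mu>) + (\<integral> \<xi>. (G * norm \<xi>) ^ (2 * k) \<partial>?\<mu>))"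
        unfolding R_def using i W2_gauss(1)[OF r2, of y "g y"] by (simp add: prob_space[simplified])
      also have "\<dots> \<le> W y + r\<^sup>2 * (lam * W y) + C * W y * (r\<^sup>2 * K0\<^sup>2 + r\<^sup>2 * K0 ^ (2 * k) + r\<^sup>2 * (K0\<^sup>2 * ?g 2) + r\<^sup>2 * (K0 ^ k * ?g k))"
      proof -
        have "(K0 * r)\<^sup>2 = r\<^sup>2 * K0\<^sup>2" by (simp add: power_mult_distrib)
        moreover have "(K0 * r) ^ (2 * k) \<le> r\<^sup>2 * K0 ^ (2 * k)"
          using r k K0 power_decreasing[of 2 "2 * k" r] by (simp add: power_mult_distrib)
        ultimately have "C * W y * ((K0 * r)\<^sup>2 + (K0 * r) ^ (2 * k) + (\<integral> \<xi>. (G * norm \<xi>) ^ (2 * 2) \<partial>?\<mu>) + (\<integral> \<xi>. (G * norm \<xi>) ^ (2 * k) \<partial>?\<mu>))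
          \<le> C * W y * (r\<^sup>2 * K0\<^sup>2 + r\<^sup>2 * K0 ^ (2 * k) + r\<^sup>2 * (K0\<^sup>2 * ?g 2) + r\<^sup>2 * (K0 ^ k * ?g k))"
          using C W_pos[of y] m4 mk by (intro mult_left_mono) auto
        then show ?thesis using gen unfolding W2_gauss(2)[OF r2] by linarith
      qed
      finally show ?thesis by (simp add: algebra_simps)
    qed
    have [measurable]: "(\<lambda>\<xi>. y + a + g y *v \<xi>) \<in> borel_measurable borel"
      unfolding matrix_vector_mult_def by (intro borel_measurable_continuous_onI continuous_intros)
    have "(\<integral>\<^sup>+ \<xi>. ennreal (W (y + r\<^sup>2 *\<^sub>R f y + g y *v \<xi>)) \<partial>?\<mu>) =
       (\<integral>\<^sup>+ \<xi>. (ennreal (W (y + a + g y *v \<xi>)) + ennreal (W (y + a + g y *v (- \<xi>)))) / 2 \<partial>?\<mu>)"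
      unfolding a_def[symmetric] by (rule nn_integral_gauss_symmetric) measurable
    also have "\<dots> \<le> (\<integral>\<^sup>+ \<xi>. ennreal (R \<xi>) \<partial>?\<mu>)"
    proof (rule nn_integral_mono)
      fix \<xi>
      have "(ennreal (W (y + a + g y *v \<xi>)) + ennreal (W (y + a + g y *v (- \<xi>)))) / 2 =
         ennreal ((W (y + a + g y *v \<xi>) + W (y + a + g y *v (- \<xi>))) / 2)"
        using W_pos[of "y + a + g y *v \<xi>"] W_pos[of "y + a + g y *v (- \<xi>)"]
        by (simp add: ennreal_plus[symmetric] divide_ennreal[symmetric] del: ennreal_plus)
      then show "(ennreal (W (y + a + g y *v \<xi>)) + ennreal (W (y + a + g y *v (- \<xi>)))) / 2 \<le> ennreal (R \<xi>)"
        using pw[of \<xi>] by (simp add: ennreal_leI del: ennreal_le_iff)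
    qed
    also have "\<dots> = ennreal (\<integral> \<xi>. R \<xi> \<partial>?\<mu>)"
      by (rule nn_integral_eq_integral[OF intR]) (simp add: R0)
    also have "\<dots> \<le> ennreal ((1 + (lam + C * ?E) * r\<^sup>2) * W y)" by (rule ennreal_leI[OF iR])
    finally show "(\<integral>\<^sup>+ \<xi>. ennreal (W (y + r\<^sup>2 *\<^sub>R f y + g y *v \<xi>)) \<partial>?\<mu>) \<le> ennreal ((1 + (lam + C * ?E) * r\<^sup>2) * W y)" .
  qed
qed

end

section \<open>Moment bound for the truncated scheme\<close>

lemma locally_lipschitz_continuous:
  fixes h :: "'b::euclidean_space \<Rightarrow> 'c::real_normed_vector"
  assumes "locally_lipschitz h" shows "continuous_on UNIV h"
proof -
  have "isCont h x" for x
  proof -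
    obtain L where "L-lipschitz_on (cball 0 (norm x + 1)) h"
      using assms by (auto simp: locally_lipschitz_def)
    then have "continuous_on (cball 0 (norm x + 1)) h" by (rule lipschitz_on_continuous_on)
    then show ?thesis by (rule continuous_on_interior) simp
  qed
  then show ?thesis by (simp add: continuous_on_eq_continuous_at)
qed

lemma ennreal_discrete_Gronwall:
  fixes a :: "nat \<Rightarrow> ennreal"
  assumes step: "\<And>k. k < n \<Longrightarrow> a (Suc k) \<le> ennreal (1 + C) * a k" and C: "0 \<le> C" and k: "k \<le> n"
  shows "a k \<le> ennreal (exp (C * real k)) * a 0"
  using k
proof (induction k)
  case (Suc k)
  have "a (Suc k) \<le> ennreal (1 + C) * a k" using Suc by (intro step) simp
  also have "\<dots> \<le> ennreal (exp C) * (ennreal (exp (C * real k)) * a 0)"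
    using Suc C by (intro mult_mono ennreal_leI exp_ge_add_one_self) auto
  also have "\<dots> = ennreal (exp (C * real (Suc k))) * a 0"
  proof -
    have "exp (C * real (Suc k)) = exp C * exp (C * real k)"
      by (simp add: exp_add[symmetric] algebra_simps)
    then show ?thesis by (simp add: ennreal_mult mult.assoc)
  qed
  finally show ?case .
qed simp

lemma continuous_on_matrix_vector_mult [continuous_intros]:
  fixes h :: "'t::topological_space \<Rightarrow> real ^ 'm::finite ^ 'd::finite"
  shows "continuous_on S h \<Longrightarrow> continuous_on S x \<Longrightarrow> continuous_on S (\<lambda>t. h t *v x t)"
  unfolding matrix_vector_mult_def by (intro continuous_intros)

lemma borel_measurable_matrix_vector_mult [measurable (raw)]:
  fixes h :: "'t \<Rightarrow> real ^ 'm::finite ^ 'd::finite"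
  assumes [measurable]: "h \<in> borel_measurable N" "x \<in> borel_measurable N"
  shows "(\<lambda>t. h t *v x t) \<in> borel_measurable N"
proof -
  have "(\<lambda>p. fst p *v snd p :: real ^ 'd) \<in> borel_measurable (borel :: ((real ^ 'm ^ 'd) \<times> (real ^ 'm)) measure)"
    by (intro borel_measurable_continuous_onI continuous_intros)
  then have "(\<lambda>p. fst p *v snd p :: real ^ 'd) \<in> borel_measurable ((borel :: (real ^ 'm ^ 'd) measure) \<Otimes>\<^sub>M borel)"
    by (simp add: borel_prod)
  from measurable_compose[OF measurable_Pair this, of h N x] show ?thesis by simp
qed

text \<open>The value of \<open>the_inv_into\<close> is determined only on the range of \<phi>.
  Continuity and growth put every v >= \<phi> a into that range, by the intermediate value
  theorem.\<close>

lemma the_inv_into_ge: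
  fixes \<phi> :: "real \<Rightarrow> real"
  assumes cont: "continuous_on {0..} \<phi>" and mono: "strict_mono_on {0..} \<phi>"
    and lim: "filterlim \<phi> at_top at_top" and a: "0 \<le> a" "\<phi> a \<le> v"
  shows "a \<le> the_inv_into {0..} \<phi> v" "\<phi> (the_inv_into {0..} \<phi> v) = v"
proof -
  from lim have "\<forall>\<^sub>F b in at_top. v \<le> \<phi> b" by (simp add: filterlim_at_top)
  then have "\<forall>\<^sub>F b in at_top. v \<le> \<phi> b \<and> a \<le> b" using eventually_ge_at_top by (rule eventually_conj)
  then obtain b where b: "v \<le> \<phi> b" "a \<le> b" by (auto dest: eventually_happens)
  have "continuous_on {a..b} \<phi>" using a by (intro continuous_on_subset[OF cont]) auto
  from IVT'[of \<phi> a v b, OF a(2) b this] obtain x where x: "a \<le> x" "\<phi> x = v" by auto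
  have "inj_on \<phi> {0..}" using mono by (rule strict_mono_on_imp_inj_on)
  then have "the_inv_into {0..} \<phi> v = x" using x a by (auto intro: the_inv_into_f_eq)
  then show "a \<le> the_inv_into {0..} \<phi> v" "\<phi> (the_inv_into {0..} \<phi> v) = v" using x by simp_all
qed

lemma norm_truncation:
  assumes "0 < the_inv_into {0..} \<phi> (K * \<Delta> powr (- \<theta>))"
  shows "norm (truncation \<phi> K \<theta> \<Delta> x) = min (norm x) (the_inv_into {0..} \<phi> (K * \<Delta> powr (- \<theta>)))"
  using assms by (cases "x = 0") (auto simp: truncation_def norm_sgn)

lemma truncation_id:
  assumes "norm x \<le> the_inv_into {0..} \<phi> (K * \<Delta> powr (- \<theta>))"
  shows "truncation \<phi> K \<theta> \<Delta> x = x"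
  using assms by (cases "x = 0") (auto simp: truncation_def min_def sgn_div_norm)

text \<open>The truncated vector is x times a factor in (0, 1]. Here the scaling hypothesis on V
  enters, and positivity of the level keeps the factor away from 0.\<close>

lemma truncation_decreasing:
  assumes pos: "0 < the_inv_into {0..} \<phi> (K * \<Delta> powr (- \<theta>))"
    and scale: "\<And>x \<epsilon>. 0 < \<epsilon> \<Longrightarrow> \<epsilon> \<le> 1 \<Longrightarrow> V (\<epsilon> *\<^sub>R x) \<le> (V x :: real)"
  shows "V (truncation \<phi> K \<theta> \<Delta> x) \<le> V x"
proof (cases "x = 0")
  case False
  let ?c = "the_inv_into {0..} \<phi> (K * \<Delta> powr (- \<theta>))"
  have "truncation \<phi> K \<theta> \<Delta> x = (min (norm x) ?c / norm x) *\<^sub>R x"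
    by (simp add: truncation_def sgn_div_norm divide_inverse)
  then show ?thesis using pos False by (auto intro!: scale simp: divide_le_eq)
qed (simp add: truncation_def)

lemma truncation_measurable [measurable]: "truncation \<phi> K \<theta> \<Delta> \<in> borel_measurable borel"
  unfolding truncation_def[abs_def] sgn_div_norm by measurable

section \<open>One-step second moments, and Lyapunov moments along the whole scheme\<close>

context brownian
begin

text \<open>Orthogonality of a Gaussian increment to the past. The cross term is removed by
  averaging over \<xi> and -\<xi>, that is by the parallelogram law, so the inequality holds in
  \<open>ennreal\<close> whether or not the moments are finite.\<close>

lemma L2_step:
  fixes m :: "'a \<Rightarrow> real ^ 'd::finite" and h :: "'a \<Rightarrow> real ^ 'm ^ 'd"
  assumes st: "0 \<le> s" "s < t" and m: "m \<in> borel_measurable (F s)" and h: "h \<in> borel_measurable (F s)"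
  shows "(\<integral>\<^sup>+ \<omega>. ennreal ((norm (m \<omega> + h \<omega> *v (B t \<omega> - B s \<omega>)))\<^sup>2) \<partial>M) \<le>
    (\<integral>\<^sup>+ \<omega>. ennreal ((norm (m \<omega>))\<^sup>2) \<partial>M) + ennreal (gauss_const TYPE('m) 1 * (t - s)) * (\<integral>\<^sup>+ \<omega>. ennreal ((norm (h \<omega>))\<^sup>2) \<partial>M)"
proof -
  have [measurable]: "m \<in> borel_measurable M" "h \<in> borel_measurable M"
    using m h st measurable_F_M by blast+
  let ?\<Phi> = "\<lambda>(p :: (real ^ 'd) \<times> (real ^ 'm ^ 'd)) \<xi>. ennreal ((norm (fst p + snd p *v \<xi>))\<^sup>2)"
  have Z: "(\<lambda>\<omega>. (m \<omega>, h \<omega>)) \<in> borel_measurable (F s)"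
    unfolding borel_prod[symmetric] using m h by (rule measurable_Pair)
  have \<Phi>: "case_prod ?\<Phi> \<in> borel_measurable borel"
    unfolding case_prod_unfold
    by (intro measurable_compose[OF _ measurable_ennreal] borel_measurable_continuous_onI continuous_intros)
  have \<tau>: "0 < t - s" using st by simp
  interpret G: prob_space "gauss (t - s) :: (real ^ 'm) measure" by (rule prob_space_gauss[OF \<tau>])
  have inner: "(\<integral>\<^sup>+ \<xi>. ennreal ((norm (a + A *v \<xi>))\<^sup>2) \<partial>gauss (t - s)) \<le>
      ennreal ((norm a)\<^sup>2) + ennreal (gauss_const TYPE('m) 1 * (t - s)) * ennreal ((norm A)\<^sup>2)" for a and A :: "real ^ 'm ^ 'd"
  proof -
    have minus: "A *v (- \<xi>) = - (A *v \<xi>)" for \<xi>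
      by (simp add: matrix_vector_mult_def vec_eq_iff sum_negf)
    have "(\<integral>\<^sup>+ \<xi>. ennreal ((norm (a + A *v \<xi>))\<^sup>2) \<partial>gauss (t - s)) =
      (\<integral>\<^sup>+ \<xi>. (ennreal ((norm (a + A *v \<xi>))\<^sup>2) + ennreal ((norm (a + A *v (- \<xi>)))\<^sup>2)) / 2 \<partial>gauss (t - s))"
      by (rule nn_integral_gauss_symmetric) measurable
    also have "\<dots> \<le> (\<integral>\<^sup>+ \<xi>. ennreal ((norm a)\<^sup>2) + ennreal ((norm A)\<^sup>2) * ennreal (norm \<xi> ^ (2 * 1)) \<partial>(gauss (t - s) :: (real ^ 'm) measure))"
    proof (rule nn_integral_mono)
      fix \<xi>
      have "((norm (a + A *v \<xi>))\<^sup>2 + (norm (a + A *v (- \<xi>)))\<^sup>2) / 2 = (norm a)\<^sup>2 + (norm (A *v \<xi>))\<^sup>2"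
        by (simp add: minus power2_norm_eq_inner inner_add_left inner_add_right inner_diff_left inner_diff_right inner_commute)
      also have "\<dots> \<le> (norm a)\<^sup>2 + (norm A)\<^sup>2 * norm \<xi> ^ (2 * 1)"
        using power_mono[OF norm_matrix_vector_mult_le[of A \<xi>], of 2] by (simp add: power_mult_distrib)
      finally have "ennreal (((norm (a + A *v \<xi>))\<^sup>2 + (norm (a + A *v (- \<xi>)))\<^sup>2) / 2) \<le>
          ennreal ((norm a)\<^sup>2 + (norm A)\<^sup>2 * norm \<xi> ^ (2 * 1))" by (rule ennreal_leI)
      then show "(ennreal ((norm (a + A *v \<xi>))\<^sup>2) + ennreal ((norm (a + A *v (- \<xi>)))\<^sup>2)) / 2 \<le>
         ennreal ((norm a)\<^sup>2) + ennreal ((norm A)\<^sup>2) * ennreal (norm \<xi> ^ (2 * 1))"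
        by (simp add: ennreal_mult divide_ennreal[symmetric])
    qed
    also have "\<dots> = ennreal ((norm a)\<^sup>2) + ennreal ((norm A)\<^sup>2) * (\<integral>\<^sup>+ \<xi>. ennreal (norm \<xi> ^ (2 * 1)) \<partial>(gauss (t - s) :: (real ^ 'm) measure))"
      using G.emeasure_space_1 by (simp add: nn_integral_add nn_integral_cmult)
    also have "\<dots> \<le> ennreal ((norm a)\<^sup>2) + ennreal ((norm A)\<^sup>2) * ennreal (gauss_const TYPE('m) 1 * (t - s) ^ 1)"
      by (intro add_left_mono mult_left_mono nn_integral_gauss_norm[OF \<tau>]) auto
    finally show ?thesis by (simp add: mult.commute)
  qed
  have "(\<integral>\<^sup>+ \<omega>. ennreal ((norm (m \<omega> + h \<omega> *v (B t \<omega> - B s \<omega>)))\<^sup>2) \<partial>M) =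
      (\<integral>\<^sup>+ \<omega>. (\<integral>\<^sup>+ \<xi>. ennreal ((norm (m \<omega> + h \<omega> *v \<xi>))\<^sup>2) \<partial>gauss (t - s)) \<partial>M)"
    using nn_integral_indep_increment[OF st Z \<Phi>] by simp
  also have "\<dots> \<le> (\<integral>\<^sup>+ \<omega>. ennreal ((norm (m \<omega>))\<^sup>2) + ennreal (gauss_const TYPE('m) 1 * (t - s)) * ennreal ((norm (h \<omega>))\<^sup>2) \<partial>M)"
    by (intro nn_integral_mono inner)
  also have "\<dots> = (\<integral>\<^sup>+ \<omega>. ennreal ((norm (m \<omega>))\<^sup>2) \<partial>M) + ennreal (gauss_const TYPE('m) 1 * (t - s)) * (\<integral>\<^sup>+ \<omega>. ennreal ((norm (h \<omega>))\<^sup>2) \<partial>M)"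
    by (simp add: nn_integral_add nn_integral_cmult)
  finally show ?thesis .
qed

lemma truncated_EM_measurable:
  fixes f :: "real ^ 'd::finite \<Rightarrow> real ^ 'd" and g :: "real ^ 'd \<Rightarrow> real ^ 'm ^ 'd"
  assumes f: "continuous_on UNIV f" and g: "continuous_on UNIV g" and \<Delta>: "0 < \<Delta>"
  shows "truncated_EM B f g x0 \<phi> K \<theta> \<Delta> k \<in> borel_measurable (F (real k * \<Delta>))"
proof (induction k)
  case 0 then show ?case by simp
next
  case (Suc k)
  let ?Y = "truncated_EM B f g x0 \<phi> K \<theta> \<Delta> k"
  have [measurable]: "f \<in> borel_measurable borel" "g \<in> borel_measurable borel"
    using f g by (simp_all add: borel_measurable_continuous_onI)
  have le: "real k * \<Delta> \<le> real (Suc k) * \<Delta>" using \<Delta> by simp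
  have [measurable]: "?Y \<in> borel_measurable (F (real (Suc k) * \<Delta>))"
    by (rule measurable_F_mono[OF Suc _ le]) (use \<Delta> in simp)
  have [measurable]: "B (real k * \<Delta>) \<in> borel_measurable (F (real (Suc k) * \<Delta>))"
    "B (real (Suc k) * \<Delta>) \<in> borel_measurable (F (real (Suc k) * \<Delta>))"
    using \<Delta> le by (auto intro!: B_measurable_F)
  show ?case by (simp del: of_nat_Suc add: Let_def)
qed

text \<open>S is a set that the scheme never leaves. The one-step bound is required only there,
  since \<phi> controls the coefficients only inside the truncation ball.\<close>

lemma truncated_EM_moment:
  fixes f :: "real ^ 'd::finite \<Rightarrow> real ^ 'd" and g :: "real ^ 'd \<Rightarrow> real ^ 'm ^ 'd"
  assumes f: "continuous_on UNIV f" and g: "continuous_on UNIV g" and \<Delta>: "0 < \<Delta>" and C: "0 \<le> C"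
    and W: "continuous_on UNIV W" "\<And>x. 0 \<le> W x"
    and trunc: "\<And>x. W (truncation \<phi> K \<theta> \<Delta> x) \<le> W x"
    and Y_in: "\<And>k \<omega>. truncated_EM B f g x0 \<phi> K \<theta> \<Delta> k \<omega> \<in> S"
    and step: "\<And>y. y \<in> S \<Longrightarrow> (\<integral>\<^sup>+ \<xi>. ennreal (W (y + \<Delta> *\<^sub>R f y + g y *v \<xi>)) \<partial>gauss \<Delta>) \<le> ennreal ((1 + C * \<Delta>) * W y)"
  shows "(\<integral>\<^sup>+ \<omega>. ennreal (W (truncated_EM B f g x0 \<phi> K \<theta> \<Delta> k \<omega>)) \<partial>M) \<le> ennreal (exp (C * (real k * \<Delta>)) * W x0)"
proof -
  define Y where "Y = truncated_EM B f g x0 \<phi> K \<theta> \<Delta>"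
  note Ym = truncated_EM_measurable[OF f g \<Delta>, of x0 \<phi> K \<theta>, folded Y_def]
  have YM [measurable]: "Y k \<in> borel_measurable M" for k
    using measurable_F_M[OF Ym] \<Delta> by simp
  have WM [measurable]: "W \<in> borel_measurable borel"
    using W(1) by (rule borel_measurable_continuous_onI)
  have cont: "continuous_on UNIV (\<lambda>p. W (fst p + \<Delta> *\<^sub>R f (fst p) + g (fst p) *v snd p))"
    by (intro continuous_on_compose2[OF W(1)] continuous_intros
      continuous_on_compose2[OF f] continuous_on_compose2[OF g]) auto
  have one: "(\<integral>\<^sup>+ \<omega>. ennreal (W (Y (Suc k) \<omega>)) \<partial>M) \<le> ennreal (1 + C * \<Delta>) * (\<integral>\<^sup>+ \<omega>. ennreal (W (Y k \<omega>)) \<partial>M)" for k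
  proof -
    let ?s = "real k * \<Delta>" and ?t = "real (Suc k) * \<Delta>"
    let ?\<Phi> = "\<lambda>y \<xi>. ennreal (W (y + \<Delta> *\<^sub>R f y + g y *v \<xi>))"
    have st: "0 \<le> ?s" "?s < ?t" and d: "?t - ?s = \<Delta>" using \<Delta> by (simp_all add: algebra_simps)
    have \<Phi>: "case_prod ?\<Phi> \<in> borel_measurable borel"
      unfolding case_prod_unfold
      by (intro measurable_compose[OF _ measurable_ennreal] borel_measurable_continuous_onI cont)
    have "(\<integral>\<^sup>+ \<omega>. ennreal (W (Y (Suc k) \<omega>)) \<partial>M) \<le> (\<integral>\<^sup>+ \<omega>. ?\<Phi> (Y k \<omega>) (B ?t \<omega> - B ?s \<omega>) \<partial>M)"
      unfolding Y_def by (intro nn_integral_mono ennreal_leI) (simp del: of_nat_Suc add: Let_def trunc)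
    also have "\<dots> = (\<integral>\<^sup>+ \<omega>. (\<integral>\<^sup>+ \<xi>. ?\<Phi> (Y k \<omega>) \<xi> \<partial>gauss \<Delta>) \<partial>M)"
      using nn_integral_indep_increment[OF st Ym[of k] \<Phi>] unfolding d .
    also have "\<dots> \<le> (\<integral>\<^sup>+ \<omega>. ennreal ((1 + C * \<Delta>) * W (Y k \<omega>)) \<partial>M)"
      using Y_in unfolding Y_def by (intro nn_integral_mono step)
    also have "\<dots> = ennreal (1 + C * \<Delta>) * (\<integral>\<^sup>+ \<omega>. ennreal (W (Y k \<omega>)) \<partial>M)"
      using C \<Delta> W(2) by (simp add: ennreal_mult nn_integral_cmult)
    finally show ?thesis .
  qed
  have "(\<integral>\<^sup>+ \<omega>. ennreal (W (Y k \<omega>)) \<partial>M) \<le> ennreal (exp (C * \<Delta> * real k)) * (\<integral>\<^sup>+ \<omega>. ennreal (W (Y 0 \<omega>)) \<partial>M)"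
    by (rule ennreal_discrete_Gronwall[where n = k]) (use one C \<Delta> in auto)
  also have "\<dots> = ennreal (exp (C * (real k * \<Delta>)) * W x0)"
    using W(2) by (simp add: Y_def emeasure_space_1 ennreal_mult mult_ac)
  finally show ?thesis unfolding Y_def .
qed

end

section \<open>Integrals of step processes\<close>

text \<open>Strict monotonicity keeps the cells nonempty and gives every Brownian increment over a
  cell a Gaussian density.\<close>

definition time_grid :: "nat \<Rightarrow> (nat \<Rightarrow> real) \<Rightarrow> bool" where
  "time_grid n p \<longleftrightarrow> 0 \<le> p 0 \<and> (\<forall>i<n. p i < p (Suc i))"

lemma time_grid_Suc: "time_grid n p \<Longrightarrow> i < n \<Longrightarrow> p i < p (Suc i)"
  by (simp add: time_grid_def)

lemma time_grid_le:
  assumes p: "time_grid n p" and ij: "i \<le> j" "j \<le> n" shows "p i \<le> p j"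
  using ij
proof (induction j rule: dec_induct)
  case (step j)
  then show ?case using time_grid_Suc[OF p, of j] by simp
qed simp

lemma time_grid_less:
  assumes p: "time_grid n p" and ij: "i < j" "j \<le> n" shows "p i < p j"
  using time_grid_Suc[OF p, of i] time_grid_le[OF p, of "Suc i" j] ij by simp

lemma time_grid_nonneg: "time_grid n p \<Longrightarrow> i \<le> n \<Longrightarrow> 0 \<le> p i"
  using time_grid_le[of n p 0 i] by (simp add: time_grid_def)

lemma (in prob_space) second_moment_tail:
  assumes Z [measurable]: "Z \<in> borel_measurable M" and \<beta>: "0 < \<beta>"
    and le: "(\<integral>\<^sup>+ \<omega>. ennreal ((norm (Z \<omega> :: 'b::{real_normed_vector, second_countable_topology}))\<^sup>2) \<partial>M) \<le> ennreal r" and r: "0 \<le> r"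
  shows "prob {\<omega> \<in> space M. \<beta> < norm (Z \<omega>)} \<le> r / \<beta>\<^sup>2"
proof -
  have sub: "{\<omega> \<in> space M. \<beta> < norm (Z \<omega>)} \<subseteq> {\<omega> \<in> space M. 1 \<le> ennreal (1 / \<beta>\<^sup>2) * ennreal ((norm (Z \<omega>))\<^sup>2)}"
  proof safe
    fix \<omega> assume "\<beta> < norm (Z \<omega>)"
    then have "\<beta>\<^sup>2 \<le> (norm (Z \<omega>))\<^sup>2" using \<beta> by (intro power_mono) auto
    then have "1 \<le> 1 / \<beta>\<^sup>2 * (norm (Z \<omega>))\<^sup>2" using \<beta> by (simp add: field_simps)
    then show "1 \<le> ennreal (1 / \<beta>\<^sup>2) * ennreal ((norm (Z \<omega>))\<^sup>2)"
      by (simp add: ennreal_mult[symmetric] ennreal_1[symmetric] del: ennreal_1)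
  qed
  have "emeasure M {\<omega> \<in> space M. 1 \<le> ennreal (1 / \<beta>\<^sup>2) * ennreal ((norm (Z \<omega>))\<^sup>2)} \<le>
      ennreal (1 / \<beta>\<^sup>2) * (\<integral>\<^sup>+ \<omega>. ennreal ((norm (Z \<omega>))\<^sup>2) * indicator (space M) \<omega> \<partial>M)"
    by (rule nn_integral_Markov_inequality) auto
  also have "\<dots> = ennreal (1 / \<beta>\<^sup>2) * (\<integral>\<^sup>+ \<omega>. ennreal ((norm (Z \<omega>))\<^sup>2) \<partial>M)"
    by (intro arg_cong2[where f = "(*)"] refl nn_integral_cong) auto
  also have "\<dots> \<le> ennreal (1 / \<beta>\<^sup>2) * ennreal r" by (intro mult_left_mono le) auto
  also have "\<dots> = ennreal (r / \<beta>\<^sup>2)" using r by (simp add: ennreal_mult'[symmetric])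
  finally have "prob {\<omega> \<in> space M. 1 \<le> ennreal (1 / \<beta>\<^sup>2) * ennreal ((norm (Z \<omega>))\<^sup>2)} \<le> r / \<beta>\<^sup>2"
    using r by (simp add: emeasure_eq_measure)
  moreover have "prob {\<omega> \<in> space M. \<beta> < norm (Z \<omega>)} \<le> prob {\<omega> \<in> space M. 1 \<le> ennreal (1 / \<beta>\<^sup>2) * ennreal ((norm (Z \<omega>))\<^sup>2)}"
    by (rule finite_measure_mono[OF sub]) measurable
  ultimately show ?thesis by linarith
qed

section \<open>Discrete stochastic integrals: second moments and a maximal inequality\<close>

context brownian
begin

definition mart_sum :: "(nat \<Rightarrow> real) \<Rightarrow> (nat \<Rightarrow> 'a \<Rightarrow> real ^ 'm ^ 'd::finite) \<Rightarrow> nat \<Rightarrow> 'a \<Rightarrow> real ^ 'd" where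
  "mart_sum p h k \<omega> = (\<Sum>i<k. h i \<omega> *v (B (p (Suc i)) \<omega> - B (p i) \<omega>))"

lemma mart_sum_measurable:
  assumes p: "time_grid n p"
    and h: "\<And>i. i < n \<Longrightarrow> h i \<in> borel_measurable (F (p i))" and k: "k \<le> n"
  shows "mart_sum p h k \<in> borel_measurable (F (p k))"
proof -
  have mono: "0 \<le> p i" "p i \<le> p j" if "i \<le> j" "j \<le> n" for i j
    using time_grid_le[OF p, of i j] time_grid_nonneg[OF p, of i] that by auto
  have "(\<lambda>\<omega>. h i \<omega> *v (B (p (Suc i)) \<omega> - B (p i) \<omega>)) \<in> borel_measurable (F (p k))" if "i < k" for i
  proof -
    have [measurable]: "h i \<in> borel_measurable (F (p k))"
      using that k mono(1)[of i k] mono(2)[of i k] by (intro measurable_F_mono[OF h]) auto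
    have [measurable]: "B (p i) \<in> borel_measurable (F (p k))" "B (p (Suc i)) \<in> borel_measurable (F (p k))"
      using that k mono(1)[of i k] mono(2)[of i k] mono(1)[of "Suc i" k] mono(2)[of "Suc i" k]
      by (auto intro!: B_measurable_F)
    show ?thesis by measurable
  qed
  then show ?thesis unfolding mart_sum_def[abs_def] by (intro borel_measurable_sum) auto
qed

text \<open>One direction of the Ito isometry, accumulated from \<open>L2_step\<close>; the factor
  is the crude bound for the second moment of a Gaussian vector.\<close>

lemma mart_sum_L2:
  fixes h :: "nat \<Rightarrow> 'a \<Rightarrow> real ^ 'm ^ 'd::finite"
  assumes p: "time_grid n p"
    and h: "\<And>i. i < n \<Longrightarrow> h i \<in> borel_measurable (F (p i))" and k: "k \<le> n"
  shows "(\<integral>\<^sup>+ \<omega>. ennreal ((norm (mart_sum p h k \<omega>))\<^sup>2) \<partial>M) \<le>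
    ennreal (gauss_const TYPE('m) 1) * (\<integral>\<^sup>+ \<omega>. ennreal (\<Sum>i<k. (p (Suc i) - p i) * (norm (h i \<omega>))\<^sup>2) \<partial>M)"
  using k
proof (induction k)
  case 0 then show ?case by (simp add: mart_sum_def)
next
  case (Suc k)
  let ?c = "gauss_const TYPE('m) 1"
  have pk: "0 \<le> p k" using time_grid_nonneg[OF p, of k] Suc.prems by auto
  have hM [measurable]: "h i \<in> borel_measurable M" if "i \<le> k" for i
    using that h[of i] Suc.prems time_grid_nonneg[OF p, of i] by (intro measurable_F_M[OF h]) auto
  have lt: "p k < p (Suc k)" using time_grid_Suc[OF p] Suc.prems by simp
  have mk: "mart_sum p h k \<in> borel_measurable (F (p k))"
    using Suc.prems by (intro mart_sum_measurable[OF p h]) auto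
  have hk: "h k \<in> borel_measurable (F (p k))" using Suc.prems by (intro h) auto
  have "(\<integral>\<^sup>+ \<omega>. ennreal ((norm (mart_sum p h (Suc k) \<omega>))\<^sup>2) \<partial>M) \<le>
    (\<integral>\<^sup>+ \<omega>. ennreal ((norm (mart_sum p h k \<omega>))\<^sup>2) \<partial>M) + ennreal (?c * (p (Suc k) - p k)) * (\<integral>\<^sup>+ \<omega>. ennreal ((norm (h k \<omega>))\<^sup>2) \<partial>M)"
    using L2_step[OF pk lt mk hk] by (simp add: mart_sum_def)
  also have "\<dots> \<le> ennreal ?c * (\<integral>\<^sup>+ \<omega>. ennreal (\<Sum>i<k. (p (Suc i) - p i) * (norm (h i \<omega>))\<^sup>2) \<partial>M)
     + ennreal ?c * (\<integral>\<^sup>+ \<omega>. ennreal ((p (Suc k) - p k) * (norm (h k \<omega>))\<^sup>2) \<partial>M)"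
    using Suc time_grid_Suc[OF p, of k] gauss_const_nonneg[of 1, where ?'m = 'm]
    by (intro add_mono) (simp_all add: ennreal_mult mult.assoc nn_integral_cmult)
  also have "\<dots> = ennreal ?c * (\<integral>\<^sup>+ \<omega>. ennreal (\<Sum>i<k. (p (Suc i) - p i) * (norm (h i \<omega>))\<^sup>2) +
     ennreal ((p (Suc k) - p k) * (norm (h k \<omega>))\<^sup>2) \<partial>M)"
    by (subst nn_integral_add) (auto simp: distrib_left)
  also have "\<dots> = ennreal ?c * (\<integral>\<^sup>+ \<omega>. ennreal (\<Sum>i<Suc k. (p (Suc i) - p i) * (norm (h i \<omega>))\<^sup>2) \<partial>M)"
  proof -
    have "ennreal (\<Sum>i<k. (p (Suc i) - p i) * (norm (h i \<omega>))\<^sup>2) + ennreal ((p (Suc k) - p k) * (norm (h k \<omega>))\<^sup>2)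
      = ennreal (\<Sum>i<Suc k. (p (Suc i) - p i) * (norm (h i \<omega>))\<^sup>2)" for \<omega>
      using Suc.prems time_grid_Suc[OF p] by (subst ennreal_plus[symmetric]) (auto intro!: sum_nonneg mult_nonneg_nonneg simp: less_imp_le)
    then show ?thesis by simp
  qed
  finally show ?case .
qed

text \<open>The martingale is stopped as soon as its quadratic variation or its norm gets large; since
  both are known one step ahead, the stopped integrand is again adapted.\<close>

lemma mart_sum_maximal:
  fixes h :: "nat \<Rightarrow> 'a \<Rightarrow> real ^ 'm ^ 'd::finite"
  assumes p: "time_grid n p"
    and h: "\<And>i. i < n \<Longrightarrow> h i \<in> borel_measurable (F (p i))"
    and eps: "0 < \<epsilon>" and eta: "0 < \<eta>"
  shows "prob {\<omega> \<in> space M. \<exists>k\<le>n. \<epsilon> < norm (mart_sum p h k \<omega>)} \<le>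
    prob {\<omega> \<in> space M. \<eta> < (\<Sum>i<n. (p (Suc i) - p i) * (norm (h i \<omega>))\<^sup>2)} + gauss_const TYPE('m) 1 * \<eta> / \<epsilon>\<^sup>2"
proof -
  let ?c = "gauss_const TYPE('m) 1"
  define S where "S k \<omega> = (\<Sum>i<k. (p (Suc i) - p i) * (norm (h i \<omega>))\<^sup>2)" for k \<omega>
  \<comment> \<open>\<open>S (Suc k)\<close> already contains the term of h k, which is known at p
    k. Testing it before h k is used keeps the quadratic variation of h' below \<eta> without
    overshoot.\<close>
  define good where "good k \<omega> \<longleftrightarrow> S (Suc k) \<omega> \<le> \<eta> \<and> (\<forall>j\<in>{..k}. norm (mart_sum p h j \<omega>) \<le> \<epsilon>)" for k \<omega>
  define h' where "h' k \<omega> = (if good k \<omega> then h k \<omega> else 0)" for k \<omega>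
  have mono: "0 \<le> p i" "p i \<le> p j" if "i \<le> j" "j \<le> n" for i j
    using time_grid_le[OF p, of i j] time_grid_nonneg[OF p, of i] that by auto
  have hF: "h i \<in> borel_measurable (F (p j))" if "i \<le> j" "j < n" for i j
    using that mono[of i j] by (intro measurable_F_mono[OF h]) auto
  have mF: "mart_sum p h i \<in> borel_measurable (F (p j))" if "i \<le> j" "j \<le> n" for i j
    using that mono[of i j] by (intro measurable_F_mono[OF mart_sum_measurable[OF p h]]) auto
  have h'F: "h' k \<in> borel_measurable (F (p k))" if "k < n" for k
  proof -
    have [measurable]: "S (Suc k) \<in> borel_measurable (F (p k))"
      unfolding S_def[abs_def] using that by (intro borel_measurable_sum borel_measurable_times borel_measurable_power measurable_compose[OF hF borel_measurable_norm] borel_measurable_const) auto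
    have [measurable]: "mart_sum p h j \<in> borel_measurable (F (p k))" if "j \<in> {..k}" for j
      using that \<open>k < n\<close> by (intro mF) auto
    have "Measurable.pred (F (p k)) (good k)"
      unfolding good_def[abs_def] by measurable
    then show ?thesis unfolding h'_def[abs_def] using h[OF that] by measurable
  qed
  have le: "(\<Sum>i<k. (p (Suc i) - p i) * (norm (h' i \<omega>))\<^sup>2) \<le> \<eta>" if "k \<le> n" for k \<omega>
    using that
  proof (induction k)
    case (Suc k)
    show ?case
    proof (cases "good k \<omega>")
      case True
      have "(\<Sum>i<Suc k. (p (Suc i) - p i) * (norm (h' i \<omega>))\<^sup>2) \<le> S (Suc k) \<omega>"
        unfolding S_def using Suc.prems time_grid_Suc[OF p] by (intro sum_mono) (auto simp: h'_def less_imp_le)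
      then show ?thesis using True by (simp add: good_def)
    qed (use Suc in \<open>auto simp: h'_def\<close>)
  qed (use eta in auto)
  have [measurable]: "mart_sum p h' n \<in> borel_measurable M"
    using measurable_F_M[OF mart_sum_measurable[OF p h'F, of n]] mono[of n n] by simp
  have [measurable]: "mart_sum p h j \<in> borel_measurable M" if "j \<le> n" for j
    using measurable_F_M[OF mF[of j j]] mono[of j j] that by simp
  have hM: "h i \<in> borel_measurable M" if "i < n" for i
    using measurable_F_M[OF h[OF that]] mono[of i i] that by simp
  have [measurable]: "S n \<in> borel_measurable M"
    unfolding S_def[abs_def] by (intro borel_measurable_sum borel_measurable_times borel_measurable_power measurable_compose[OF hM borel_measurable_norm] borel_measurable_const) auto
  have "(\<integral>\<^sup>+ \<omega>. ennreal ((norm (mart_sum p h' n \<omega>))\<^sup>2) \<partial>M) \<le> ennreal ?c * (\<integral>\<^sup>+ \<omega>. ennreal (\<Sum>i<n. (p (Suc i) - p i) * (norm (h' i \<omega>))\<^sup>2) \<partial>M)"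
    by (rule mart_sum_L2[OF p h'F]) auto
  also have "\<dots> \<le> ennreal ?c * (\<integral>\<^sup>+ \<omega>. ennreal \<eta> \<partial>M)"
    by (intro mult_left_mono nn_integral_mono ennreal_leI le) auto
  also have "\<dots> = ennreal (?c * \<eta>)"
    using eta gauss_const_nonneg[of 1, where ?'m = 'm] by (simp add: emeasure_space_1 ennreal_mult)
  finally have L2: "(\<integral>\<^sup>+ \<omega>. ennreal ((norm (mart_sum p h' n \<omega>))\<^sup>2) \<partial>M) \<le> ennreal (?c * \<eta>)" .
  have sub: "{\<omega> \<in> space M. \<exists>k\<le>n. \<epsilon> < norm (mart_sum p h k \<omega>)} \<subseteq>
     {\<omega> \<in> space M. \<eta> < S n \<omega>} \<union> {\<omega> \<in> space M. \<epsilon> < norm (mart_sum p h' n \<omega>)}"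
  proof (rule subsetI, rule UnCI)
    fix \<omega> assume \<omega>: "\<omega> \<in> {\<omega> \<in> space M. \<exists>k\<le>n. \<epsilon> < norm (mart_sum p h k \<omega>)}"
      and "\<omega> \<notin> {\<omega> \<in> space M. \<epsilon> < norm (mart_sum p h' n \<omega>)}"
    then have no: "\<not> \<epsilon> < norm (mart_sum p h' n \<omega>)" by simp
    show "\<omega> \<in> {\<omega> \<in> space M. \<eta> < S n \<omega>}"
    proof (rule ccontr)
      assume "\<omega> \<notin> {\<omega> \<in> space M. \<eta> < S n \<omega>}"
      then have Sn: "S n \<omega> \<le> \<eta>" using \<omega> by auto
      define k where "k = (LEAST k. \<epsilon> < norm (mart_sum p h k \<omega>))"
      have k: "\<epsilon> < norm (mart_sum p h k \<omega>)" "k \<le> n" and kmin: "\<And>j. j < k \<Longrightarrow> norm (mart_sum p h j \<omega>) \<le> \<epsilon>"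
      proof -
        obtain k' where k': "\<epsilon> < norm (mart_sum p h k' \<omega>)" "k' \<le> n" using \<omega> by auto
        show "\<epsilon> < norm (mart_sum p h k \<omega>)" unfolding k_def using k'(1) by (rule LeastI)
        show "k \<le> n" unfolding k_def using Least_le[of "\<lambda>k. \<epsilon> < norm (mart_sum p h k \<omega>)", OF k'(1)] k'(2) by simp
        show "norm (mart_sum p h j \<omega>) \<le> \<epsilon>" if "j < k" for j
          using not_less_Least that unfolding k_def by fastforce
      qed
      have Smono: "S (Suc j) \<omega> \<le> S n \<omega>" if "j < n" for j
        unfolding S_def using that time_grid_Suc[OF p] by (intro sum_mono2) (auto simp: less_imp_le)
      have g1: "good j \<omega>" if "j < k" for j
        unfolding good_def using that k(2) Smono[of j] Sn kmin by auto
      have g2: "\<not> good j \<omega>" if "k \<le> j" for j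
        unfolding good_def using that k(1) by (auto intro!: bexI[of _ k])
      \<comment> \<open>h' coincides with h before the first exit k and vanishes from k on, so the
        stopped sum at the final index still shows the value at the exit. A second moment at the
        single index n therefore controls the maximum.\<close>
      have "mart_sum p h' n \<omega> = (\<Sum>i<n. if i < k then h i \<omega> *v (B (p (Suc i)) \<omega> - B (p i) \<omega>) else 0)"
        unfolding mart_sum_def by (intro sum.cong) (auto simp: h'_def g1 g2 not_less)
      also have "\<dots> = mart_sum p h k \<omega>"
        unfolding mart_sum_def using k(2) by (subst sum.inter_filter[symmetric]) (auto intro!: sum.cong)
      finally have "mart_sum p h' n \<omega> = mart_sum p h k \<omega>" .
      with k(1) no show False by simp
    qed
  qed
  have Markov: "prob {\<omega> \<in> space M. \<epsilon> < norm (mart_sum p h' n \<omega>)} \<le> ?c * \<eta> / \<epsilon>\<^sup>2"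
    using eta gauss_const_nonneg[of 1, where ?'m = 'm] by (intro second_moment_tail[OF _ eps L2]) auto
  have "prob {\<omega> \<in> space M. \<exists>k\<le>n. \<epsilon> < norm (mart_sum p h k \<omega>)} \<le>
     prob ({\<omega> \<in> space M. \<eta> < S n \<omega>} \<union> {\<omega> \<in> space M. \<epsilon> < norm (mart_sum p h' n \<omega>)})"
    by (rule finite_measure_mono[OF sub]) measurable
  also have "\<dots> \<le> prob {\<omega> \<in> space M. \<eta> < S n \<omega>} + prob {\<omega> \<in> space M. \<epsilon> < norm (mart_sum p h' n \<omega>)}"
    by (rule measure_Un_le) measurable
  finally show ?thesis using Markov unfolding S_def by linarith
qed

end

section \<open>Common refinement of partitions for step processes\<close>

lemma bounded_bilinear_matrix_vector_mult:
  "bounded_bilinear ((*v) :: real ^ 'm::finite ^ 'd::finite \<Rightarrow> _)"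
proof
  show "\<exists>K. \<forall>a b. norm (a *v b :: real ^ 'd) \<le> norm a * norm (b :: real ^ 'm) * K"
    using norm_matrix_vector_mult_le by (intro exI[of _ 1]) auto
qed (simp_all add: matrix_vector_mult_def vec_eq_iff sum.distrib algebra_simps sum_distrib_left)

lemma finite_set_time_grid:
  fixes P :: "real set"
  assumes P: "finite P" "P \<noteq> {}" "P \<subseteq> {0..}"
  obtains n p where "time_grid n p" "p ` {..n} = P"
proof
  let ?l = "sorted_list_of_set P"
  have l: "length ?l = card P" "set ?l = P" using P by auto
  have c: "0 < card P" using P by (simp add: card_gt_0_iff)
  then have ix: "{..card P - 1} = {..<length ?l}" using l by auto
  show im: "(\<lambda>i. ?l ! i) ` {..card P - 1} = P"
    unfolding ix using l(2) by (auto simp: set_conv_nth)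
  have "?l ! i < ?l ! Suc i" if "i < card P - 1" for i
    using sorted_list_of_set.strict_sorted_key_list_of_set that l c
    by (intro sorted_wrt_nth_less[of "(<)"]) auto
  moreover have "?l ! 0 \<in> P" using c l by (metis nth_mem)
  ultimately show "time_grid (card P - 1) (\<lambda>i. ?l ! i)" unfolding time_grid_def using P(3) by auto
qed

text \<open>The telescoping sum runs over all cells, selected by a condition instead of an index
  range, so that \<open>refine_sum\<close> can interchange it with the sum over the coarse
  intervals.\<close>

lemma time_grid_telescope:
  fixes G :: "real \<Rightarrow> 'b::ab_group_add"
  assumes p: "time_grid N p" and ab: "a \<le> b" "b \<le> N"
  shows "G (p b) - G (p a) = (\<Sum>i<N. if p a \<le> p i \<and> p (Suc i) \<le> p b then G (p (Suc i)) - G (p i) else 0)"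
proof -
  have iff: "p a \<le> p i \<longleftrightarrow> a \<le> i" "p (Suc i) \<le> p b \<longleftrightarrow> Suc i \<le> b" if "i < N" for i
    using time_grid_le[OF p, of a i] time_grid_less[OF p, of i a] time_grid_le[OF p, of "Suc i" b]
      time_grid_less[OF p, of b "Suc i"] that ab by (auto simp: not_le[symmetric])
  have "G (p b) - G (p a) = (\<Sum>i = a..<b. G (p (Suc i)) - G (p i))"
    using sum_Suc_diff'[OF ab(1), of "\<lambda>i. G (p i)"] by simp
  also have "\<dots> = (\<Sum>i<N. if a \<le> i \<and> Suc i \<le> b then G (p (Suc i)) - G (p i) else 0)"
    using ab by (subst sum.inter_filter[symmetric]) (auto intro!: sum.cong)
  also have "\<dots> = (\<Sum>i<N. if p a \<le> p i \<and> p (Suc i) \<le> p b then G (p (Suc i)) - G (p i) else 0)"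
    by (intro sum.cong) (auto simp: iff)
  finally show ?thesis .
qed

text \<open>The value of the step process on the ith cell of a finer grid p: the coarse intervals
  containing that cell are selected by the condition. Degenerate intervals of \<tau> contain no cell
  and drop out.\<close>

definition refine :: "nat \<Rightarrow> (nat \<Rightarrow> real) \<Rightarrow> (nat \<Rightarrow> 'a \<Rightarrow> 'b::real_normed_vector) \<Rightarrow> (nat \<Rightarrow> real) \<Rightarrow> nat \<Rightarrow> 'a \<Rightarrow> 'b" where
  "refine n \<tau> \<xi> p i \<omega> = (\<Sum>j<n. if \<tau> j \<le> p i \<and> p (Suc i) \<le> \<tau> (Suc j) then \<xi> j \<omega> else 0)"

text \<open>Stated for an arbitrary bilinear product and integrator G, because it is needed twice:
  with indicator functions for the process itself and with Brownian paths for its integral.\<close>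

lemma refine_sum:
  assumes pr: "bounded_bilinear pr" and p: "time_grid N p"
    and \<tau>: "\<And>j. j < n \<Longrightarrow> \<tau> j \<le> \<tau> (Suc j)" and sub: "\<tau> ` {..n} \<subseteq> p ` {..N}"
  shows "(\<Sum>j<n. pr (\<xi> j \<omega>) (G (\<tau> (Suc j)) - G (\<tau> j))) = (\<Sum>i<N. pr (refine n \<tau> \<xi> p i \<omega>) (G (p (Suc i)) - G (p i)))"
proof -
  interpret bounded_bilinear pr by (rule pr)
  have tel: "G (\<tau> (Suc j)) - G (\<tau> j) = (\<Sum>i<N. if \<tau> j \<le> p i \<and> p (Suc i) \<le> \<tau> (Suc j) then G (p (Suc i)) - G (p i) else 0)"
    if "j < n" for j
  proof -
    have "\<tau> j \<in> p ` {..N}" "\<tau> (Suc j) \<in> p ` {..N}" using sub that by auto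
    then obtain a b where ab: "\<tau> j = p a" "\<tau> (Suc j) = p b" "a \<le> N" "b \<le> N"
      by (auto elim!: imageE)
    have "a \<le> b"
    proof (rule ccontr)
      assume "\<not> a \<le> b"
      then have "p b < p a" using ab by (intro time_grid_less[OF p]) auto
      then show False using \<tau>[OF that] ab by simp
    qed
    then show ?thesis unfolding ab using ab by (intro time_grid_telescope[OF p]) auto
  qed
  have "(\<Sum>j<n. pr (\<xi> j \<omega>) (G (\<tau> (Suc j)) - G (\<tau> j))) =
    (\<Sum>j<n. \<Sum>i<N. pr (if \<tau> j \<le> p i \<and> p (Suc i) \<le> \<tau> (Suc j) then \<xi> j \<omega> else 0) (G (p (Suc i)) - G (p i)))"
    by (intro sum.cong refl) (auto simp: tel sum_right zero_left zero_right intro!: sum.cong)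
  also have "\<dots> = (\<Sum>i<N. \<Sum>j<n. pr (if \<tau> j \<le> p i \<and> p (Suc i) \<le> \<tau> (Suc j) then \<xi> j \<omega> else 0) (G (p (Suc i)) - G (p i)))"
    by (rule sum.swap)
  also have "\<dots> = (\<Sum>i<N. pr (refine n \<tau> \<xi> p i \<omega>) (G (p (Suc i)) - G (p i)))"
    by (simp add: refine_def sum_left)
  finally show ?thesis .
qed

text \<open>Turns the indicator of a cell into an increment of a function of the endpoint, the shape
  that \<open>refine_sum\<close> expects.\<close>

lemma indicator_Ioc_eq_diff:
  fixes x y s :: real
  shows "x \<le> y \<Longrightarrow> indicator {x<..y} s = (indicator {s..} y - indicator {s..} x :: real)"
  by (auto split: split_indicator)

lemma refine_simple_process:
  fixes \<xi> :: "nat \<Rightarrow> 'a \<Rightarrow> real ^ 'm::finite ^ 'd::finite"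
  assumes p: "time_grid N p"
    and \<tau>: "\<And>j. j < n \<Longrightarrow> \<tau> j \<le> \<tau> (Suc j)" and sub: "\<tau> ` {..n} \<subseteq> p ` {..N}"
  shows "simple_process n \<tau> \<xi> s \<omega> = simple_process N p (refine n \<tau> \<xi> p) s \<omega>"
proof -

  have "simple_process n \<tau> \<xi> s \<omega> = (\<Sum>j<n. (indicator {s..} (\<tau> (Suc j)) - indicator {s..} (\<tau> j)) *\<^sub>R \<xi> j \<omega>)"
    unfolding simple_process_def by (intro sum.cong refl) (simp add: indicator_Ioc_eq_diff[OF \<tau>])
  also have "\<dots> = (\<Sum>i<N. (indicator {s..} (p (Suc i)) - indicator {s..} (p i)) *\<^sub>R refine n \<tau> \<xi> p i \<omega>)"
    by (rule refine_sum[OF bounded_bilinear.flip[OF bounded_bilinear_scaleR] p \<tau> sub])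
  also have "\<dots> = simple_process N p (refine n \<tau> \<xi> p) s \<omega>"
    unfolding simple_process_def
    by (intro sum.cong refl) (simp add: indicator_Ioc_eq_diff[OF less_imp_le[OF time_grid_Suc[OF p]]])
  finally show ?thesis .
qed

lemma refine_simple_ito_integral:
  assumes p: "time_grid N p"
    and \<tau>: "\<And>j. j < n \<Longrightarrow> \<tau> j \<le> \<tau> (Suc j)" and sub: "\<tau> ` {..n} \<subseteq> p ` {..N}"
  shows "simple_ito_integral B n \<tau> \<xi> t \<omega> = simple_ito_integral B N p (refine n \<tau> \<xi> p) t \<omega>"
  unfolding simple_ito_integral_def
  by (rule refine_sum[OF bounded_bilinear_matrix_vector_mult p \<tau> sub, where G = "\<lambda>r. B (min t r) \<omega>"])

lemma grid_indicator_unique: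
  assumes p: "time_grid N p" and i: "i < N" and s: "s \<in> {p i<..p (Suc i)}" and j: "j < N"
  shows "indicator {p j<..p (Suc j)} s = (if j = i then 1 else 0 :: real)"
proof (cases i j rule: linorder_cases)
  case less
  then show ?thesis using time_grid_le[OF p, of "Suc i" j] s j by (auto split: split_indicator)
next
  case greater
  then show ?thesis using time_grid_le[OF p, of "Suc j" i] s i by (auto split: split_indicator)
qed (use s in auto)

text \<open>The cells are disjoint, so at most one summand is nonzero and \<Psi> acts on it
  alone.\<close>

lemma grid_step_transform:
  fixes c :: "nat \<Rightarrow> 'b::real_vector" and \<Psi> :: "'b \<Rightarrow> 'c::real_vector"
  assumes p: "time_grid N p" and \<Psi>: "\<Psi> 0 = 0"
  shows "\<Psi> (\<Sum>i<N. indicator {p i<..p (Suc i)} s *\<^sub>R c i) = (\<Sum>i<N. indicator {p i<..p (Suc i)} s *\<^sub>R \<Psi> (c i))"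
proof (cases "\<exists>i<N. s \<in> {p i<..p (Suc i)}")
  case True
  then obtain i where i: "i < N" "s \<in> {p i<..p (Suc i)}" by auto
  have *: "(\<Sum>j<N. indicator {p j<..p (Suc j)} s *\<^sub>R d j) = d i" for d :: "nat \<Rightarrow> 'z::real_vector"
  proof -
    have "(\<Sum>j<N. indicator {p j<..p (Suc j)} s *\<^sub>R d j) = (\<Sum>j<N. if j = i then d j else 0)"
      using grid_indicator_unique[OF p i] by (intro sum.cong) auto
    then show ?thesis using i by simp
  qed
  show ?thesis unfolding * ..
next
  case False
  then have "indicator {p i<..p (Suc i)} s = (0 :: real)" if "i < N" for i
    using that by (auto split: split_indicator)
  then show ?thesis using \<Psi> by simp
qed

lemma grid_step_integral:
  fixes c :: "nat \<Rightarrow> 'b::{banach, second_countable_topology}"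
  assumes p: "time_grid N p" and K: "K \<le> N"
  shows "set_integrable lborel {0..p K} (\<lambda>s. \<Sum>i<N. indicator {p i<..p (Suc i)} s *\<^sub>R c i)"
    and "(LBINT s:{0..p K}. (\<Sum>i<N. indicator {p i<..p (Suc i)} s *\<^sub>R c i)) = (\<Sum>i<K. (p (Suc i) - p i) *\<^sub>R c i)"
proof -
  have eq: "indicator {0..p K} s *\<^sub>R (\<Sum>i<N. indicator {p i<..p (Suc i)} s *\<^sub>R c i) =
      (\<Sum>i<K. indicator {p i<..p (Suc i)} s *\<^sub>R c i)" for s :: real
  proof -
    have "indicator {0..p K} s *\<^sub>R (\<Sum>i<N. indicator {p i<..p (Suc i)} s *\<^sub>R c i) =
      (\<Sum>i<N. if i < K then indicator {p i<..p (Suc i)} s *\<^sub>R c i else 0)"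
      unfolding scaleR_sum_right
    proof (intro sum.cong refl)
      fix i assume "i \<in> {..<N}"
      then have i: "i < N" by simp
      show "indicator {0..p K} s *\<^sub>R indicator {p i<..p (Suc i)} s *\<^sub>R c i = (if i < K then indicator {p i<..p (Suc i)} s *\<^sub>R c i else 0)"
      proof (cases "i < K")
        case True
        then have "p (Suc i) \<le> p K" "0 \<le> p i" using K i by (auto intro: time_grid_le[OF p] time_grid_nonneg[OF p])
        then show ?thesis using True by (auto split: split_indicator)
      next
        case False
        then have "p K \<le> p i" using i by (intro time_grid_le[OF p]) auto
        then show ?thesis using False by (auto split: split_indicator)
      qed
    qed
    also have "\<dots> = (\<Sum>i<K. indicator {p i<..p (Suc i)} s *\<^sub>R c i)"
      using K by (subst sum.inter_filter[symmetric]) (auto intro!: sum.cong)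
    finally show ?thesis .
  qed
  have int: "integrable lborel (\<lambda>s :: real. indicator {p i<..p (Suc i)} s *\<^sub>R c i)"
    and val: "(\<integral> s. indicator {p i<..p (Suc i)} s *\<^sub>R c i \<partial>lborel) = (p (Suc i) - p i) *\<^sub>R c i" if "i < N" for i
  proof -
    have le: "p i \<le> p (Suc i)" using time_grid_Suc[OF p that] by simp
    then show int: "integrable lborel (\<lambda>s :: real. indicator {p i<..p (Suc i)} s *\<^sub>R c i)"
      by (intro integrable_scaleR_left integrable_real_indicator) auto
    show "(\<integral> s. indicator {p i<..p (Suc i)} s *\<^sub>R c i \<partial>lborel) = (p (Suc i) - p i) *\<^sub>R c i"
      using le by (subst integral_scaleR_left) (auto intro!: integrable_real_indicator)
  qed
  show "set_integrable lborel {0..p K} (\<lambda>s. \<Sum>i<N. indicator {p i<..p (Suc i)} s *\<^sub>R c i)"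
    unfolding set_integrable_def eq using int K by (intro Bochner_Integration.integrable_sum) auto
  show "(LBINT s:{0..p K}. (\<Sum>i<N. indicator {p i<..p (Suc i)} s *\<^sub>R c i)) = (\<Sum>i<K. (p (Suc i) - p i) *\<^sub>R c i)"
    unfolding set_lebesgue_integral_def eq using int val K by (subst Bochner_Integration.integral_sum) auto
qed

text \<open>\<open>simple_integrand\<close> with the boundedness dropped: the values of the
  integrand sampled at grid times, which form the Riemann sums, are adapted but may be
  unbounded.\<close>

definition adapted_step ::
    "(real \<Rightarrow> 'a measure) \<Rightarrow> nat \<Rightarrow> (nat \<Rightarrow> real) \<Rightarrow> (nat \<Rightarrow> 'a \<Rightarrow> real ^ 'm::finite ^ 'd::finite) \<Rightarrow> bool" where
  "adapted_step F n \<tau> \<xi> \<longleftrightarrow> 0 \<le> \<tau> 0 \<and> (\<forall>i<n. \<tau> i \<le> \<tau> (Suc i)) \<and> (\<forall>i<n. \<xi> i \<in> borel_measurable (F (\<tau> i)))"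

lemma simple_integrand_adapted_step: "simple_integrand M F n \<tau> \<xi> \<Longrightarrow> adapted_step F n \<tau> \<xi>"
  by (simp add: simple_integrand_def adapted_step_def)

lemma adapted_step_nonneg:
  assumes "adapted_step F n \<tau> \<xi>" "i \<le> n" shows "0 \<le> \<tau> i"
  using assms(2)
proof (induction i)
  case 0 then show ?case using assms(1) by (simp add: adapted_step_def)
next
  case (Suc i)
  then have "0 \<le> \<tau> i" "\<tau> i \<le> \<tau> (Suc i)" using assms(1) by (auto simp: adapted_step_def)
  then show ?case by simp
qed

section \<open>Comparing the integrals of two step processes\<close>

context brownian
begin

lemma refine_measurable:
  assumes a: "adapted_step F n \<tau> \<xi>" and p: "time_grid N p" and i: "i < N"
  shows "refine n \<tau> \<xi> p i \<in> borel_measurable (F (p i))"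
  unfolding refine_def[abs_def]
proof (intro borel_measurable_sum)
  fix j assume j: "j \<in> {..<n}"
  show "(\<lambda>\<omega>. if \<tau> j \<le> p i \<and> p (Suc i) \<le> \<tau> (Suc j) then \<xi> j \<omega> else 0) \<in> borel_measurable (F (p i))"
  proof (cases "\<tau> j \<le> p i \<and> p (Suc i) \<le> \<tau> (Suc j)")
    case True
    then show ?thesis using a j adapted_step_nonneg[OF a, of j]
      by (auto simp: adapted_step_def intro: measurable_F_mono)
  qed auto
qed

lemma simple_ito_integral_grid:
  assumes p: "time_grid N p" and K: "K \<le> N"
  shows "simple_ito_integral B N p h (p K) \<omega> = mart_sum p h K \<omega>"
proof -
  have "simple_ito_integral B N p h (p K) \<omega> = (\<Sum>i<N. if i < K then h i \<omega> *v (B (p (Suc i)) \<omega> - B (p i) \<omega>) else 0)"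
    unfolding simple_ito_integral_def
  proof (intro sum.cong refl)
    fix i assume "i \<in> {..<N}"
    then have i: "i < N" by simp
    show "h i \<omega> *v (B (min (p K) (p (Suc i))) \<omega> - B (min (p K) (p i)) \<omega>) = (if i < K then h i \<omega> *v (B (p (Suc i)) \<omega> - B (p i) \<omega>) else 0)"
    proof (cases "i < K")
      case True
      then have "p (Suc i) \<le> p K" "p i \<le> p K" using K by (auto intro: time_grid_le[OF p])
      then show ?thesis using True by (simp add: min_absorb2)
    next
      case False
      then have "p K \<le> p i" "p K \<le> p (Suc i)" using i by (auto intro: time_grid_le[OF p])
      then show ?thesis using False by (simp add: min_absorb1)
    qed
  qed
  also have "\<dots> = mart_sum p h K \<omega>"
    unfolding mart_sum_def using K by (subst sum.inter_filter[symmetric]) (auto intro!: sum.cong)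
  finally show ?thesis .
qed

text \<open>On a common refinement of both partitions and of Q, the difference of the two integrals
  becomes a single discrete stochastic integral and D becomes its quadratic variation, so the
  discrete maximal inequality applies.\<close>

lemma simple_ito_integral_maximal:
  fixes \<xi> \<xi>' :: "nat \<Rightarrow> 'a \<Rightarrow> real ^ 'm ^ 'd::finite"
  assumes a: "adapted_step F n \<tau> \<xi>" and a': "adapted_step F n' \<tau>' \<xi>'"
    and Q: "finite Q" "Q \<subseteq> {0..t}" and t: "0 \<le> t" and eps: "0 < \<epsilon>" and eta: "0 < \<eta>"
  defines "D \<equiv> \<lambda>\<omega>. LBINT s:{0..t}. (norm (simple_process n \<tau> \<xi> s \<omega> - simple_process n' \<tau>' \<xi>' s \<omega>))\<^sup>2"
  shows "D \<in> borel_measurable M"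
    and "prob {\<omega> \<in> space M. \<exists>s\<in>Q. \<epsilon> < norm (simple_ito_integral B n \<tau> \<xi> s \<omega> - simple_ito_integral B n' \<tau>' \<xi>' s \<omega>)}
      \<le> prob {\<omega> \<in> space M. \<eta> < D \<omega>} + gauss_const TYPE('m) 1 * \<eta> / \<epsilon>\<^sup>2"
    and "set_integrable lborel {0..t} (\<lambda>s. (norm (simple_process n \<tau> \<xi> s \<omega> - simple_process n' \<tau>' \<xi>' s \<omega>))\<^sup>2)"
proof -
  \<comment> \<open>The point t is included so that the integral over [0, t] ends at a grid point;
    the points of Q are included because the maximum is taken over them.\<close>
  let ?P = "\<tau> ` {..n} \<union> \<tau>' ` {..n'} \<union> Q \<union> {0, t}"
  have "finite ?P" "?P \<noteq> {}" "?P \<subseteq> {0..}"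
    using Q t adapted_step_nonneg[OF a] adapted_step_nonneg[OF a'] by auto
  then obtain N p where p: "time_grid N p" and im: "p ` {..N} = ?P"
    by (rule finite_set_time_grid)
  have sub: "\<tau> ` {..n} \<subseteq> p ` {..N}" "\<tau>' ` {..n'} \<subseteq> p ` {..N}" unfolding im by auto
  have mono: "\<And>j. j < n \<Longrightarrow> \<tau> j \<le> \<tau> (Suc j)" "\<And>j. j < n' \<Longrightarrow> \<tau>' j \<le> \<tau>' (Suc j)"
    using a a' by (auto simp: adapted_step_def)
  define d where "d i \<omega> = refine n \<tau> \<xi> p i \<omega> - refine n' \<tau>' \<xi>' p i \<omega>" for i \<omega>
  have "t \<in> p ` {..N}" unfolding im by auto
  then obtain K where K: "K \<le> N" "t = p K" by auto
  have dF: "d i \<in> borel_measurable (F (p i))" if "i < N" for i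
    unfolding d_def[abs_def] by (intro borel_measurable_diff refine_measurable[OF a p that] refine_measurable[OF a' p that])
  have dM: "d i \<in> borel_measurable M" if "i < N" for i
    using measurable_F_M[OF dF[OF that]] time_grid_nonneg[OF p, of i] that by simp
  have proc: "(norm (simple_process n \<tau> \<xi> s \<omega> - simple_process n' \<tau>' \<xi>' s \<omega>))\<^sup>2 =
      (\<Sum>i<N. indicator {p i<..p (Suc i)} s *\<^sub>R (norm (d i \<omega>))\<^sup>2)" for s \<omega>
  proof -
    have "simple_process n \<tau> \<xi> s \<omega> = simple_process N p (refine n \<tau> \<xi> p) s \<omega>"
      by (rule refine_simple_process[OF p mono(1) sub(1)])
    moreover have "simple_process n' \<tau>' \<xi>' s \<omega> = simple_process N p (refine n' \<tau>' \<xi>' p) s \<omega>"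
      by (rule refine_simple_process[OF p mono(2) sub(2)])
    ultimately have "simple_process n \<tau> \<xi> s \<omega> - simple_process n' \<tau>' \<xi>' s \<omega> = (\<Sum>i<N. indicator {p i<..p (Suc i)} s *\<^sub>R d i \<omega>)"
      unfolding d_def scaleR_diff_right sum_subtractf by (simp only: simple_process_def)
    then show ?thesis using grid_step_transform[OF p, of "\<lambda>x. (norm x)\<^sup>2" s "\<lambda>i. d i \<omega>"] by simp
  qed
  have D: "D \<omega> = (\<Sum>i<K. (p (Suc i) - p i) * (norm (d i \<omega>))\<^sup>2)" for \<omega>
    unfolding D_def proc K(2) grid_step_integral(2)[OF p K(1)] by simp
  show "set_integrable lborel {0..t} (\<lambda>s. (norm (simple_process n \<tau> \<xi> s \<omega> - simple_process n' \<tau>' \<xi>' s \<omega>))\<^sup>2)"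
    unfolding proc K(2) by (rule grid_step_integral(1)[OF p K(1)])
  show "D \<in> borel_measurable M"
    unfolding D[abs_def] using K
    by (intro borel_measurable_sum borel_measurable_times borel_measurable_power measurable_compose[OF dM borel_measurable_norm] borel_measurable_const) auto
  \<comment> \<open>The grid is cut at t = p K, since only the cells before t contribute to
    D.\<close>
  have pK: "time_grid K p" using p K by (auto simp: time_grid_def)
  have ito: "simple_ito_integral B n \<tau> \<xi> (p k) \<omega> - simple_ito_integral B n' \<tau>' \<xi>' (p k) \<omega> = mart_sum p d k \<omega>"
    if "k \<le> N" for k \<omega>
  proof -
    have "simple_ito_integral B n \<tau> \<xi> (p k) \<omega> = mart_sum p (refine n \<tau> \<xi> p) k \<omega>"
      using refine_simple_ito_integral[OF p mono(1) sub(1), where B = B and t = "p k" and \<omega> = \<omega> and \<xi> = \<xi>]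
        simple_ito_integral_grid[OF p that] by simp
    moreover have "simple_ito_integral B n' \<tau>' \<xi>' (p k) \<omega> = mart_sum p (refine n' \<tau>' \<xi>' p) k \<omega>"
      using refine_simple_ito_integral[OF p mono(2) sub(2), where B = B and t = "p k" and \<omega> = \<omega> and \<xi> = \<xi>']
        simple_ito_integral_grid[OF p that] by simp
    ultimately show ?thesis
      by (simp add: mart_sum_def d_def sum_subtractf bounded_bilinear.diff_left[OF bounded_bilinear_matrix_vector_mult])
  qed
  have Qk: "\<exists>k\<le>K. s = p k" if "s \<in> Q" for s
  proof -
    have "s \<in> p ` {..N}" unfolding im using that by auto
    then obtain k where k: "k \<le> N" "s = p k" by auto
    have "k \<le> K"
      using time_grid_less[OF p, of K k] k K Q(2) that by (auto simp: not_less[symmetric])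
    then show ?thesis using k by auto
  qed
  have [measurable]: "mart_sum p d k \<in> borel_measurable M" if "k \<le> K" for k
    using measurable_F_M[OF mart_sum_measurable[OF p dF, of k]] time_grid_nonneg[OF p, of k] that K by simp
  have "prob {\<omega> \<in> space M. \<exists>s\<in>Q. \<epsilon> < norm (simple_ito_integral B n \<tau> \<xi> s \<omega> - simple_ito_integral B n' \<tau>' \<xi>' s \<omega>)} \<le>
    prob {\<omega> \<in> space M. \<exists>k\<le>K. \<epsilon> < norm (mart_sum p d k \<omega>)}"
  proof (rule finite_measure_mono)
    show "{\<omega> \<in> space M. \<exists>s\<in>Q. \<epsilon> < norm (simple_ito_integral B n \<tau> \<xi> s \<omega> - simple_ito_integral B n' \<tau>' \<xi>' s \<omega>)} \<subseteq>
       {\<omega> \<in> space M. \<exists>k\<le>K. \<epsilon> < norm (mart_sum p d k \<omega>)}"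
      using Qk ito K by (fastforce dest: order_trans)
  qed measurable
  also have "\<dots> \<le> prob {\<omega> \<in> space M. \<eta> < D \<omega>} + gauss_const TYPE('m) 1 * \<eta> / \<epsilon>\<^sup>2"
    unfolding D using K by (intro mart_sum_maximal[OF pK _ eps eta] dF) auto
  finally show "prob {\<omega> \<in> space M. \<exists>s\<in>Q. \<epsilon> < norm (simple_ito_integral B n \<tau> \<xi> s \<omega> - simple_ito_integral B n' \<tau>' \<xi>' s \<omega>)}
      \<le> prob {\<omega> \<in> space M. \<eta> < D \<omega>} + gauss_const TYPE('m) 1 * \<eta> / \<epsilon>\<^sup>2" .
qed

end

section \<open>Riemann sums of stochastic integrals\<close>

lemma norm_diff_square_le: "(norm (a - b))\<^sup>2 \<le> 2 * (norm (a - c))\<^sup>2 + 2 * (norm (b - c))\<^sup>2"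
  for a b c :: "'b::real_normed_vector"
proof -
  have "norm (a - b) \<le> norm (a - c) + norm (b - c)"
    using norm_triangle_ineq4[of "a - c" "b - c"] by simp
  then have "(norm (a - b))\<^sup>2 \<le> (norm (a - c) + norm (b - c))\<^sup>2" by (rule power_mono) simp
  also have "\<dots> \<le> 2 * (norm (a - c))\<^sup>2 + 2 * (norm (b - c))\<^sup>2"
    using zero_le_power2[of "norm (a - c) - norm (b - c)"] by (simp add: power2_sum power2_diff)
  finally show ?thesis .
qed

lemma set_integral_norm_diff_square_le:
  fixes a b h :: "real \<Rightarrow> 'b::real_normed_vector"
  assumes "set_integrable lborel S (\<lambda>s. (norm (a s - b s))\<^sup>2)"
    "set_integrable lborel S (\<lambda>s. (norm (a s - h s))\<^sup>2)" "set_integrable lborel S (\<lambda>s. (norm (b s - h s))\<^sup>2)"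
  shows "(LBINT s:S. (norm (a s - b s))\<^sup>2) \<le> 2 * (LBINT s:S. (norm (a s - h s))\<^sup>2) + 2 * (LBINT s:S. (norm (b s - h s))\<^sup>2)"
proof -
  have "(LBINT s:S. (norm (a s - b s))\<^sup>2) \<le> (LBINT s:S. 2 * (norm (a s - h s))\<^sup>2 + 2 * (norm (b s - h s))\<^sup>2)"
    using assms by (intro set_integral_mono set_integral_add(1) set_integrable_mult_right norm_diff_square_le)
  also have "\<dots> = 2 * (LBINT s:S. (norm (a s - h s))\<^sup>2) + 2 * (LBINT s:S. (norm (b s - h s))\<^sup>2)"
    using assms by (subst set_integral_add(2)) (simp_all add: set_integrable_mult_right)
  finally show ?thesis .
qed

lemma set_integral_mono_subset:
  fixes a :: "real \<Rightarrow> real"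
  assumes S': "set_integrable lborel S' a" and sub: "S \<subseteq> S'" "S \<in> sets borel" and nn: "\<And>s. 0 \<le> a s"
  shows "(LBINT s:S. a s) \<le> (LBINT s:S'. a s)"
proof -
  have "set_integrable lborel S a" by (rule set_integrable_subset[OF S']) (use sub in auto)
  then show ?thesis
    using S' sub nn unfolding set_lebesgue_integral_def set_integrable_def
    by (intro integral_mono) (auto split: split_indicator)
qed

lemma time_grid_cover:
  assumes "time_grid N p" "p 0 < s" "s \<le> p N"
  shows "\<exists>i<N. s \<in> {p i<..p (Suc i)}"
  using assms
proof (induction N)
  case (Suc N)
  show ?case
  proof (cases "s \<le> p N")
    case True
    have "time_grid N p" using Suc.prems by (simp add: time_grid_def)
    then obtain i where "i < N" "s \<in> {p i<..p (Suc i)}" using Suc.IH Suc.prems(2) True by blast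
    then show ?thesis by (intro exI[of _ i]) simp
  qed (use Suc.prems in auto)
qed simp

lemma simple_process_grid:
  assumes "time_grid N p" "i < N" "s \<in> {p i<..p (Suc i)}"
  shows "simple_process N p h s \<omega> = h i \<omega>"
proof -
  have "simple_process N p h s \<omega> = (\<Sum>j<N. if j = i then h j \<omega> else 0)"
    unfolding simple_process_def using grid_indicator_unique[OF assms] by (intro sum.cong) auto
  then show ?thesis using assms by simp
qed

lemma simple_process_measurable_time: "(\<lambda>s. simple_process n \<tau> \<xi> s \<omega>) \<in> borel_measurable borel"
  unfolding simple_process_def by measurable

lemma set_borel_measurable_norm_diff_square:
  fixes a h :: "real \<Rightarrow> 'b::{real_normed_vector, second_countable_topology}"
  assumes a: "a \<in> borel_measurable borel" and h: "set_borel_measurable lborel {0..t} h"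
  shows "set_borel_measurable lborel {0..t} (\<lambda>s. (norm (a s - h s))\<^sup>2)"
proof -
  have [measurable]: "a \<in> borel_measurable borel" by (rule a)
  have [measurable]: "(\<lambda>s. indicator {0..t} s *\<^sub>R h s) \<in> borel_measurable lborel"
    using h by (simp add: set_borel_measurable_def)
  have "(\<lambda>s. (norm (indicator {0..t} s *\<^sub>R a s - indicator {0..t} s *\<^sub>R h s))\<^sup>2) \<in> borel_measurable lborel"
    by measurable
  moreover have "(norm (indicator {0..t} s *\<^sub>R a s - indicator {0..t} s *\<^sub>R h s))\<^sup>2 = indicator {0..t} s *\<^sub>R (norm (a s - h s))\<^sup>2" for s
    by (auto split: split_indicator)
  ultimately show ?thesis by (simp add: set_borel_measurable_def)
qed

text \<open>J t is a version of the integral chosen for each t separately; the family carries no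
  path regularity, and different times are related only through common approximating
  sequences.\<close>

locale ito_process = brownian M F B
  for M :: "'a measure" and F and B :: "real \<Rightarrow> 'a \<Rightarrow> real ^ 'm::finite" +
  fixes H :: "real \<Rightarrow> 'a \<Rightarrow> real ^ 'm ^ 'd::finite" and J :: "real \<Rightarrow> 'a \<Rightarrow> real ^ 'd"
  assumes ito: "0 \<le> t \<Longrightarrow> has_ito_integral M F B H t (J t)"
begin

lemma H_adapted: "0 \<le> t \<Longrightarrow> H t \<in> borel_measurable (F t)"
  using ito[of 0] by (simp add: has_ito_integral_def adapted_def)

lemma H_square_integrable:
  assumes "0 \<le> t"
  shows "AE \<omega> in M. set_borel_measurable lborel {0..t} (\<lambda>s. H s \<omega>) \<and> set_integrable lborel {0..t} (\<lambda>s. (norm (H s \<omega>))\<^sup>2)"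
  using ito[OF assms] by (simp add: has_ito_integral_def)

lemma J_measurable: "0 \<le> t \<Longrightarrow> J t \<in> borel_measurable M"
  using ito[of t] by (auto simp: has_ito_integral_def conv_in_prob_def)

lemma step_diff_integrable:
  assumes a: "adapted_step F n \<tau> \<xi>" and t: "0 \<le> t"
  shows "AE \<omega> in M. set_integrable lborel {0..t} (\<lambda>s. (norm (simple_process n \<tau> \<xi> s \<omega> - H s \<omega>))\<^sup>2)"
  using H_square_integrable[OF t]
proof eventually_elim
  case (elim \<omega>)
  let ?S = "\<lambda>s. simple_process n \<tau> \<xi> s \<omega>"
  \<comment> \<open>The zero process serves as the second step process, so that the integrability
    statement for differences yields it for one process.\<close>
  have a0: "adapted_step F 0 (\<lambda>_. 0) (\<lambda>_ _. 0 :: real ^ 'm ^ 'd)" by (simp add: adapted_step_def)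
  have S: "set_integrable lborel {0..t} (\<lambda>s. (norm (?S s))\<^sup>2)"
    using simple_ito_integral_maximal(3)[OF a a0, of "{}" t 1 1 \<omega>] t by (simp add: simple_process_def)
  have "set_integrable lborel {0..t} (\<lambda>s. 2 * (norm (?S s))\<^sup>2 + 2 * (norm (H s \<omega>))\<^sup>2)"
    using elim S by (intro set_integral_add(1) set_integrable_mult_right) auto
  then show ?case
  proof (rule set_integrable_bound)
    show "set_borel_measurable lborel {0..t} (\<lambda>s. (norm (?S s - H s \<omega>))\<^sup>2)"
      using elim by (intro set_borel_measurable_norm_diff_square simple_process_measurable_time) auto
    have "norm ((norm (?S s - H s \<omega>))\<^sup>2) \<le> norm (2 * (norm (?S s))\<^sup>2 + 2 * (norm (H s \<omega>))\<^sup>2)" for s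
      using norm_diff_square_le[of "?S s" "H s \<omega>" 0] by simp
    then show "AE x in lborel. x \<in> {0..t} \<longrightarrow> norm ((norm (?S x - H x \<omega>))\<^sup>2) \<le> norm (2 * (norm (?S x))\<^sup>2 + 2 * (norm (H x \<omega>))\<^sup>2)"
      by simp
  qed
qed

lemma simple_ito_integral_measurable:
  assumes a: "adapted_step F n \<tau> \<xi>" and t: "0 \<le> t"
  shows "simple_ito_integral B n \<tau> \<xi> t \<in> borel_measurable M"
proof -
  have "(\<lambda>\<omega>. \<xi> i \<omega> *v (B (min t (\<tau> (Suc i))) \<omega> - B (min t (\<tau> i)) \<omega>)) \<in> borel_measurable M" if "i < n" for i
  proof -
    have [measurable]: "\<xi> i \<in> borel_measurable M"
      using a that adapted_step_nonneg[OF a, of i] by (intro measurable_F_M[of _ "\<tau> i"]) (auto simp: adapted_step_def)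
    have [measurable]: "B (min t (\<tau> (Suc i))) \<in> borel_measurable M" "B (min t (\<tau> i)) \<in> borel_measurable M"
      using t adapted_step_nonneg[OF a, of i] adapted_step_nonneg[OF a, of "Suc i"] that by (auto intro!: B_measurable)
    show ?thesis by measurable
  qed
  then show ?thesis unfolding simple_ito_integral_def[abs_def] by (intro borel_measurable_sum) auto
qed

text \<open>The definition of the integral allows a different approximating sequence at each time; the one
  for \<open>T\<close> serves all earlier times.\<close>

lemma approximating_sequence:
  assumes T: "0 \<le> T"
  obtains n \<tau> and \<xi> :: "nat \<Rightarrow> nat \<Rightarrow> 'a \<Rightarrow> real ^ 'm ^ 'd"
  where "\<And>r. adapted_step F (n r) (\<tau> r) (\<xi> r)"
    and "\<And>r. (\<lambda>\<omega>. LBINT s:{0..T}. (norm (simple_process (n r) (\<tau> r) (\<xi> r) s \<omega> - H s \<omega>))\<^sup>2) \<in> borel_measurable M"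
    and "\<And>\<eta>. 0 < \<eta> \<Longrightarrow> (\<lambda>r. prob {\<omega> \<in> space M. \<eta> < (LBINT s:{0..T}. (norm (simple_process (n r) (\<tau> r) (\<xi> r) s \<omega> - H s \<omega>))\<^sup>2)}) \<longlonglongrightarrow> 0"
    and "\<And>t \<epsilon>. 0 \<le> t \<Longrightarrow> t \<le> T \<Longrightarrow> 0 < \<epsilon> \<Longrightarrow>
      (\<lambda>r. prob {\<omega> \<in> space M. \<epsilon> < norm (simple_ito_integral B (n r) (\<tau> r) (\<xi> r) t \<omega> - J t \<omega>)}) \<longlonglongrightarrow> 0"
proof -
  have nn: "0 \<le> (LBINT s:{0..t}. (norm (simple_process n \<tau> \<xi> s \<omega> - H s \<omega>))\<^sup>2)" for t n \<tau> \<xi> \<omega>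
    unfolding set_lebesgue_integral_def by (intro Bochner_Integration.integral_nonneg) auto
  have ex: "\<exists>n \<tau> \<xi>. (\<forall>r. adapted_step F (n r) (\<tau> r) (\<xi> r)) \<and>
    (\<forall>r. (\<lambda>\<omega>. LBINT s:{0..t}. (norm (simple_process (n r) (\<tau> r) (\<xi> r) s \<omega> - H s \<omega>))\<^sup>2) \<in> borel_measurable M) \<and>
    (\<forall>\<eta>>0. (\<lambda>r. prob {\<omega> \<in> space M. \<eta> < (LBINT s:{0..t}. (norm (simple_process (n r) (\<tau> r) (\<xi> r) s \<omega> - H s \<omega>))\<^sup>2)}) \<longlonglongrightarrow> 0) \<and>
    (\<forall>\<epsilon>>0. (\<lambda>r. prob {\<omega> \<in> space M. \<epsilon> < norm (simple_ito_integral B (n r) (\<tau> r) (\<xi> r) t \<omega> - J t \<omega>)}) \<longlonglongrightarrow> 0)"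
    if t0: "0 \<le> t" for t
  proof -
    obtain n \<tau> \<xi> where 1: "\<And>k. simple_integrand M F (n k) (\<tau> k) (\<xi> k)"
      and 2: "conv_in_prob M (\<lambda>k \<omega>. LBINT s:{0..t}. (norm (simple_process (n k) (\<tau> k) (\<xi> k) s \<omega> - H s \<omega>))\<^sup>2) (\<lambda>_. 0)"
      and 3: "conv_in_prob M (\<lambda>k. simple_ito_integral B (n k) (\<tau> k) (\<xi> k) t) (J t)"
      using ito[OF t0] by (auto simp: has_ito_integral_def)
    show ?thesis
      by (intro exI[of _ n] exI[of _ \<tau>] exI[of _ \<xi>])
        (use 1[THEN simple_integrand_adapted_step] 2 3 nn[of t] in \<open>auto simp: conv_in_prob_def dist_norm abs_of_nonneg\<close>)
  qed
  from ex[OF T] obtain n \<tau> \<xi> where a: "\<And>r. adapted_step F (n r) (\<tau> r) (\<xi> r)"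
    and Am: "\<And>r. (\<lambda>\<omega>. LBINT s:{0..T}. (norm (simple_process (n r) (\<tau> r) (\<xi> r) s \<omega> - H s \<omega>))\<^sup>2) \<in> borel_measurable M"
    and A: "\<And>\<eta>. 0 < \<eta> \<Longrightarrow> (\<lambda>r. prob {\<omega> \<in> space M. \<eta> < (LBINT s:{0..T}. (norm (simple_process (n r) (\<tau> r) (\<xi> r) s \<omega> - H s \<omega>))\<^sup>2)}) \<longlonglongrightarrow> 0"
    by blast
  show ?thesis
  proof (rule that[OF a Am A])
    fix t \<epsilon> :: real assume t: "0 \<le> t" "t \<le> T" and eps: "0 < \<epsilon>"
    from ex[OF t(1)] obtain n' \<tau>' \<xi>' where a': "\<And>r. adapted_step F (n' r) (\<tau>' r) (\<xi>' r)"
      and Am': "\<And>r. (\<lambda>\<omega>. LBINT s:{0..t}. (norm (simple_process (n' r) (\<tau>' r) (\<xi>' r) s \<omega> - H s \<omega>))\<^sup>2) \<in> borel_measurable M"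
      and A': "\<And>\<eta>. 0 < \<eta> \<Longrightarrow> (\<lambda>r. prob {\<omega> \<in> space M. \<eta> < (LBINT s:{0..t}. (norm (simple_process (n' r) (\<tau>' r) (\<xi>' r) s \<omega> - H s \<omega>))\<^sup>2)}) \<longlonglongrightarrow> 0"
      and I': "\<And>\<epsilon>. 0 < \<epsilon> \<Longrightarrow> (\<lambda>r. prob {\<omega> \<in> space M. \<epsilon> < norm (simple_ito_integral B (n' r) (\<tau>' r) (\<xi>' r) t \<omega> - J t \<omega>)}) \<longlonglongrightarrow> 0"
      by blast
    let ?c = "gauss_const TYPE('m) 1"
    let ?I = "\<lambda>r \<omega>. simple_ito_integral B (n r) (\<tau> r) (\<xi> r) t \<omega>"
    let ?I' = "\<lambda>r \<omega>. simple_ito_integral B (n' r) (\<tau>' r) (\<xi>' r) t \<omega>"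
    let ?A = "\<lambda>r \<omega>. LBINT s:{0..T}. (norm (simple_process (n r) (\<tau> r) (\<xi> r) s \<omega> - H s \<omega>))\<^sup>2"
    let ?A' = "\<lambda>r \<omega>. LBINT s:{0..t}. (norm (simple_process (n' r) (\<tau>' r) (\<xi>' r) s \<omega> - H s \<omega>))\<^sup>2"
    let ?D = "\<lambda>r \<omega>. LBINT s:{0..t}. (norm (simple_process (n r) (\<tau> r) (\<xi> r) s \<omega> - simple_process (n' r) (\<tau>' r) (\<xi>' r) s \<omega>))\<^sup>2"
    have [measurable]: "?I r \<in> borel_measurable M" "?I' r \<in> borel_measurable M" for r
      by (rule simple_ito_integral_measurable[OF a t(1)], rule simple_ito_integral_measurable[OF a' t(1)])
    have [measurable]: "J t \<in> borel_measurable M" by (rule J_measurable[OF t(1)])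
    note [measurable] = Am Am'
    have Q: "finite {t}" "{t} \<subseteq> {0..t}" using t by auto
    \<comment> \<open>The level \<eta> is free. For fixed \<eta> all probabilities on the right
      vanish as r grows, and the one remaining term is made small by the choice of \<eta>.\<close>
    have bound: "prob {\<omega> \<in> space M. \<epsilon> < norm (?I r \<omega> - J t \<omega>)} \<le>
      (prob {\<omega> \<in> space M. \<eta> / 4 < ?A r \<omega>} + prob {\<omega> \<in> space M. \<eta> / 4 < ?A' r \<omega>} + ?c * \<eta> / (\<epsilon> / 2)\<^sup>2)
        + prob {\<omega> \<in> space M. \<epsilon> / 2 < norm (?I' r \<omega> - J t \<omega>)}" if eta: "0 < \<eta>" for r \<eta>
    proof -
      have e2: "0 < \<epsilon> / 2" using eps by simp
      note L = simple_ito_integral_maximal[OF a[of r] a'[of r] Q t(1) e2 eta]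
      note [measurable] = L(1)
      \<comment> \<open>Since D <= 2 A + 2 A', D > \<eta> forces one of the distances to H above
        \<eta> / 4.\<close>
      have "AE \<omega> in M. ?D r \<omega> \<le> 2 * ?A r \<omega> + 2 * ?A' r \<omega>"
        using step_diff_integrable[OF a[of r] T] step_diff_integrable[OF a'[of r] t(1)]
      proof eventually_elim
        case (elim \<omega>)
        have sub: "set_integrable lborel {0..t} (\<lambda>s. (norm (simple_process (n r) (\<tau> r) (\<xi> r) s \<omega> - H s \<omega>))\<^sup>2)"
          using t by (intro set_integrable_subset[OF elim(1)]) auto
        have "?D r \<omega> \<le> 2 * (LBINT s:{0..t}. (norm (simple_process (n r) (\<tau> r) (\<xi> r) s \<omega> - H s \<omega>))\<^sup>2) + 2 * ?A' r \<omega>"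
          by (rule set_integral_norm_diff_square_le[OF L(3) sub elim(2)])
        also have "(LBINT s:{0..t}. (norm (simple_process (n r) (\<tau> r) (\<xi> r) s \<omega> - H s \<omega>))\<^sup>2) \<le> ?A r \<omega>"
          using t by (intro set_integral_mono_subset[OF elim(1)]) auto
        finally show ?case by simp
      qed
      then have "AE \<omega> in M. \<omega> \<in> {\<omega> \<in> space M. \<eta> < ?D r \<omega>} \<longrightarrow>
          \<omega> \<in> {\<omega> \<in> space M. \<eta> / 4 < ?A r \<omega>} \<union> {\<omega> \<in> space M. \<eta> / 4 < ?A' r \<omega>}"
        by eventually_elim auto
      then have "prob {\<omega> \<in> space M. \<eta> < ?D r \<omega>} \<le> prob ({\<omega> \<in> space M. \<eta> / 4 < ?A r \<omega>} \<union> {\<omega> \<in> space M. \<eta> / 4 < ?A' r \<omega>})"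
        by (rule finite_measure_mono_AE) measurable
      also have "\<dots> \<le> prob {\<omega> \<in> space M. \<eta> / 4 < ?A r \<omega>} + prob {\<omega> \<in> space M. \<eta> / 4 < ?A' r \<omega>}"
        by (rule measure_Un_le) measurable
      finally have D: "prob {\<omega> \<in> space M. \<eta> < ?D r \<omega>} \<le> \<dots>" .
      have "prob {\<omega> \<in> space M. \<epsilon> < norm (?I r \<omega> - J t \<omega>)} \<le>
         prob ({\<omega> \<in> space M. \<exists>s\<in>{t}. \<epsilon> / 2 < norm (simple_ito_integral B (n r) (\<tau> r) (\<xi> r) s \<omega> - simple_ito_integral B (n' r) (\<tau>' r) (\<xi>' r) s \<omega>)}
           \<union> {\<omega> \<in> space M. \<epsilon> / 2 < norm (?I' r \<omega> - J t \<omega>)})"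
      proof (rule finite_measure_mono)
        have "\<epsilon> / 2 < norm (x - y) \<or> \<epsilon> / 2 < norm (y - z)" if "\<epsilon> < norm (x - z)" for x y z :: "real ^ 'd"
          using norm_triangle_ineq[of "x - y" "y - z"] that by simp linarith
        then show "{\<omega> \<in> space M. \<epsilon> < norm (?I r \<omega> - J t \<omega>)} \<subseteq> {\<omega> \<in> space M. \<exists>s\<in>{t}. \<epsilon> / 2 < norm (simple_ito_integral B (n r) (\<tau> r) (\<xi> r) s \<omega> - simple_ito_integral B (n' r) (\<tau>' r) (\<xi>' r) s \<omega>)}
           \<union> {\<omega> \<in> space M. \<epsilon> / 2 < norm (?I' r \<omega> - J t \<omega>)}" by blast
      qed simp
      also have "\<dots> \<le> prob {\<omega> \<in> space M. \<exists>s\<in>{t}. \<epsilon> / 2 < norm (simple_ito_integral B (n r) (\<tau> r) (\<xi> r) s \<omega> - simple_ito_integral B (n' r) (\<tau>' r) (\<xi>' r) s \<omega>)}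
           + prob {\<omega> \<in> space M. \<epsilon> / 2 < norm (?I' r \<omega> - J t \<omega>)}"
        by (rule measure_Un_le) simp_all
      finally show ?thesis using L(2) D by linarith
    qed
    show "(\<lambda>r. prob {\<omega> \<in> space M. \<epsilon> < norm (?I r \<omega> - J t \<omega>)}) \<longlonglongrightarrow> 0"
    proof (rule LIMSEQ_I)
      fix e :: real assume e: "0 < e"
      \<comment> \<open>Solves for a maximal-inequality term of at most e / 2; the summand 1
        protects the division when ?c is small.\<close>
      define \<eta> where "\<eta> = e * (\<epsilon> / 2)\<^sup>2 / (2 * (?c + 1))"
      have c: "0 < ?c + 1" using gauss_const_nonneg[of 1, where ?'m = 'm] by simp
      have eta: "0 < \<eta>" using e eps c by (simp add: \<eta>_def)
      have ce: "?c * \<eta> / (\<epsilon> / 2)\<^sup>2 < e"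
      proof -
        have "?c * \<eta> / (\<epsilon> / 2)\<^sup>2 = e * (?c / (2 * (?c + 1)))" using eps by (simp add: \<eta>_def)
        also have "\<dots> < e * 1" using e c by (intro mult_strict_left_mono) (auto simp: divide_less_eq)
        finally show ?thesis by simp
      qed
      have "(\<lambda>r. (prob {\<omega> \<in> space M. \<eta> / 4 < ?A r \<omega>} + prob {\<omega> \<in> space M. \<eta> / 4 < ?A' r \<omega>} + ?c * \<eta> / (\<epsilon> / 2)\<^sup>2)
        + prob {\<omega> \<in> space M. \<epsilon> / 2 < norm (?I' r \<omega> - J t \<omega>)}) \<longlonglongrightarrow> (0 + 0 + ?c * \<eta> / (\<epsilon> / 2)\<^sup>2) + 0"
        using eta eps by (intro tendsto_add A A' I' tendsto_const) auto
      then have "\<forall>\<^sub>F r in sequentially. (prob {\<omega> \<in> space M. \<eta> / 4 < ?A r \<omega>} + prob {\<omega> \<in> space M. \<eta> / 4 < ?A' r \<omega>} + ?c * \<eta> / (\<epsilon> / 2)\<^sup>2)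
        + prob {\<omega> \<in> space M. \<epsilon> / 2 < norm (?I' r \<omega> - J t \<omega>)} < e"
        by (rule order_tendstoD(2)) (use ce in simp)
      then have "\<forall>\<^sub>F r in sequentially. norm (prob {\<omega> \<in> space M. \<epsilon> < norm (?I r \<omega> - J t \<omega>)} - 0) < e"
      proof eventually_elim
        case (elim r)
        from le_less_trans[OF bound[OF eta, of r] elim] show ?case by simp
      qed
      then show "\<exists>no. \<forall>r\<ge>no. norm (prob {\<omega> \<in> space M. \<epsilon> < norm (?I r \<omega> - J t \<omega>)} - 0) < e"
        by (simp add: eventually_sequentially)
    qed
  qed
qed

text \<open>The Riemann sum is itself the integral of a step process, one that on E is within \<eta>
  / 4 of H in L^2. It is compared with an approximating sequence of H at all grid points at once;
  after the passage to the limit only the distance between the Riemann step process and H is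
  left.\<close>

lemma riemann_sum_error:
  assumes \<Delta>: "0 < \<Delta>" and eps: "0 < \<epsilon>" and eta: "0 < \<eta>" and \<mu>: "real N * \<Delta> * \<mu>\<^sup>2 \<le> \<eta> / 4"
    and E: "E \<in> events"
    and osc: "AE \<omega> in M. \<omega> \<in> E \<longrightarrow> (\<forall>j<N. \<forall>s\<in>{real j * \<Delta><..real (Suc j) * \<Delta>}. norm (H (real j * \<Delta>) \<omega> - H s \<omega>) \<le> \<mu>)"
  shows "prob {\<omega> \<in> space M. \<exists>k\<le>N. \<epsilon> < norm (mart_sum (\<lambda>j. real j * \<Delta>) (\<lambda>j. H (real j * \<Delta>)) k \<omega> - J (real k * \<Delta>) \<omega>)}
    \<le> prob (space M - E) + gauss_const TYPE('m) 1 * \<eta> / (\<epsilon> / 2)\<^sup>2"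
proof -
  let ?c = "gauss_const TYPE('m) 1"
  let ?p = "\<lambda>j. real j * \<Delta>"
  let ?G = "\<lambda>j. H (?p j)"
  let ?T = "?p N"
  have T: "0 \<le> ?T" using \<Delta> by simp
  have p: "time_grid N ?p" using \<Delta> by (simp add: time_grid_def)
  have aG: "adapted_step F N ?p ?G"
    using \<Delta> by (auto simp: adapted_step_def intro!: H_adapted)
  obtain n \<tau> and \<xi> :: "nat \<Rightarrow> nat \<Rightarrow> 'a \<Rightarrow> real ^ 'm ^ 'd" where a: "\<And>r. adapted_step F (n r) (\<tau> r) (\<xi> r)"
    and Am: "\<And>r. (\<lambda>\<omega>. LBINT s:{0..?T}. (norm (simple_process (n r) (\<tau> r) (\<xi> r) s \<omega> - H s \<omega>))\<^sup>2) \<in> borel_measurable M"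
    and A: "\<And>\<eta>. 0 < \<eta> \<Longrightarrow> (\<lambda>r. prob {\<omega> \<in> space M. \<eta> < (LBINT s:{0..?T}. (norm (simple_process (n r) (\<tau> r) (\<xi> r) s \<omega> - H s \<omega>))\<^sup>2)}) \<longlonglongrightarrow> 0"
    and I: "\<And>t \<epsilon>. 0 \<le> t \<Longrightarrow> t \<le> ?T \<Longrightarrow> 0 < \<epsilon> \<Longrightarrow>
      (\<lambda>r. prob {\<omega> \<in> space M. \<epsilon> < norm (simple_ito_integral B (n r) (\<tau> r) (\<xi> r) t \<omega> - J t \<omega>)}) \<longlonglongrightarrow> 0"
    using approximating_sequence[OF T] by blast
  let ?A = "\<lambda>r \<omega>. LBINT s:{0..?T}. (norm (simple_process (n r) (\<tau> r) (\<xi> r) s \<omega> - H s \<omega>))\<^sup>2"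
  let ?D = "\<lambda>r \<omega>. LBINT s:{0..?T}. (norm (simple_process (n r) (\<tau> r) (\<xi> r) s \<omega> - simple_process N ?p ?G s \<omega>))\<^sup>2"
  let ?I = "\<lambda>r t \<omega>. simple_ito_integral B (n r) (\<tau> r) (\<xi> r) t \<omega>"
  let ?R = "\<lambda>k \<omega>. mart_sum ?p ?G k \<omega>"
  have R: "simple_ito_integral B N ?p ?G (?p k) \<omega> = ?R k \<omega>" if "k \<le> N" for k \<omega>
    by (rule simple_ito_integral_grid[OF p that])
  have pk: "0 \<le> ?p k" "k \<le> N \<Longrightarrow> ?p k \<le> ?T" for k using \<Delta> by auto
  have [measurable]: "?I r (?p k) \<in> borel_measurable M" for r k
    by (rule simple_ito_integral_measurable[OF a pk(1)])
  have Rm: "?R k \<in> borel_measurable M" if "k \<le> N" for k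
    using simple_ito_integral_measurable[OF aG pk(1)[of k]] unfolding R[OF that, abs_def] by (simp add: R[OF that] cong: measurable_cong)
  have [measurable]: "J (?p k) \<in> borel_measurable M" for k by (rule J_measurable[OF pk(1)])
  note [measurable] = Am E
  have GH: "AE \<omega> in M. \<omega> \<in> E \<longrightarrow> (LBINT s:{0..?T}. (norm (simple_process N ?p ?G s \<omega> - H s \<omega>))\<^sup>2) \<le> \<eta> / 4"
    using osc step_diff_integrable[OF aG T]
  proof eventually_elim
    case (elim \<omega>)
    show ?case
    proof
      assume "\<omega> \<in> E"
      \<comment> \<open>The cells are open on the left, so time 0 lies in none of them; it is
        discarded later as a null set.\<close>
      have pw: "(norm (simple_process N ?p ?G s \<omega> - H s \<omega>))\<^sup>2 \<le> \<mu>\<^sup>2" if s: "s \<noteq> 0" "s \<in> {0..?T}" for s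
      proof -
        obtain j where j: "j < N" "s \<in> {?p j<..?p (Suc j)}"
          using time_grid_cover[OF p, of s] s by (auto simp del: of_nat_Suc)
        then have "norm (H (?p j) \<omega> - H s \<omega>) \<le> \<mu>" using elim \<open>\<omega> \<in> E\<close> by auto
        then show ?thesis unfolding simple_process_grid[OF p j] by (rule power_mono) simp
      qed
      have "(LBINT s:{0..?T}. (norm (simple_process N ?p ?G s \<omega> - H s \<omega>))\<^sup>2) \<le> (LBINT s:{0..?T}. \<mu>\<^sup>2)"
      proof (rule set_integral_mono_AE[OF elim(2)])
        show "set_integrable lborel {0..?T} (\<lambda>s. \<mu>\<^sup>2)"
          unfolding set_integrable_def by (intro integrable_scaleR_left integrable_real_indicator) (auto simp: emeasure_lborel_Icc_eq)
        show "AE s\<in>{0..?T} in lborel. (norm (simple_process N ?p ?G s \<omega> - H s \<omega>))\<^sup>2 \<le> \<mu>\<^sup>2"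
          using AE_lborel_singleton[of "0::real"] by eventually_elim (use pw in auto)
      qed
      also have "\<dots> = ?T * \<mu>\<^sup>2"
        using T by (simp add: set_lebesgue_integral_def)
      also have "\<dots> \<le> \<eta> / 4" using \<mu> by simp
      finally show "(LBINT s:{0..?T}. (norm (simple_process N ?p ?G s \<omega> - H s \<omega>))\<^sup>2) \<le> \<eta> / 4" .
    qed
  qed
  let ?Q = "?p ` {..N}"
  have Q: "finite ?Q" "?Q \<subseteq> {0..?T}" using pk by auto
  let ?Bad = "{\<omega> \<in> space M. \<exists>k\<le>N. \<epsilon> < norm (?R k \<omega> - J (?p k) \<omega>)}"
  let ?L = "\<lambda>r. (prob {\<omega> \<in> space M. \<eta> / 4 < ?A r \<omega>} + prob (space M - E) + ?c * \<eta> / (\<epsilon> / 2)\<^sup>2)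
      + (\<Sum>k\<le>N. prob {\<omega> \<in> space M. \<epsilon> / 2 < norm (?I r (?p k) \<omega> - J (?p k) \<omega>)})"
  have bound: "prob ?Bad \<le> ?L r" for r
  proof -
    have e2: "0 < \<epsilon> / 2" using eps by simp
    note L = simple_ito_integral_maximal[OF a[of r] aG Q T e2 eta]
    note [measurable] = L(1)
    have "AE \<omega> in M. \<omega> \<in> {\<omega> \<in> space M. \<eta> < ?D r \<omega>} \<longrightarrow> \<omega> \<in> {\<omega> \<in> space M. \<eta> / 4 < ?A r \<omega>} \<union> (space M - E)"
      using step_diff_integrable[OF a[of r] T] step_diff_integrable[OF aG T] GH
    proof eventually_elim
      case (elim \<omega>)
      have "?D r \<omega> \<le> 2 * ?A r \<omega> + 2 * (LBINT s:{0..?T}. (norm (simple_process N ?p ?G s \<omega> - H s \<omega>))\<^sup>2)"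
        by (rule set_integral_norm_diff_square_le[OF L(3) elim(1,2)])
      then show ?case using elim(3) by auto
    qed
    then have "prob {\<omega> \<in> space M. \<eta> < ?D r \<omega>} \<le> prob ({\<omega> \<in> space M. \<eta> / 4 < ?A r \<omega>} \<union> (space M - E))"
      by (rule finite_measure_mono_AE) measurable
    also have "\<dots> \<le> prob {\<omega> \<in> space M. \<eta> / 4 < ?A r \<omega>} + prob (space M - E)"
      by (rule measure_Un_le) measurable
    finally have D: "prob {\<omega> \<in> space M. \<eta> < ?D r \<omega>} \<le> \<dots>" .
    let ?C = "{\<omega> \<in> space M. \<exists>s\<in>?Q. \<epsilon> / 2 < norm (?I r s \<omega> - simple_ito_integral B N ?p ?G s \<omega>)}"
    let ?K = "\<lambda>k. {\<omega> \<in> space M. \<epsilon> / 2 < norm (?I r (?p k) \<omega> - J (?p k) \<omega>)}"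
    have Cm: "?C \<in> events"
    proof -
      have "?C = (\<Union>k\<in>{..N}. {\<omega> \<in> space M. \<epsilon> / 2 < norm (?I r (?p k) \<omega> - ?R k \<omega>)})"
        by (auto simp: R)
      also have "\<dots> \<in> events"
        using Rm by (intro sets.finite_UN) (auto intro!: borel_measurable_less measurable_compose[OF _ borel_measurable_norm] borel_measurable_diff)
      finally show ?thesis .
    qed
    have "prob ?Bad \<le> prob (?C \<union> (\<Union>k\<in>{..N}. ?K k))"
    proof (rule finite_measure_mono)
      have tri: "\<epsilon> / 2 < norm (x - y) \<or> \<epsilon> / 2 < norm (x - z)" if "\<epsilon> < norm (y - z)" for x y z :: "real ^ 'd"
        using norm_triangle_ineq4[of "x - z" "x - y"] that by simp linarith
      show "?Bad \<subseteq> ?C \<union> (\<Union>k\<in>{..N}. ?K k)"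
      proof
        fix \<omega> assume "\<omega> \<in> ?Bad"
        then obtain k where k: "\<omega> \<in> space M" "k \<le> N" "\<epsilon> < norm (?R k \<omega> - J (?p k) \<omega>)" by auto
        from tri[OF k(3), of "?I r (?p k) \<omega>"] show "\<omega> \<in> ?C \<union> (\<Union>k\<in>{..N}. ?K k)"
        proof
          assume "\<epsilon> / 2 < norm (?I r (?p k) \<omega> - ?R k \<omega>)"
          then have "\<omega> \<in> ?C" using k R[OF k(2), of \<omega>]
            by (intro CollectI conjI bexI[of _ "?p k"]) auto
          then show ?thesis ..
        qed (use k in auto)
      qed
      show "?C \<union> (\<Union>k\<in>{..N}. ?K k) \<in> events" using Cm by measurable
    qed
    also have "\<dots> \<le> prob ?C + prob (\<Union>k\<in>{..N}. ?K k)" by (rule measure_Un_le[OF Cm]) measurable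
    also have "prob (\<Union>k\<in>{..N}. ?K k) \<le> (\<Sum>k\<le>N. prob (?K k))"
      by (rule measure_UNION_le) auto
    finally show ?thesis using L(2) D by linarith
  qed
  \<comment> \<open>The left side of \<open>bound\<close> does not involve r, so the approximating
    sequence disappears in the limit.\<close>
  have "?L \<longlonglongrightarrow> (0 + prob (space M - E) + ?c * \<eta> / (\<epsilon> / 2)\<^sup>2) + (\<Sum>k\<le>N. 0)"
    using eta eps pk by (intro tendsto_add tendsto_sum A I tendsto_const) auto
  from LIMSEQ_le_const[OF this] bound show ?thesis by auto
qed

end

section \<open>Convergence in probability\<close>

text \<open>Approximation strictly from the right stays inside the time domain also at s = 0. It may
  step beyond T, which is why the next lemmas work on [0, T + 1].\<close>

lemma rational_approx_right:
  "\<exists>q :: nat \<Rightarrow> real. (\<forall>k. q k \<in> \<rat>) \<and> (\<forall>k. s < q k) \<and> (\<forall>k. q k < s + 1) \<and> q \<longlonglongrightarrow> s"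
proof -
  have "\<forall>k. \<exists>q\<in>\<rat>. s < q \<and> q < s + inverse (real (Suc k))"
    using Rats_dense_in_real by simp
  then obtain q where q: "\<And>k. q k \<in> \<rat>" "\<And>k. s < q k" "\<And>k. q k < s + inverse (real (Suc k))"
    by metis
  have "(\<lambda>k. s + inverse (real (Suc k))) \<longlonglongrightarrow> s + 0"
    by (intro tendsto_add tendsto_const LIMSEQ_inverse_real_of_nat)
  then have "q \<longlonglongrightarrow> s"
    using q by (intro tendsto_sandwich[of "\<lambda>_. s" q sequentially "\<lambda>k. s + inverse (real (Suc k))"])
      (auto simp: less_imp_le)
  moreover have "q k < s + 1" for k
  proof -
    have "inverse (real (Suc k)) \<le> 1" by (simp add: inverse_le_1_iff)
    then show ?thesis using q(3)[of k] by linarith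
  qed
  ultimately show ?thesis using q by blast
qed

section \<open>Uniform control of continuous paths outside events of small probability\<close>

context prob_space
begin

lemma increasing_events_exhaust:
  fixes A :: "nat \<Rightarrow> 'a set"
  assumes A: "\<And>n. A n \<in> events" "incseq A" and ex: "AE \<omega> in M. \<exists>n. \<omega> \<in> A n" and e: "0 < e"
  obtains n where "prob (space M - A n) \<le> e"
proof -
  have "prob (\<Union>n. A n) = 1"
    using A ex by (subst prob_eq_1) auto
  moreover have "(\<lambda>n. prob (A n)) \<longlonglongrightarrow> prob (\<Union>n. A n)"
    using A by (intro finite_Lim_measure_incseq) auto
  ultimately have "\<forall>\<^sub>F n in sequentially. 1 - e < prob (A n)"
    using e by (intro order_tendstoD(1)) auto
  then obtain n where "1 - e < prob (A n)" by (auto simp: eventually_sequentially)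
  then show ?thesis using A by (intro that[of n]) (simp add: prob_compl)
qed

text \<open>Almost every path is uniformly continuous on a compact interval; continuity of the
  probability along increasing events makes the modulus the same for most paths. The events involve
  rational times only, which makes them measurable, and path continuity extends them to all
  times.\<close>

lemma continuous_process_modulus:
  fixes Z :: "real \<Rightarrow> 'a \<Rightarrow> 'b::{second_countable_topology, metric_space}"
  assumes Z: "\<And>s. 0 \<le> s \<Longrightarrow> Z s \<in> borel_measurable M"
    and cont: "AE \<omega> in M. continuous_on {0..} (\<lambda>s. Z s \<omega>)"
    and T: "0 \<le> T" and \<mu>: "0 < \<mu>" and e: "0 < e"
  obtains d E where "0 < d" "E \<in> events" "prob (space M - E) \<le> e"
    "AE \<omega> in M. \<omega> \<in> E \<longrightarrow> (\<forall>s\<in>{0..T}. \<forall>s'\<in>{0..T}. \<bar>s - s'\<bar> < d \<longrightarrow> dist (Z s \<omega>) (Z s' \<omega>) \<le> \<mu>)"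
proof -
  define Q where "Q = \<rat> \<inter> {0..T + 1}"
  have Q: "countable Q" unfolding Q_def using countable_rat by (rule countable_subset[rotated]) auto
  define A where "A n = {\<omega> \<in> space M. \<forall>p\<in>Q \<times> Q. \<bar>fst p - snd p\<bar> < inverse (real (Suc n)) \<longrightarrow> dist (Z (fst p) \<omega>) (Z (snd p) \<omega>) \<le> \<mu>}" for n
  have "countable (Q \<times> Q)" using Q by simp
  have Am: "A n \<in> events" for n
    unfolding A_def
  proof (intro sets.sets_Collect_countable_All' \<open>countable (Q \<times> Q)\<close> sets.sets_Collect_imp sets.sets_Collect_const)
    fix p assume "p \<in> Q \<times> Q"
    then have [measurable]: "Z (fst p) \<in> borel_measurable M" "Z (snd p) \<in> borel_measurable M"
      by (auto simp: Q_def intro!: Z)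
    show "{\<omega> \<in> space M. dist (Z (fst p) \<omega>) (Z (snd p) \<omega>) \<le> \<mu>} \<in> events" by measurable
  qed
  have Ainc: "incseq A"
  proof (rule incseq_SucI)
    fix n
    have le: "inverse (real (Suc (Suc n))) \<le> inverse (real (Suc n))" by (simp add: divide_simps)
    show "A n \<subseteq> A (Suc n)"
    proof
      fix \<omega> assume \<omega>: "\<omega> \<in> A n"
      show "\<omega> \<in> A (Suc n)"
        unfolding A_def mem_Collect_eq
      proof (intro conjI ballI impI)
        show "\<omega> \<in> space M" using \<omega> by (simp add: A_def)
        fix p assume p: "p \<in> Q \<times> Q" and "\<bar>fst p - snd p\<bar> < inverse (real (Suc (Suc n)))"
        then have "\<bar>fst p - snd p\<bar> < inverse (real (Suc n))" using le by linarith
        with \<omega> p show "dist (Z (fst p) \<omega>) (Z (snd p) \<omega>) \<le> \<mu>" unfolding A_def by blast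
      qed
    qed
  qed
  have "AE \<omega> in M. \<exists>n. \<omega> \<in> A n"
    using cont AE_space
  proof eventually_elim
    case (elim \<omega>)
    have "uniformly_continuous_on {0..T + 1} (\<lambda>s. Z s \<omega>)"
      using elim by (intro compact_uniformly_continuous continuous_on_subset[OF elim(1)]) auto
    then obtain d where d: "0 < d" "\<And>s s'. s \<in> {0..T+1} \<Longrightarrow> s' \<in> {0..T+1} \<Longrightarrow> dist s' s < d \<Longrightarrow> dist (Z s' \<omega>) (Z s \<omega>) < \<mu>"
      using \<mu> unfolding uniformly_continuous_on_def by blast
    obtain n where n: "inverse (real (Suc n)) < d" using d(1) reals_Archimedean by blast
    have "\<omega> \<in> A n"
      unfolding A_def mem_Collect_eq
    proof (intro conjI ballI impI)
      fix p assume p: "p \<in> Q \<times> Q" "\<bar>fst p - snd p\<bar> < inverse (real (Suc n))"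
      then have "fst p \<in> {0..T + 1}" "snd p \<in> {0..T + 1}" by (auto simp: Q_def)
      moreover have "dist (fst p) (snd p) < d" using p(2) n by (simp add: dist_real_def)
      ultimately show "dist (Z (fst p) \<omega>) (Z (snd p) \<omega>) \<le> \<mu>" using d(2)[of "snd p" "fst p"] by simp
    qed (rule elim(2))
    then show ?case ..
  qed
  from increasing_events_exhaust[OF Am Ainc this e] obtain n where n: "prob (space M - A n) \<le> e" .
  show ?thesis
  proof (rule that[of "inverse (real (Suc n))" "A n"])
    show "AE \<omega> in M. \<omega> \<in> A n \<longrightarrow> (\<forall>s\<in>{0..T}. \<forall>s'\<in>{0..T}. \<bar>s - s'\<bar> < inverse (real (Suc n)) \<longrightarrow> dist (Z s \<omega>) (Z s' \<omega>) \<le> \<mu>)"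
      using cont
    proof eventually_elim
      case (elim \<omega>)
      show ?case
      proof (intro impI ballI)
        fix s s' assume \<omega>: "\<omega> \<in> A n" and s: "s \<in> {0..T}" "s' \<in> {0..T}" and close: "\<bar>s - s'\<bar> < inverse (real (Suc n))"
        obtain q where q: "\<And>k. q k \<in> \<rat>" "\<And>k. s < q k" "\<And>k. q k < s + 1" "q \<longlonglongrightarrow> s"
          using rational_approx_right[of s] by blast
        obtain q' where q': "\<And>k. q' k \<in> \<rat>" "\<And>k. s' < q' k" "\<And>k. q' k < s' + 1" "q' \<longlonglongrightarrow> s'"
          using rational_approx_right[of s'] by blast
        have Qq: "q k \<in> Q" "q' k \<in> Q" for k
          unfolding Q_def using s q(1-3)[of k] q'(1-3)[of k] by auto
        have 1: "(\<lambda>k. Z (q k) \<omega>) \<longlonglongrightarrow> Z s \<omega>" and 2: "(\<lambda>k. Z (q' k) \<omega>) \<longlonglongrightarrow> Z s' \<omega>"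
          using elim s q q' Qq by (auto simp: Q_def intro!: continuous_on_tendsto_compose[OF elim])
        have "(\<lambda>k. \<bar>q k - q' k\<bar>) \<longlonglongrightarrow> \<bar>s - s'\<bar>"
          by (intro tendsto_rabs tendsto_diff q q')
        then have ev: "\<forall>\<^sub>F k in sequentially. \<bar>q k - q' k\<bar> < inverse (real (Suc n))"
          using close by (rule order_tendstoD(2))
        have "\<forall>\<^sub>F k in sequentially. dist (Z (q k) \<omega>) (Z (q' k) \<omega>) \<le> \<mu>"
          using ev
        proof eventually_elim
          case (elim k)
          then show ?case using \<omega> Qq[of k] unfolding A_def by (auto dest!: bspec[of _ _ "(q k, q' k)"])
        qed
        then show "dist (Z s \<omega>) (Z s' \<omega>) \<le> \<mu>"
          by (intro tendsto_upperbound[OF tendsto_dist[OF 1 2]]) auto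
      qed
    qed
  qed (use n Am in auto)
qed

text \<open>The same argument as for the modulus, with boundedness of a continuous path on a compact
  interval.\<close>

lemma continuous_process_bound:
  fixes Z :: "real \<Rightarrow> 'a \<Rightarrow> 'b::{second_countable_topology, real_normed_vector}"
  assumes Z: "\<And>s. 0 \<le> s \<Longrightarrow> Z s \<in> borel_measurable M"
    and cont: "AE \<omega> in M. continuous_on {0..} (\<lambda>s. Z s \<omega>)"
    and T: "0 \<le> T" and e: "0 < e"
  obtains R E where "0 < R" "E \<in> events" "prob (space M - E) \<le> e"
    "AE \<omega> in M. \<omega> \<in> E \<longrightarrow> (\<forall>s\<in>{0..T}. norm (Z s \<omega>) \<le> R)"
proof -
  define Q where "Q = \<rat> \<inter> {0..T + 1}"
  have Q: "countable Q" unfolding Q_def using countable_rat by (rule countable_subset[rotated]) auto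
  define A where "A n = {\<omega> \<in> space M. \<forall>s\<in>Q. norm (Z s \<omega>) \<le> real (Suc n)}" for n
  have Am: "A n \<in> events" for n
    unfolding A_def
  proof (intro sets.sets_Collect_countable_All' Q)
    fix s assume "s \<in> Q"
    then have [measurable]: "Z s \<in> borel_measurable M" by (auto simp: Q_def intro!: Z)
    show "{\<omega> \<in> space M. norm (Z s \<omega>) \<le> real (Suc n)} \<in> events" by measurable
  qed
  have Ainc: "incseq A"
  proof (rule incseq_SucI)
    fix n
    have "norm x \<le> real (Suc n) \<Longrightarrow> norm x \<le> real (Suc (Suc n))" for x :: 'b by simp
    then show "A n \<subseteq> A (Suc n)" unfolding A_def by blast
  qed
  have "AE \<omega> in M. \<exists>n. \<omega> \<in> A n"
    using cont AE_space
  proof eventually_elim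
    case (elim \<omega>)
    have "compact ((\<lambda>s. Z s \<omega>) ` {0..T + 1})"
      by (intro compact_continuous_image continuous_on_subset[OF elim(1)]) auto
    then have "bounded ((\<lambda>s. Z s \<omega>) ` {0..T + 1})" by (rule compact_imp_bounded)
    then obtain C where C: "\<forall>s\<in>{0..T + 1}. norm (Z s \<omega>) \<le> C"
      by (auto simp: bounded_iff)
    obtain n where "C \<le> real n" using real_arch_simple by blast
    then have "C \<le> real (Suc n)" by simp
    then have "norm (Z s \<omega>) \<le> real (Suc n)" if "s \<in> Q" for s
      using bspec[OF C, of s] that unfolding Q_def by auto
    then have "\<omega> \<in> A n" unfolding A_def using elim(2) by blast
    then show ?case ..
  qed
  from increasing_events_exhaust[OF Am Ainc this e] obtain n where n: "prob (space M - A n) \<le> e" .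
  show ?thesis
  proof (rule that[of "real (Suc n)" "A n"])
    show "AE \<omega> in M. \<omega> \<in> A n \<longrightarrow> (\<forall>s\<in>{0..T}. norm (Z s \<omega>) \<le> real (Suc n))"
      using cont
    proof eventually_elim
      case (elim \<omega>)
      show ?case
      proof (intro impI ballI)
        fix s assume \<omega>: "\<omega> \<in> A n" and s: "s \<in> {0..T}"
        obtain q where q: "\<And>k. q k \<in> \<rat>" "\<And>k. s < q k" "\<And>k. q k < s + 1" "q \<longlonglongrightarrow> s"
          using rational_approx_right[of s] by blast
        have Qq: "q k \<in> Q" for k unfolding Q_def using s q(1-3)[of k] by auto
        have 1: "(\<lambda>k. Z (q k) \<omega>) \<longlonglongrightarrow> Z s \<omega>"
          using elim s q Qq by (auto simp: Q_def intro!: continuous_on_tendsto_compose[OF elim])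
        have "norm (Z (q k) \<omega>) \<le> real (Suc n)" for k using \<omega> Qq[of k] by (auto simp: A_def)
        then show "norm (Z s \<omega>) \<le> real (Suc n)"
          by (intro tendsto_upperbound[OF tendsto_norm[OF 1]]) auto
      qed
    qed
  qed (use n Am in auto)
qed

end

section \<open>The exact solution as a perturbed Euler recursion on the grid\<close>

locale sde = brownian M F B
  for M :: "'a measure" and F and B :: "real \<Rightarrow> 'a \<Rightarrow> real ^ 'm::finite" +
  fixes f :: "real ^ 'd::finite \<Rightarrow> real ^ 'd" and g :: "real ^ 'd \<Rightarrow> real ^ 'm ^ 'd"
    and x0 :: "real ^ 'd" and X :: "real \<Rightarrow> 'a \<Rightarrow> real ^ 'd"
  assumes f_lip: "locally_lipschitz f" and g_lip: "locally_lipschitz g"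
    and sol: "sde_solution M F B f g x0 X"
begin

lemma f_cont: "continuous_on UNIV f" and g_cont: "continuous_on UNIV g"
  using f_lip g_lip by (auto intro: locally_lipschitz_continuous)

lemma f_borel [measurable]: "f \<in> borel_measurable borel" and g_borel [measurable]: "g \<in> borel_measurable borel"
  using f_cont g_cont by (auto intro: borel_measurable_continuous_onI)

lemma X_adapted: "0 \<le> t \<Longrightarrow> X t \<in> borel_measurable (F t)"
  using sol by (simp add: sde_solution_def adapted_def)

lemma X_measurable: "0 \<le> t \<Longrightarrow> X t \<in> borel_measurable M"
  using X_adapted measurable_F_M by blast

lemma X_continuous: "AE \<omega> in M. continuous_on {0..} (\<lambda>s. X s \<omega>)"
  using sol by (simp add: sde_solution_def continuous_process_def)

definition J :: "real \<Rightarrow> 'a \<Rightarrow> real ^ 'd" where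
  "J t = (SOME J. has_ito_integral M F B (\<lambda>s \<omega>. g (X s \<omega>)) t J \<and>
        (AE \<omega> in M. set_integrable lborel {0..t} (\<lambda>s. f (X s \<omega>)) \<and>
                    X t \<omega> = x0 + (LBINT s:{0..t}. f (X s \<omega>)) + J \<omega>))"

lemma J:
  assumes "0 \<le> t"
  shows "has_ito_integral M F B (\<lambda>s \<omega>. g (X s \<omega>)) t (J t)"
    and "AE \<omega> in M. set_integrable lborel {0..t} (\<lambda>s. f (X s \<omega>)) \<and> X t \<omega> = x0 + (LBINT s:{0..t}. f (X s \<omega>)) + J t \<omega>"
proof -
  have "\<exists>J. has_ito_integral M F B (\<lambda>s \<omega>. g (X s \<omega>)) t J \<and>
        (AE \<omega> in M. set_integrable lborel {0..t} (\<lambda>s. f (X s \<omega>)) \<and>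
                    X t \<omega> = x0 + (LBINT s:{0..t}. f (X s \<omega>)) + J \<omega>)"
    using sol assms by (simp add: sde_solution_def)
  from someI_ex[OF this, folded J_def]
  show "has_ito_integral M F B (\<lambda>s \<omega>. g (X s \<omega>)) t (J t)"
    and "AE \<omega> in M. set_integrable lborel {0..t} (\<lambda>s. f (X s \<omega>)) \<and> X t \<omega> = x0 + (LBINT s:{0..t}. f (X s \<omega>)) + J t \<omega>"
    by blast+
qed

sublocale ito: ito_process M F B "\<lambda>s \<omega>. g (X s \<omega>)" J
  by unfold_locales (rule J(1))

text \<open>The accumulated defect of X in the Euler recursion. At k = 0 it measures the deviation
  of X 0 from x0, which is zero only almost surely.\<close>

definition euler_error :: "real \<Rightarrow> nat \<Rightarrow> 'a \<Rightarrow> real ^ 'd" where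
  "euler_error \<Delta> k \<omega> = X (real k * \<Delta>) \<omega> - x0 - (\<Sum>j<k. \<Delta> *\<^sub>R f (X (real j * \<Delta>) \<omega>))
    - mart_sum (\<lambda>j. real j * \<Delta>) (\<lambda>j \<omega>. g (X (real j * \<Delta>) \<omega>)) k \<omega>"

text \<open>The defect is the oscillation of f(X) within the cells plus the Riemann-sum error of the
  stochastic integral. Both are governed by a modulus of continuity along the path, uniformly over
  the grid points.\<close>

lemma euler_error_small:
  assumes T: "0 \<le> T" and eta: "0 < \<eta>" and e: "0 < e"
  obtains d where "0 < d" "\<And>\<Delta> N. 0 < \<Delta> \<Longrightarrow> \<Delta> < d \<Longrightarrow> real N * \<Delta> \<le> T \<Longrightarrow>
    prob {\<omega> \<in> space M. \<exists>k\<le>N. \<eta> < norm (euler_error \<Delta> k \<omega>)} \<le> e"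
proof -
  let ?c = "gauss_const TYPE('m) 1"
  have c: "0 < ?c + 1" using gauss_const_nonneg[of 1, where ?'m = 'm] by simp
  \<comment> \<open>Chosen so that the maximal-inequality term in \<open>riemann_sum_error\<close>,
    applied with \<eta> / 2, is at most e / 2.\<close>
  define \<eta>' where "\<eta>' = (e / 2) * (\<eta> / 2 / 2)\<^sup>2 / (?c + 1)"
  have eta': "0 < \<eta>'" using c e eta by (simp add: \<eta>'_def)
  have ce: "?c * \<eta>' / (\<eta> / 2 / 2)\<^sup>2 \<le> e / 2"
  proof -
    have "?c * \<eta>' / (\<eta> / 2 / 2)\<^sup>2 = (e / 2) * (?c / (?c + 1))" using eta by (simp add: \<eta>'_def)
    also have "\<dots> \<le> (e / 2) * 1" using e c by (intro mult_left_mono) (auto simp: divide_le_eq)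
    finally show ?thesis by simp
  qed
  \<comment> \<open>The bound 1 gives \<mu>^2 <= \<mu>, the second entry meets the requirement of
    the stochastic part, the third that of the drift. T + 1 replaces T to allow T = 0.\<close>
  define \<mu> where "\<mu> = min (min 1 (\<eta>' / (4 * (T + 1)))) (\<eta> / (2 * (T + 1)))"
  have T1: "0 < T + 1" using T by simp
  have cancel: "x * (y / (k * x)) = y / k" if "x \<noteq> 0" for x y k :: real using that by simp
  have \<mu>: "0 < \<mu>" "\<mu> \<le> 1" using eta eta' T by (auto simp: \<mu>_def)
  have \<mu>3: "(T + 1) * \<mu> \<le> \<eta>' / 4"
  proof -
    have "(T + 1) * \<mu> \<le> (T + 1) * (\<eta>' / (4 * (T + 1)))"
      using T1 by (intro mult_left_mono) (auto simp: \<mu>_def)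
    also have "\<dots> = \<eta>' / 4" using T1 by (intro cancel) simp
    finally show ?thesis .
  qed
  have \<mu>4: "(T + 1) * \<mu> \<le> \<eta> / 2"
  proof -
    have "(T + 1) * \<mu> \<le> (T + 1) * (\<eta> / (2 * (T + 1)))"
      using T1 by (intro mult_left_mono) (auto simp: \<mu>_def)
    also have "\<dots> = \<eta> / 2" using T1 by (intro cancel) simp
    finally show ?thesis .
  qed
  \<comment> \<open>Treated as one process, the pair of coefficients needs only one exceptional
    event.\<close>
  let ?Z = "\<lambda>s \<omega>. (f (X s \<omega>), g (X s \<omega>))"
  have Z1: "?Z s \<in> borel_measurable M" if "0 \<le> s" for s
    using X_measurable[OF that] unfolding borel_prod[symmetric] by measurable
  have Z2: "AE \<omega> in M. continuous_on {0..} (\<lambda>s. ?Z s \<omega>)"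
    using X_continuous by eventually_elim
      (intro continuous_on_Pair continuous_on_compose2[OF f_cont] continuous_on_compose2[OF g_cont], auto)
  have e4: "0 < e / 4" using e by simp
  obtain d E where d: "0 < d" and E: "E \<in> events" "prob (space M - E) \<le> e / 4"
    and osc: "AE \<omega> in M. \<omega> \<in> E \<longrightarrow> (\<forall>s\<in>{0..T}. \<forall>s'\<in>{0..T}. \<bar>s - s'\<bar> < d \<longrightarrow> dist (?Z s \<omega>) (?Z s' \<omega>) \<le> \<mu>)"
    by (rule continuous_process_modulus[OF Z1 Z2 T \<mu>(1) e4])
  show ?thesis
  proof (rule that[OF d])
    fix \<Delta> N assume \<Delta>: "0 < \<Delta>" "\<Delta> < d" "real N * \<Delta> \<le> T"
    let ?p = "\<lambda>j. real j * \<Delta>"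
    let ?R = "\<lambda>k. mart_sum ?p (\<lambda>j \<omega>. g (X (?p j) \<omega>)) k"
    have pk: "0 \<le> ?p k" "k \<le> N \<Longrightarrow> ?p k \<le> T" for k
    proof -
      show "0 \<le> ?p k" using \<Delta> by simp
      assume "k \<le> N"
      then have "?p k \<le> ?p N" using \<Delta> by (intro mult_right_mono) auto
      then show "?p k \<le> T" using \<Delta>(3) by linarith
    qed
    have osc': "AE \<omega> in M. \<omega> \<in> E \<longrightarrow> (\<forall>j<N. \<forall>s\<in>{?p j<..?p (Suc j)}.
        norm (f (X (?p j) \<omega>) - f (X s \<omega>)) \<le> \<mu> \<and> norm (g (X (?p j) \<omega>) - g (X s \<omega>)) \<le> \<mu>)"
      using osc
    proof eventually_elim
      case (elim \<omega>)
      show ?case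
      proof (intro impI allI ballI)
        fix j s assume \<omega>: "\<omega> \<in> E" and j: "j < N" and s: "s \<in> {?p j<..?p (Suc j)}"
        have "0 \<le> ?p j" "?p j < s" "s \<le> ?p j + \<Delta>" "s \<le> T"
          using pk(1)[of j] s pk(2)[of "Suc j"] j by (auto simp: algebra_simps)
        then have "\<bar>?p j - s\<bar> < d" "0 \<le> s" "s \<le> T" "0 \<le> ?p j" "?p j \<le> T"
          using \<Delta>(1,2) by linarith+
        then have "\<bar>?p j - s\<bar> < d" "s \<in> {0..T}" "?p j \<in> {0..T}"
          by simp_all
        then have "dist (?Z (?p j) \<omega>) (?Z s \<omega>) \<le> \<mu>" using elim \<omega> by blast
        then show "norm (f (X (?p j) \<omega>) - f (X s \<omega>)) \<le> \<mu> \<and> norm (g (X (?p j) \<omega>) - g (X s \<omega>)) \<le> \<mu>"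
          using dist_fst_le[of "?Z (?p j) \<omega>" "?Z s \<omega>"] dist_snd_le[of "?Z (?p j) \<omega>" "?Z s \<omega>"]
          by (simp add: dist_norm)
      qed
    qed
    have \<mu>2: "real N * \<Delta> * \<mu>\<^sup>2 \<le> \<eta>' / 4"
    proof -
      have "\<mu>\<^sup>2 \<le> \<mu>" using \<mu>(1,2) by (simp add: power2_eq_square mult_left_le_one_le)
      then have "real N * \<Delta> * \<mu>\<^sup>2 \<le> (T + 1) * \<mu>" using \<Delta> T by (intro mult_mono) auto
      then show ?thesis using \<mu>3 by simp
    qed
    have "prob {\<omega> \<in> space M. \<exists>k\<le>N. \<eta> / 2 < norm (?R k \<omega> - J (?p k) \<omega>)}
      \<le> prob (space M - E) + ?c * \<eta>' / (\<eta> / 2 / 2)\<^sup>2"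
    proof (rule ito.riemann_sum_error[OF \<Delta>(1) _ eta' \<mu>2 E(1)])
      show "AE \<omega> in M. \<omega> \<in> E \<longrightarrow> (\<forall>j<N. \<forall>s\<in>{?p j<..?p (Suc j)}. norm (g (X (?p j) \<omega>) - g (X s \<omega>)) \<le> \<mu>)"
        using osc' by eventually_elim blast
    qed (use eta in simp)
    then have R: "prob {\<omega> \<in> space M. \<exists>k\<le>N. \<eta> / 2 < norm (?R k \<omega> - J (?p k) \<omega>)} \<le> e / 4 + e / 2"
      using E ce by linarith
    have "AE \<omega> in M. \<forall>k\<in>{..N}. set_integrable lborel {0..?p k} (\<lambda>s. f (X s \<omega>)) \<and> X (?p k) \<omega> = x0 + (LBINT s:{0..?p k}. f (X s \<omega>)) + J (?p k) \<omega>"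
      using J(2)[OF pk(1)] by (simp add: AE_finite_all)
    then have imp: "AE \<omega> in M. \<omega> \<in> {\<omega> \<in> space M. \<exists>k\<le>N. \<eta> < norm (euler_error \<Delta> k \<omega>)} \<longrightarrow>
      \<omega> \<in> {\<omega> \<in> space M. \<exists>k\<le>N. \<eta> / 2 < norm (?R k \<omega> - J (?p k) \<omega>)} \<union> (space M - E)"
      using osc'
    proof eventually_elim
      case (elim \<omega>)
      show ?case
      proof
        assume "\<omega> \<in> {\<omega> \<in> space M. \<exists>k\<le>N. \<eta> < norm (euler_error \<Delta> k \<omega>)}"
        then obtain k where k: "\<omega> \<in> space M" "k \<le> N" "\<eta> < norm (euler_error \<Delta> k \<omega>)" by auto
        show "\<omega> \<in> {\<omega> \<in> space M. \<exists>k\<le>N. \<eta> / 2 < norm (?R k \<omega> - J (?p k) \<omega>)} \<union> (space M - E)"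
        proof (cases "\<omega> \<in> E")
          case True
          let ?st = "\<lambda>s. \<Sum>i<k. indicator {?p i<..?p (Suc i)} s *\<^sub>R f (X (?p i) \<omega>)"
          have p: "time_grid k ?p" using \<Delta> by (simp add: time_grid_def)
          have fi: "set_integrable lborel {0..?p k} (\<lambda>s. f (X s \<omega>))"
            and Xk: "X (?p k) \<omega> = x0 + (LBINT s:{0..?p k}. f (X s \<omega>)) + J (?p k) \<omega>"
            using elim(1) k(2) by auto
          note st = grid_step_integral[OF p order_refl, of "\<lambda>i. f (X (?p i) \<omega>)"]
          have sum: "(\<Sum>j<k. \<Delta> *\<^sub>R f (X (?p j) \<omega>)) = (LBINT s:{0..?p k}. ?st s)"
            unfolding st(2) by (intro sum.cong) (auto simp: algebra_simps)
          have stv: "?st s = f (X (?p i) \<omega>)" if "i < k" "s \<in> {?p i<..?p (Suc i)}" for i s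
          proof -
            have "?st s = (\<Sum>j<k. if j = i then f (X (?p j) \<omega>) else 0)"
              using grid_indicator_unique[OF p that] by (intro sum.cong) auto
            then show ?thesis using that by simp
          qed
          have pw: "norm (f (X s \<omega>) - ?st s) \<le> \<mu>" if s: "s \<noteq> 0" "s \<in> {0..?p k}" for s
          proof -
            obtain j where j: "j < k" "s \<in> {?p j<..?p (Suc j)}"
              using time_grid_cover[OF p, of s] s by (auto simp del: of_nat_Suc)
            then have "norm (f (X (?p j) \<omega>) - f (X s \<omega>)) \<le> \<mu>" using elim(2) True k(2) by auto
            then show ?thesis unfolding stv[OF j] by (simp add: norm_minus_commute)
          qed
          have diff: "set_integrable lborel {0..?p k} (\<lambda>s. f (X s \<omega>) - ?st s)"
            by (intro set_integral_diff(1) fi st(1))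
          have "norm ((LBINT s:{0..?p k}. f (X s \<omega>)) - (\<Sum>j<k. \<Delta> *\<^sub>R f (X (?p j) \<omega>))) = norm (LBINT s:{0..?p k}. f (X s \<omega>) - ?st s)"
            unfolding sum by (subst set_integral_diff(2)[OF fi st(1)]) simp
          also have "\<dots> \<le> (LBINT s:{0..?p k}. norm (f (X s \<omega>) - ?st s))"
            by (rule set_integral_norm_bound[OF diff])
          also have "\<dots> \<le> (LBINT s:{0..?p k}. \<mu>)"
          proof (rule set_integral_mono_AE)
            show "set_integrable lborel {0..?p k} (\<lambda>s. norm (f (X s \<omega>) - ?st s))" by (rule set_integrable_norm[OF diff])
            show "set_integrable lborel {0..?p k} (\<lambda>s. \<mu>)"
              unfolding set_integrable_def by (intro integrable_scaleR_left integrable_real_indicator) (auto simp: emeasure_lborel_Icc_eq)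
            show "AE s\<in>{0..?p k} in lborel. norm (f (X s \<omega>) - ?st s) \<le> \<mu>"
              using AE_lborel_singleton[of "0::real"] by eventually_elim (use pw in auto)
          qed
          also have "\<dots> = ?p k * \<mu>" using pk(1)[of k] by (simp add: set_lebesgue_integral_def)
          also have "\<dots> \<le> (T + 1) * \<mu>" using pk(2)[OF k(2)] \<mu>(1) by (intro mult_right_mono) auto
          also have "\<dots> \<le> \<eta> / 2" by (rule \<mu>4)
          finally have drift: "norm ((LBINT s:{0..?p k}. f (X s \<omega>)) - (\<Sum>j<k. \<Delta> *\<^sub>R f (X (?p j) \<omega>))) \<le> \<eta> / 2" .
          define a where "a = (LBINT s:{0..?p k}. f (X s \<omega>)) - (\<Sum>j<k. \<Delta> *\<^sub>R f (X (?p j) \<omega>))"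
          have "euler_error \<Delta> k \<omega> = a - (?R k \<omega> - J (?p k) \<omega>)"
            unfolding euler_error_def Xk a_def by simp
          then have "norm (euler_error \<Delta> k \<omega>) \<le> norm a + norm (?R k \<omega> - J (?p k) \<omega>)"
            by (simp only: norm_triangle_ineq4)
          moreover have "norm a \<le> \<eta> / 2" using drift unfolding a_def .
          ultimately have "norm (euler_error \<Delta> k \<omega>) \<le> \<eta> / 2 + norm (?R k \<omega> - J (?p k) \<omega>)" by linarith
          then have "\<eta> / 2 < norm (?R k \<omega> - J (?p k) \<omega>)" using k(3) by linarith
          then show ?thesis using k by auto
        qed (use k in auto)
      qed
    qed
    have bad: "{\<omega> \<in> space M. \<exists>k\<le>N. \<eta> / 2 < norm (?R k \<omega> - J (?p k) \<omega>)} \<in> events"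
    proof -
      have [measurable]: "J (?p k) \<in> borel_measurable M" for k by (rule ito.J_measurable[OF pk(1)])
      have p: "time_grid N ?p" using \<Delta> by (simp add: time_grid_def)
      have [measurable]: "?R k \<in> borel_measurable M" if "k \<le> N" for k
        using that pk by (intro measurable_F_M[OF mart_sum_measurable[OF p]] measurable_compose[OF X_adapted g_borel]) auto
      show ?thesis by measurable
    qed
    have Ec: "space M - E \<in> events" using E(1) by (rule sets.compl_sets)
    have "prob {\<omega> \<in> space M. \<exists>k\<le>N. \<eta> < norm (euler_error \<Delta> k \<omega>)} \<le>
       prob ({\<omega> \<in> space M. \<exists>k\<le>N. \<eta> / 2 < norm (?R k \<omega> - J (?p k) \<omega>)} \<union> (space M - E))"
      by (rule finite_measure_mono_AE[OF imp sets.Un[OF bad Ec]])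
    also have "\<dots> \<le> prob {\<omega> \<in> space M. \<exists>k\<le>N. \<eta> / 2 < norm (?R k \<omega> - J (?p k) \<omega>)} + prob (space M - E)"
      by (rule measure_Un_le[OF bad Ec])
    finally show "prob {\<omega> \<in> space M. \<exists>k\<le>N. \<eta> < norm (euler_error \<Delta> k \<omega>)} \<le> e"
      using R E by linarith
  qed
qed

end

lemma truncation_radius_ge:
  fixes \<phi> :: "real \<Rightarrow> real"
  assumes \<phi>: "continuous_on {0..} \<phi>" "strict_mono_on {0..} \<phi>" "filterlim \<phi> at_top at_top"
    and \<theta>: "0 < \<theta>" and K: "0 < K" and a: "0 \<le> a"
  obtains d where "0 < d" "\<And>\<Delta>. 0 < \<Delta> \<Longrightarrow> \<Delta> < d \<Longrightarrow> a \<le> the_inv_into {0..} \<phi> (K * \<Delta> powr (- \<theta>))"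
proof -
  \<comment> \<open>The maximum with 1 keeps z positive even when \<phi> a is not, so that
    d^(-\<theta>) = z can be solved for d.\<close>
  define z where "z = max 1 (\<phi> a / K)"
  define d where "d = z powr (- (1 / \<theta>))"
  have z: "1 \<le> z" "\<phi> a \<le> K * z"
    using K by (auto simp: z_def max_def field_simps)
  have d: "0 < d" "d powr (- \<theta>) = z"
    using z \<theta> by (auto simp: d_def powr_powr)
  show ?thesis
  proof (rule that[OF d(1)])
    fix \<Delta> :: real assume \<Delta>: "0 < \<Delta>" "\<Delta> < d"
    have "d powr (- \<theta>) \<le> \<Delta> powr (- \<theta>)"
      using \<Delta> \<theta> by (intro powr_mono2') auto
    then have "\<phi> a \<le> K * \<Delta> powr (- \<theta>)"
      using z(2) K unfolding d(2) by (meson mult_left_mono less_imp_le order_trans)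
    then show "a \<le> the_inv_into {0..} \<phi> (K * \<Delta> powr (- \<theta>))"
      by (rule the_inv_into_ge(1)[OF \<phi> a])
  qed
qed

text \<open>One step of Gronwall for a^2 + \<eta>^2. The defect \<eta> is carried along inside the
  quantity, which makes the recursion purely multiplicative.\<close>

lemma square_growth_bound:
  assumes a: "0 \<le> (a::real)" and \<eta>: "0 \<le> \<eta>" and L: "0 \<le> L" and \<Delta>: "0 \<le> \<Delta>" "\<Delta> \<le> 1" and c: "0 \<le> c"
    and x: "0 \<le> x" "x \<le> L * (a + \<eta>)" and y: "0 \<le> y" "y \<le> L * (a + \<eta>)"
  shows "(a + \<Delta> * x)\<^sup>2 + c * \<Delta> * y\<^sup>2 + \<eta>\<^sup>2 \<le> (1 + (4 * L + 2 * L\<^sup>2 + 2 * c * L\<^sup>2) * \<Delta>) * (a\<^sup>2 + \<eta>\<^sup>2)"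
proof -
  let ?s = "a + \<eta>"
  have s2: "?s\<^sup>2 \<le> 2 * (a\<^sup>2 + \<eta>\<^sup>2)"
    using zero_le_power2[of "a - \<eta>"] by (simp add: power2_sum power2_diff)
  have x2: "x\<^sup>2 \<le> L\<^sup>2 * ?s\<^sup>2" using power_mono[OF x(2) x(1), of 2] by (simp add: power_mult_distrib)
  have y2: "y\<^sup>2 \<le> L\<^sup>2 * ?s\<^sup>2" using power_mono[OF y(2) y(1), of 2] by (simp add: power_mult_distrib)
  have ax: "a * x \<le> L * ?s\<^sup>2"
  proof -
    have "a * x \<le> ?s * (L * ?s)" using a \<eta> x by (intro mult_mono) auto
    then show ?thesis by (simp add: power2_eq_square mult_ac)
  qed
  have dx: "\<Delta>\<^sup>2 * x\<^sup>2 \<le> \<Delta> * x\<^sup>2"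
    using \<Delta> by (intro mult_right_mono) (auto simp: power2_eq_square mult_left_le_one_le)
  have "(a + \<Delta> * x)\<^sup>2 + c * \<Delta> * y\<^sup>2 + \<eta>\<^sup>2 = a\<^sup>2 + \<eta>\<^sup>2 + \<Delta> * (2 * (a * x)) + \<Delta>\<^sup>2 * x\<^sup>2 + \<Delta> * (c * y\<^sup>2)"
    by (simp add: power2_sum power_mult_distrib mult_ac)
  also have "\<dots> \<le> a\<^sup>2 + \<eta>\<^sup>2 + \<Delta> * (2 * (L * ?s\<^sup>2)) + \<Delta> * (L\<^sup>2 * ?s\<^sup>2) + \<Delta> * (c * (L\<^sup>2 * ?s\<^sup>2))"
    using \<Delta> c ax y2 dx mult_left_mono[OF x2 \<Delta>(1)] by (intro add_mono mult_left_mono) auto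
  also have "\<dots> = a\<^sup>2 + \<eta>\<^sup>2 + \<Delta> * ((2 * L + L\<^sup>2 + c * L\<^sup>2) * ?s\<^sup>2)" by (simp add: algebra_simps)
  also have "\<dots> \<le> a\<^sup>2 + \<eta>\<^sup>2 + \<Delta> * ((2 * L + L\<^sup>2 + c * L\<^sup>2) * (2 * (a\<^sup>2 + \<eta>\<^sup>2)))"
    using \<Delta> L c by (intro add_left_mono mult_left_mono s2) auto
  also have "\<dots> = (1 + (4 * L + 2 * L\<^sup>2 + 2 * c * L\<^sup>2) * \<Delta>) * (a\<^sup>2 + \<eta>\<^sup>2)" by (simp add: algebra_simps)
  finally show ?thesis .
qed

section \<open>Stability of the scheme up to exit from a ball, and convergence in
  probability\<close>

context sde
begin

text \<open>The two schemes are compared up to the first grid time at which \<open>X\<close>, \<open>Y\<close> or the Euler error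
  gets large. Before that time the truncation is inactive, and leaving through \<open>Y\<close> alone forces
  the stopped difference \<open>S\<close> to be large.\<close>

lemma truncated_EM_stability:
  fixes \<phi> :: "real \<Rightarrow> real" and K \<theta> \<Delta> R L \<eta> \<beta> \<eta>' :: real and N :: nat
  defines "Y \<equiv> truncated_EM B f g x0 \<phi> K \<theta> \<Delta>"
  assumes \<Delta>: "0 < \<Delta>" "\<Delta> \<le> 1" and R: "0 \<le> R"
    and radius: "R + 1 < the_inv_into {0..} \<phi> (K * \<Delta> powr (- \<theta>))"
    and L: "0 \<le> L" "L-lipschitz_on (cball 0 (R + 1)) f" "L-lipschitz_on (cball 0 (R + 1)) g"
    and \<eta>: "0 \<le> \<eta>" and \<beta>: "0 < \<beta>" and sum: "\<eta> + \<beta> \<le> 1" "\<eta> + \<beta> \<le> \<eta>'"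
  shows "prob {\<omega> \<in> space M. \<eta>' < norm (X (real N * \<Delta>) \<omega> - Y N \<omega>)} \<le>
     prob {\<omega> \<in> space M. \<exists>k\<le>N. R < norm (X (real k * \<Delta>) \<omega>)} + prob {\<omega> \<in> space M. \<exists>k\<le>N. \<eta> < norm (euler_error \<Delta> k \<omega>)}
      + \<eta>\<^sup>2 * exp ((4 * L + 2 * L\<^sup>2 + 2 * gauss_const TYPE('m) 1 * L\<^sup>2) * (real N * \<Delta>)) / \<beta>\<^sup>2"
proof -
  let ?c = "gauss_const TYPE('m) 1"
  let ?C = "4 * L + 2 * L\<^sup>2 + 2 * ?c * L\<^sup>2"
  let ?p = "\<lambda>j. real j * \<Delta>"
  have c: "0 \<le> ?c" by (rule gauss_const_nonneg)
  have p: "time_grid n ?p" for n using \<Delta> by (simp add: time_grid_def)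
  have pk: "0 \<le> ?p k" for k using \<Delta> by simp
  have pmono: "i \<le> j \<Longrightarrow> ?p i \<le> ?p j" for i j using \<Delta> by (simp add: mult_right_mono)
  have YF: "Y k \<in> borel_measurable (F (?p k))" for k
    unfolding Y_def by (rule truncated_EM_measurable[OF f_cont g_cont \<Delta>(1)])
  have XF: "X (?p k) \<in> borel_measurable (F (?p k))" for k by (rule X_adapted[OF pk])
  have errF: "euler_error \<Delta> k \<in> borel_measurable (F (?p k))" for k
  proof -
    have "X (?p j) \<in> borel_measurable (F (?p k))" if "j \<le> k" for j
      by (rule measurable_F_mono[OF XF pk pmono[OF that]])
    moreover have "mart_sum ?p (\<lambda>j \<omega>. g (X (?p j) \<omega>)) k \<in> borel_measurable (F (?p k))"
      by (rule mart_sum_measurable[OF p[of k] _ order_refl]) (rule measurable_compose[OF XF g_borel])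
    ultimately show ?thesis
      unfolding euler_error_def[abs_def]
      by (intro borel_measurable_diff borel_measurable_sum borel_measurable_scaleR measurable_compose[OF _ f_borel] borel_measurable_const) auto
  qed
  \<comment> \<open>The two radii differ by 1: while X stays in its ball, Y can leave only by moving
    away from X by more than 1, whereas \<eta> + \<beta> <= 1.\<close>
  define ok where "ok k \<omega> \<longleftrightarrow> (\<forall>j\<in>{..k}. norm (X (?p j) \<omega>) \<le> R \<and> norm (Y j \<omega>) \<le> R + 1 \<and> norm (euler_error \<Delta> j \<omega>) \<le> \<eta>)" for k \<omega>
  have okF: "Measurable.pred (F (?p k)) (ok k)" for k
  proof -
    have [measurable]: "X (?p j) \<in> borel_measurable (F (?p k))" "Y j \<in> borel_measurable (F (?p k))"
      "euler_error \<Delta> j \<in> borel_measurable (F (?p k))" if "j \<in> {..k}" for j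
      using that by (auto intro!: measurable_F_mono[OF XF pk pmono] measurable_F_mono[OF YF pk pmono] measurable_F_mono[OF errF pk pmono])
    show ?thesis unfolding ok_def[abs_def] by measurable
  qed
  have ok_mono: "ok k \<omega> \<Longrightarrow> j \<le> k \<Longrightarrow> ok j \<omega>" for j k \<omega> by (auto simp: ok_def)
  define fd where "fd k \<omega> = (if ok k \<omega> then f (X (?p k) \<omega>) - f (Y k \<omega>) else 0)" for k \<omega>
  define gd where "gd k \<omega> = (if ok k \<omega> then g (X (?p k) \<omega>) - g (Y k \<omega>) else 0)" for k \<omega>
  define S where "S k \<omega> = (\<Sum>j<k. \<Delta> *\<^sub>R fd j \<omega>) + mart_sum ?p gd k \<omega>" for k \<omega>
  \<comment> \<open>The Euler sum along the truncated values but without the final truncation. It is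
    linear in the increments, so it can be subtracted from the corresponding expression for
    X.\<close>
  define Yt where "Yt k \<omega> = x0 + (\<Sum>j<k. \<Delta> *\<^sub>R f (Y j \<omega>)) + mart_sum ?p (\<lambda>j \<omega>. g (Y j \<omega>)) k \<omega>" for k \<omega>
  have fdF: "fd k \<in> borel_measurable (F (?p k))" for k
    unfolding fd_def[abs_def] using okF[of k] measurable_compose[OF XF f_borel, of k] measurable_compose[OF YF f_borel, of k] by measurable
  have gdF: "gd k \<in> borel_measurable (F (?p k))" for k
    unfolding gd_def[abs_def] using okF[of k] measurable_compose[OF XF g_borel, of k] measurable_compose[OF YF g_borel, of k] by measurable
  have SF: "S k \<in> borel_measurable (F (?p k))" for k
  proof -
    have "fd j \<in> borel_measurable (F (?p k))" if "j \<le> k" for j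
      by (rule measurable_F_mono[OF fdF pk pmono[OF that]])
    moreover have "mart_sum ?p gd k \<in> borel_measurable (F (?p k))"
      by (rule mart_sum_measurable[OF p[of k] gdF order_refl])
    ultimately show ?thesis unfolding S_def[abs_def]
      by (intro borel_measurable_add borel_measurable_sum borel_measurable_scaleR borel_measurable_const) auto
  qed
  have SM [measurable]: "S k \<in> borel_measurable M" for k by (rule measurable_F_M[OF SF pk])
  have Y_step: "Y (Suc k) \<omega> = truncation \<phi> K \<theta> \<Delta> (Yt (Suc k) \<omega>)" if "Y k \<omega> = Yt k \<omega>" for k \<omega>
    using that unfolding Y_def Yt_def by (simp add: Let_def mart_sum_def add_ac)
  have norm_trunc: "norm (truncation \<phi> K \<theta> \<Delta> x) = min (norm x) (the_inv_into {0..} \<phi> (K * \<Delta> powr (- \<theta>)))" for x :: "real ^ 'd"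
    using radius R by (intro norm_truncation) simp
  \<comment> \<open>A truncated vector with norm strictly below the level was not cut, and R + 1
    lies strictly below the level; so Y and Yt agree as long as Y stays within R + 1.\<close>
  have Y_eq: "Y k \<omega> = Yt k \<omega>" if "\<forall>j\<le>k. norm (Y j \<omega>) \<le> R + 1" for k \<omega>
    using that
  proof (induction k)
    case 0 then show ?case by (simp add: Y_def Yt_def mart_sum_def)
  next
    case (Suc k)
    then have eq: "Y (Suc k) \<omega> = truncation \<phi> K \<theta> \<Delta> (Yt (Suc k) \<omega>)" by (intro Y_step) auto
    have "norm (Y (Suc k) \<omega>) \<le> R + 1" using Suc.prems by auto
    then have "norm (Yt (Suc k) \<omega>) \<le> the_inv_into {0..} \<phi> (K * \<Delta> powr (- \<theta>))"
      using radius unfolding eq norm_trunc by (auto simp: min_def split: if_splits)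
    then show ?case unfolding eq by (rule truncation_id)
  qed
  \<comment> \<open>\<open>ok\<close> is required strictly before k only, because the identity is
    needed at the first index where \<open>ok\<close> fails.\<close>
  have diff: "X (?p k) \<omega> - Yt k \<omega> = S k \<omega> + euler_error \<Delta> k \<omega>" if "\<forall>j<k. ok j \<omega>" for k \<omega>
  proof -
    have 1: "(\<Sum>j<k. \<Delta> *\<^sub>R fd j \<omega>) = (\<Sum>j<k. \<Delta> *\<^sub>R f (X (?p j) \<omega>)) - (\<Sum>j<k. \<Delta> *\<^sub>R f (Y j \<omega>))"
      using that by (simp add: fd_def sum_subtractf scaleR_diff_right cong: sum.cong_simp)
    have "mart_sum ?p gd k \<omega> = (\<Sum>i<k. (g (X (?p i) \<omega>) - g (Y i \<omega>)) *v (B (?p (Suc i)) \<omega> - B (?p i) \<omega>))"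
      unfolding mart_sum_def using that by (intro sum.cong) (auto simp: gd_def)
    also have "\<dots> = mart_sum ?p (\<lambda>j \<omega>. g (X (?p j) \<omega>)) k \<omega> - mart_sum ?p (\<lambda>j \<omega>. g (Y j \<omega>)) k \<omega>"
      by (simp only: mart_sum_def bounded_bilinear.diff_left[OF bounded_bilinear_matrix_vector_mult] sum_subtractf)
    finally show ?thesis unfolding S_def euler_error_def Yt_def 1 by simp
  qed
  have close: "norm (X (?p k) \<omega> - Y k \<omega>) \<le> norm (S k \<omega>) + \<eta>" if "ok k \<omega>" for k \<omega>
  proof -
    have "Y k \<omega> = Yt k \<omega>" using that by (intro Y_eq) (auto simp: ok_def)
    moreover have "X (?p k) \<omega> - Yt k \<omega> = S k \<omega> + euler_error \<Delta> k \<omega>"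
      using that by (intro diff) (auto intro: ok_mono)
    moreover have "norm (euler_error \<Delta> k \<omega>) \<le> \<eta>" using that by (auto simp: ok_def)
    ultimately show ?thesis using norm_triangle_ineq[of "S k \<omega>" "euler_error \<Delta> k \<omega>"] by simp
  qed
  have lip: "norm (fd k \<omega>) \<le> L * (norm (S k \<omega>) + \<eta>)" "norm (gd k \<omega>) \<le> L * (norm (S k \<omega>) + \<eta>)" for k \<omega>
  proof -
    have nn: "0 \<le> L * (norm (S k \<omega>) + \<eta>)" using L(1) \<eta> by simp
    have *: "norm (h (X (?p k) \<omega>) - h (Y k \<omega>)) \<le> L * (norm (S k \<omega>) + \<eta>)"
      if "ok k \<omega>" and h: "L-lipschitz_on (cball 0 (R + 1)) h" for h :: "real ^ 'd \<Rightarrow> 'z::real_normed_vector"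
    proof -
      have "norm (X (?p k) \<omega>) \<le> R" "norm (Y k \<omega>) \<le> R + 1" using that(1) by (auto simp: ok_def)
      then have "X (?p k) \<omega> \<in> cball 0 (R + 1)" "Y k \<omega> \<in> cball 0 (R + 1)" by simp_all
      then have "norm (h (X (?p k) \<omega>) - h (Y k \<omega>)) \<le> L * norm (X (?p k) \<omega> - Y k \<omega>)"
        using lipschitz_onD[OF h] by (simp add: dist_norm)
      also have "\<dots> \<le> L * (norm (S k \<omega>) + \<eta>)" using L(1) close[OF that(1)] by (rule mult_left_mono[rotated])
      finally show ?thesis .
    qed
    show "norm (fd k \<omega>) \<le> L * (norm (S k \<omega>) + \<eta>)" using *[OF _ L(2)] nn by (simp add: fd_def)
    show "norm (gd k \<omega>) \<le> L * (norm (S k \<omega>) + \<eta>)" using *[OF _ L(3)] nn by (simp add: gd_def)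
  qed
  \<comment> \<open>The added \<eta>^2 is the quantity of \<open>square_growth_bound\<close>; it
    also makes A 0 = \<eta>^2 the starting value, as S starts at 0.\<close>
  define A where "A k = (\<integral>\<^sup>+ \<omega>. ennreal ((norm (S k \<omega>))\<^sup>2 + \<eta>\<^sup>2) \<partial>M)" for k
  have A_step: "A (Suc k) \<le> ennreal (1 + ?C * \<Delta>) * A k" for k
  proof -
    have [measurable]: "fd k \<in> borel_measurable M" "gd k \<in> borel_measurable M"
      by (rule measurable_F_M[OF fdF pk], rule measurable_F_M[OF gdF pk])
    let ?m = "\<lambda>\<omega>. S k \<omega> + \<Delta> *\<^sub>R fd k \<omega>"
    have mF: "?m \<in> borel_measurable (F (?p k))"
      by (intro borel_measurable_add SF borel_measurable_scaleR borel_measurable_const fdF)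
    have lt: "?p k < ?p (Suc k)" and dt: "?p (Suc k) - ?p k = \<Delta>" using \<Delta> by (simp_all add: algebra_simps)
    have S_Suc: "S (Suc k) \<omega> = ?m \<omega> + gd k \<omega> *v (B (?p (Suc k)) \<omega> - B (?p k) \<omega>)" for \<omega>
      by (simp add: S_def mart_sum_def add_ac)
    have "A (Suc k) = (\<integral>\<^sup>+ \<omega>. ennreal ((norm (S (Suc k) \<omega>))\<^sup>2) \<partial>M) + ennreal (\<eta>\<^sup>2)"
      unfolding A_def using emeasure_space_1 by (simp add: nn_integral_add)
    also have "\<dots> = (\<integral>\<^sup>+ \<omega>. ennreal ((norm (?m \<omega> + gd k \<omega> *v (B (?p (Suc k)) \<omega> - B (?p k) \<omega>)))\<^sup>2) \<partial>M) + ennreal (\<eta>\<^sup>2)"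
      by (simp only: S_Suc)
    also have "\<dots> \<le> ((\<integral>\<^sup>+ \<omega>. ennreal ((norm (?m \<omega>))\<^sup>2) \<partial>M) + ennreal (?c * \<Delta>) * (\<integral>\<^sup>+ \<omega>. ennreal ((norm (gd k \<omega>))\<^sup>2) \<partial>M)) + ennreal (\<eta>\<^sup>2)"
      using L2_step[OF pk lt mF gdF] unfolding dt by (rule add_right_mono)
    also have "\<dots> = (\<integral>\<^sup>+ \<omega>. ennreal ((norm (?m \<omega>))\<^sup>2 + ?c * \<Delta> * (norm (gd k \<omega>))\<^sup>2 + \<eta>\<^sup>2) \<partial>M)"
      using emeasure_space_1 c \<Delta> by (simp add: nn_integral_add nn_integral_cmult ennreal_mult)
    also have "\<dots> \<le> (\<integral>\<^sup>+ \<omega>. ennreal ((1 + ?C * \<Delta>) * ((norm (S k \<omega>))\<^sup>2 + \<eta>\<^sup>2)) \<partial>M)"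
    proof (intro nn_integral_mono ennreal_leI)
      fix \<omega>
      have "norm (?m \<omega>) \<le> norm (S k \<omega>) + \<Delta> * norm (fd k \<omega>)"
        using norm_triangle_ineq[of "S k \<omega>" "\<Delta> *\<^sub>R fd k \<omega>"] \<Delta> by simp
      then have "(norm (?m \<omega>))\<^sup>2 \<le> (norm (S k \<omega>) + \<Delta> * norm (fd k \<omega>))\<^sup>2" by (rule power_mono) simp
      moreover have "(norm (S k \<omega>) + \<Delta> * norm (fd k \<omega>))\<^sup>2 + ?c * \<Delta> * (norm (gd k \<omega>))\<^sup>2 + \<eta>\<^sup>2 \<le> (1 + ?C * \<Delta>) * ((norm (S k \<omega>))\<^sup>2 + \<eta>\<^sup>2)"
        by (rule square_growth_bound[OF norm_ge_zero \<eta> L(1) less_imp_le[OF \<Delta>(1)] \<Delta>(2) c norm_ge_zero lip(1) norm_ge_zero lip(2)])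
      ultimately show "(norm (?m \<omega>))\<^sup>2 + ?c * \<Delta> * (norm (gd k \<omega>))\<^sup>2 + \<eta>\<^sup>2 \<le> (1 + ?C * \<Delta>) * ((norm (S k \<omega>))\<^sup>2 + \<eta>\<^sup>2)"
        by linarith
    qed
    also have "\<dots> = ennreal (1 + ?C * \<Delta>) * A k"
      unfolding A_def using L(1) c \<Delta> by (subst nn_integral_cmult[symmetric]) (auto simp: ennreal_mult)
    finally show ?thesis .
  qed
  have C0: "0 \<le> ?C * \<Delta>" using L(1) c \<Delta> by simp
  have "(\<integral>\<^sup>+ \<omega>. ennreal ((norm (S N \<omega>))\<^sup>2) \<partial>M) \<le> A N"
    unfolding A_def by (intro nn_integral_mono ennreal_leI) simp
  also have "\<dots> \<le> ennreal (exp (?C * \<Delta> * real N)) * A 0"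
    by (rule ennreal_discrete_Gronwall[where n = N, OF _ C0 order_refl]) (rule A_step)
  also have "A 0 = ennreal (\<eta>\<^sup>2)" unfolding A_def S_def mart_sum_def using emeasure_space_1 by simp
  also have "ennreal (exp (?C * \<Delta> * real N)) * ennreal (\<eta>\<^sup>2) = ennreal (\<eta>\<^sup>2 * exp (?C * (real N * \<Delta>)))"
    by (simp add: ennreal_mult[symmetric] mult_ac)
  finally have tail: "prob {\<omega> \<in> space M. \<beta> < norm (S N \<omega>)} \<le> \<eta>\<^sup>2 * exp (?C * (real N * \<Delta>)) / \<beta>\<^sup>2"
    by (intro second_moment_tail[OF SM \<beta>]) auto
  let ?B1 = "{\<omega> \<in> space M. \<exists>k\<le>N. R < norm (X (?p k) \<omega>)}"
  let ?B2 = "{\<omega> \<in> space M. \<exists>k\<le>N. \<eta> < norm (euler_error \<Delta> k \<omega>)}"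
  let ?B3 = "{\<omega> \<in> space M. \<beta> < norm (S N \<omega>)}"
  have [measurable]: "X (?p k) \<in> borel_measurable M" "euler_error \<Delta> k \<in> borel_measurable M" for k
    by (rule measurable_F_M[OF XF pk], rule measurable_F_M[OF errF pk])
  have ev: "?B1 \<in> events" "?B2 \<in> events" "?B3 \<in> events" by measurable
  have sub: "{\<omega> \<in> space M. \<eta>' < norm (X (?p N) \<omega> - Y N \<omega>)} \<subseteq> ?B1 \<union> ?B2 \<union> ?B3"
  proof
    fix \<omega> assume \<omega>: "\<omega> \<in> {\<omega> \<in> space M. \<eta>' < norm (X (?p N) \<omega> - Y N \<omega>)}"
    show "\<omega> \<in> ?B1 \<union> ?B2 \<union> ?B3"
    proof (rule ccontr)
      assume no: "\<omega> \<notin> ?B1 \<union> ?B2 \<union> ?B3"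
      then have XR: "norm (X (?p k) \<omega>) \<le> R" and er: "norm (euler_error \<Delta> k \<omega>) \<le> \<eta>" if "k \<le> N" for k
        using \<omega> that by (auto simp: not_less)
      have SN: "norm (S N \<omega>) \<le> \<beta>" using no \<omega> by auto
      have nN: "\<not> ok N \<omega>"
      proof
        assume "ok N \<omega>"
        from close[OF this] SN sum \<omega> show False by auto
      qed
      define k where "k = (LEAST k. \<not> ok k \<omega>)"
      have k: "\<not> ok k \<omega>" unfolding k_def using nN by (rule LeastI)
      have kN: "k \<le> N" unfolding k_def using nN by (rule Least_le)
      have before: "ok j \<omega>" if "j < k" for j using not_less_Least[of j "\<lambda>k. \<not> ok k \<omega>"] that unfolding k_def by blast
      \<comment> \<open>The value X 0 on this path need not be x0; the Euler error at time 0 bridges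
        the gap.\<close>
      have Y0: "norm (Y 0 \<omega>) \<le> R + 1"
      proof -
        have "norm x0 \<le> norm (X (?p 0) \<omega>) + norm (euler_error \<Delta> 0 \<omega>)"
          using norm_triangle_sub[of x0 "X 0 \<omega>"] by (simp add: euler_error_def mart_sum_def norm_minus_commute)
        then have "norm x0 \<le> R + \<eta>" using XR[of 0] er[of 0] by linarith
        then show ?thesis using sum(1) \<beta> by (simp add: Y_def)
      qed
      \<comment> \<open>At the first failure neither X nor the Euler error is to blame, so it must
        be Y that left its ball.\<close>
      have Yk: "R + 1 < norm (Y k \<omega>)"
      proof (rule ccontr)
        assume "\<not> R + 1 < norm (Y k \<omega>)"
        then have "norm (Y j \<omega>) \<le> R + 1" if "j \<le> k" for j
          using before[of j] that by (cases "j = k") (auto simp: ok_def)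
        then have "ok k \<omega>" unfolding ok_def using XR er kN by auto
        with k show False by simp
      qed
      with Y0 obtain i where i: "k = Suc i" by (cases k) auto
      have all_i: "\<forall>j\<le>i. norm (Y j \<omega>) \<le> R + 1" using before i by (auto simp: ok_def less_Suc_eq_le)
      \<comment> \<open>Even if the exit step was truncated, truncation does not increase the norm,
        so the untruncated value is outside as well.\<close>
      have "norm (Y k \<omega>) \<le> norm (Yt k \<omega>)"
        unfolding i Y_step[OF Y_eq[OF all_i]] norm_trunc by simp
      then have "1 < norm (X (?p k) \<omega> - Yt k \<omega>)"
        using Yk XR[OF kN] norm_triangle_sub[of "Yt k \<omega>" "X (?p k) \<omega>"] by (simp add: norm_minus_commute)
      also have "X (?p k) \<omega> - Yt k \<omega> = S k \<omega> + euler_error \<Delta> k \<omega>" using before by (intro diff) auto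
      finally have "1 < norm (S k \<omega>) + \<eta>" using er[OF kN] norm_triangle_ineq[of "S k \<omega>" "euler_error \<Delta> k \<omega>"] by linarith
      \<comment> \<open>S is frozen from the exit on, so the exit is visible at the final index and
        a second-moment bound at N suffices.\<close>
      moreover have "S N \<omega> = S k \<omega>"
      proof -
        have z: "fd j \<omega> = 0" "gd j \<omega> = 0" if "k \<le> j" for j
          using k ok_mono[of j \<omega> k] that by (auto simp: fd_def gd_def)
        have "(\<Sum>j<N. \<Delta> *\<^sub>R fd j \<omega>) = (\<Sum>j<k. \<Delta> *\<^sub>R fd j \<omega>)"
          using kN z by (intro sum.mono_neutral_right) auto
        moreover have "mart_sum ?p gd N \<omega> = mart_sum ?p gd k \<omega>"
          unfolding mart_sum_def using kN z by (intro sum.mono_neutral_right) auto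
        ultimately show ?thesis by (simp add: S_def)
      qed
      ultimately show False using SN sum(1) by simp
    qed
  qed
  have "prob {\<omega> \<in> space M. \<eta>' < norm (X (?p N) \<omega> - Y N \<omega>)} \<le> prob (?B1 \<union> ?B2 \<union> ?B3)"
    by (rule finite_measure_mono[OF sub]) (intro sets.Un ev)
  also have "\<dots> \<le> prob (?B1 \<union> ?B2) + prob ?B3" by (rule measure_Un_le) (intro sets.Un ev)+
  also have "\<dots> \<le> prob ?B1 + prob ?B2 + prob ?B3" by (intro add_right_mono measure_Un_le ev)
  finally show ?thesis using tail by linarith
qed

text \<open>Four errors of e / 4 each: X leaves a ball, the Euler error is large, the stopped
  difference is large, and X moves between the last grid point N \<Delta> and T, where the scheme is
  constant.\<close>

lemma truncated_EM_converges_in_prob: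
  fixes \<phi> :: "real \<Rightarrow> real" and K \<theta> T \<eta> e :: real
  assumes radius: "\<And>a. 0 \<le> a \<Longrightarrow> \<exists>d>0. \<forall>\<Delta>. 0 < \<Delta> \<longrightarrow> \<Delta> < d \<longrightarrow> a \<le> the_inv_into {0..} \<phi> (K * \<Delta> powr (- \<theta>))"
    and T: "0 \<le> T" and eta: "0 < \<eta>" and e: "0 < e"
  obtains d where "0 < d" "\<And>\<Delta>. 0 < \<Delta> \<Longrightarrow> \<Delta> < d \<Longrightarrow>
    prob {\<omega> \<in> space M. \<eta> < norm (X T \<omega> - truncated_EM_process B f g x0 \<phi> K \<theta> \<Delta> T \<omega>)} \<le> e"
proof -
  let ?c = "gauss_const TYPE('m) 1"
  have e4: "0 < e / 4" using e by simp
  obtain R E where R: "0 < R" and E: "E \<in> events" "prob (space M - E) \<le> e / 4"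
    and bnd: "AE \<omega> in M. \<omega> \<in> E \<longrightarrow> (\<forall>s\<in>{0..T}. norm (X s \<omega>) \<le> R)"
    by (rule continuous_process_bound[OF X_measurable X_continuous T e4])
  have eta2: "0 < \<eta> / 2" using eta by simp
  obtain d2 E2 where d2: "0 < d2" and E2: "E2 \<in> events" "prob (space M - E2) \<le> e / 4"
    and osc: "AE \<omega> in M. \<omega> \<in> E2 \<longrightarrow> (\<forall>s\<in>{0..T}. \<forall>s'\<in>{0..T}. \<bar>s - s'\<bar> < d2 \<longrightarrow> dist (X s \<omega>) (X s' \<omega>) \<le> \<eta> / 2)"
    by (rule continuous_process_modulus[OF X_measurable X_continuous T eta2 e4])
  obtain Lf Lg where Lf: "Lf-lipschitz_on (cball 0 (R + 1)) f" and Lg: "Lg-lipschitz_on (cball 0 (R + 1)) g"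
    using f_lip g_lip unfolding locally_lipschitz_def by blast
  define L where "L = max Lf Lg"
  have L: "0 \<le> L" "L-lipschitz_on (cball 0 (R + 1)) f" "L-lipschitz_on (cball 0 (R + 1)) g"
    using lipschitz_on_nonneg[OF Lf] lipschitz_on_le[OF Lf, of L] lipschitz_on_le[OF Lg, of L] by (auto simp: L_def)
  let ?C = "4 * L + 2 * L\<^sup>2 + 2 * ?c * L\<^sup>2"
  have C: "0 \<le> ?C" using L(1) gauss_const_nonneg[of 1, where ?'m = 'm] by simp
  \<comment> \<open>As \<gamma> <= \<beta>, this gives \<gamma> + \<beta> <= 1 for the exit argument
    and \<gamma> + \<beta> <= \<eta> / 2 for the final difference.\<close>
  define \<beta> where "\<beta> = min (\<eta> / 4) (1 / 2)"
  have \<beta>: "0 < \<beta>" "2 * \<beta> \<le> 1" "2 * \<beta> \<le> \<eta> / 2" using eta by (auto simp: \<beta>_def)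
  \<comment> \<open>Fixed after R, L and \<beta>: it solves \<gamma>^2 exp(C T) / \<beta>^2 = e / 4,
    so the Euler error is made small relative to the Gronwall constant of the ball.\<close>
  define \<gamma> where "\<gamma> = min \<beta> (\<beta> * sqrt (e / 4 / exp (?C * T)))"
  have \<gamma>: "0 < \<gamma>" "\<gamma> \<le> \<beta>" using \<beta>(1) e by (auto simp: \<gamma>_def)
  have \<gamma>2: "\<gamma>\<^sup>2 * exp (?C * T) / \<beta>\<^sup>2 \<le> e / 4"
  proof -
    have "\<gamma>\<^sup>2 \<le> (\<beta> * sqrt (e / 4 / exp (?C * T)))\<^sup>2"
      using \<gamma>(1) by (intro power_mono) (auto simp: \<gamma>_def)
    also have "\<dots> = \<beta>\<^sup>2 * (e / 4 / exp (?C * T))" using e by (simp add: power_mult_distrib)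
    finally have "\<gamma>\<^sup>2 * exp (?C * T) \<le> \<beta>\<^sup>2 * (e / 4)" by (simp add: field_simps)
    then show ?thesis using \<beta>(1) by (simp add: field_simps)
  qed
  obtain d3 where d3: "0 < d3" and err: "\<And>\<Delta> N. 0 < \<Delta> \<Longrightarrow> \<Delta> < d3 \<Longrightarrow> real N * \<Delta> \<le> T \<Longrightarrow>
    prob {\<omega> \<in> space M. \<exists>k\<le>N. \<gamma> < norm (euler_error \<Delta> k \<omega>)} \<le> e / 4"
    using euler_error_small[OF T \<gamma>(1) e4] by blast
  obtain d4 where d4: "0 < d4" and rad: "\<And>\<Delta>. 0 < \<Delta> \<Longrightarrow> \<Delta> < d4 \<Longrightarrow> R + 2 \<le> the_inv_into {0..} \<phi> (K * \<Delta> powr (- \<theta>))"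
    using radius[of "R + 2"] R by auto
  show ?thesis
  proof (rule that[of "min 1 (min d2 (min d3 d4))"])
    show "0 < min 1 (min d2 (min d3 d4))" using d2 d3 d4 by simp
    fix \<Delta> :: real assume \<Delta>: "0 < \<Delta>" and "\<Delta> < min 1 (min d2 (min d3 d4))"
    then have lt: "\<Delta> < 1" "\<Delta> < d2" "\<Delta> < d3" "\<Delta> < d4" by auto
    define N where "N = nat \<lfloor>T / \<Delta>\<rfloor>"
    have Nr: "real N = of_int \<lfloor>T / \<Delta>\<rfloor>" using T \<Delta> by (simp add: N_def)
    have NT: "real N * \<Delta> \<le> T" "T - real N * \<Delta> < \<Delta>"
    proof -
      have "real N \<le> T / \<Delta>" unfolding Nr by (rule of_int_floor_le)
      then show "real N * \<Delta> \<le> T" using \<Delta> by (simp add: field_simps)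
      have "T / \<Delta> < real N + 1" unfolding Nr by linarith
      then show "T - real N * \<Delta> < \<Delta>" using \<Delta> by (simp add: field_simps)
    qed
    have pk: "0 \<le> real k * \<Delta>" "k \<le> N \<Longrightarrow> real k * \<Delta> \<le> T" for k
    proof -
      show "0 \<le> real k * \<Delta>" using \<Delta> by simp
      assume "k \<le> N"
      then have "real k * \<Delta> \<le> real N * \<Delta>" using \<Delta> by (intro mult_right_mono) auto
      then show "real k * \<Delta> \<le> T" using NT(1) by linarith
    qed
    let ?Y = "truncated_EM B f g x0 \<phi> K \<theta> \<Delta>"
    have [measurable]: "X (real k * \<Delta>) \<in> borel_measurable M" "?Y k \<in> borel_measurable M" for k
      by (rule X_measurable[OF pk(1)], rule measurable_F_M[OF truncated_EM_measurable[OF f_cont g_cont \<Delta>] pk(1)])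
    have X: "prob {\<omega> \<in> space M. \<exists>k\<le>N. R < norm (X (real k * \<Delta>) \<omega>)} \<le> e / 4"
    proof -
      have "AE \<omega> in M. \<omega> \<in> {\<omega> \<in> space M. \<exists>k\<le>N. R < norm (X (real k * \<Delta>) \<omega>)} \<longrightarrow> \<omega> \<in> space M - E"
        using bnd
      proof eventually_elim
        case (elim \<omega>)
        then show ?case using pk by (force simp: not_less[symmetric])
      qed
      from finite_measure_mono_AE[OF this sets.compl_sets[OF E(1)]] E(2) show ?thesis by linarith
    qed
    have "prob {\<omega> \<in> space M. \<eta> / 2 < norm (X (real N * \<Delta>) \<omega> - ?Y N \<omega>)} \<le>
     prob {\<omega> \<in> space M. \<exists>k\<le>N. R < norm (X (real k * \<Delta>) \<omega>)} + prob {\<omega> \<in> space M. \<exists>k\<le>N. \<gamma> < norm (euler_error \<Delta> k \<omega>)}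
      + \<gamma>\<^sup>2 * exp (?C * (real N * \<Delta>)) / \<beta>\<^sup>2"
      by (rule truncated_EM_stability) (use \<Delta> lt R L \<beta> \<gamma> rad[of \<Delta>] in auto)
    also have "\<gamma>\<^sup>2 * exp (?C * (real N * \<Delta>)) / \<beta>\<^sup>2 \<le> \<gamma>\<^sup>2 * exp (?C * T) / \<beta>\<^sup>2"
      using mult_left_mono[OF NT(1) C] by (intro divide_right_mono mult_left_mono) auto
    finally have grid: "prob {\<omega> \<in> space M. \<eta> / 2 < norm (X (real N * \<Delta>) \<omega> - ?Y N \<omega>)} \<le> e / 4 + e / 4 + e / 4"
      using X err[OF \<Delta> lt(3) NT(1)] \<gamma>2 by linarith
    let ?G = "{\<omega> \<in> space M. \<eta> / 2 < norm (X (real N * \<Delta>) \<omega> - ?Y N \<omega>)}"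
    have G: "?G \<in> events" by measurable
    have imp: "AE \<omega> in M. \<omega> \<in> {\<omega> \<in> space M. \<eta> < norm (X T \<omega> - truncated_EM_process B f g x0 \<phi> K \<theta> \<Delta> T \<omega>)} \<longrightarrow>
       \<omega> \<in> ?G \<union> (space M - E2)"
      using osc
    proof eventually_elim
      case (elim \<omega>)
      show ?case
      proof
        assume "\<omega> \<in> {\<omega> \<in> space M. \<eta> < norm (X T \<omega> - truncated_EM_process B f g x0 \<phi> K \<theta> \<Delta> T \<omega>)}"
        then have \<omega>: "\<omega> \<in> space M" "\<eta> < norm (X T \<omega> - ?Y N \<omega>)"
          by (auto simp: truncated_EM_process_def N_def)
        have "norm (X T \<omega> - X (real N * \<Delta>) \<omega>) \<le> \<eta> / 2" if "\<omega> \<in> E2"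
        proof -
          have "\<bar>T - real N * \<Delta>\<bar> < d2" using NT lt by simp
          then have "dist (X T \<omega>) (X (real N * \<Delta>) \<omega>) \<le> \<eta> / 2"
            using elim that T pk(1)[of N] NT(1) by auto
          then show ?thesis by (simp add: dist_norm)
        qed
        moreover have "norm (X T \<omega> - ?Y N \<omega>) \<le> norm (X T \<omega> - X (real N * \<Delta>) \<omega>) + norm (X (real N * \<Delta>) \<omega> - ?Y N \<omega>)"
          using norm_triangle_ineq[of "X T \<omega> - X (real N * \<Delta>) \<omega>" "X (real N * \<Delta>) \<omega> - ?Y N \<omega>"] by simp
        ultimately show "\<omega> \<in> ?G \<union> (space M - E2)" using \<omega> by (cases "\<omega> \<in> E2") auto
      qed
    qed
    have "prob {\<omega> \<in> space M. \<eta> < norm (X T \<omega> - truncated_EM_process B f g x0 \<phi> K \<theta> \<Delta> T \<omega>)} \<le> prob (?G \<union> (space M - E2))"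
      by (rule finite_measure_mono_AE[OF imp sets.Un[OF G sets.compl_sets[OF E2(1)]]])
    also have "\<dots> \<le> prob ?G + prob (space M - E2)"
      by (rule measure_Un_le[OF G sets.compl_sets[OF E2(1)]])
    finally show "prob {\<omega> \<in> space M. \<eta> < norm (X T \<omega> - truncated_EM_process B f g x0 \<phi> K \<theta> \<Delta> T \<omega>)} \<le> e"
      using grid E2(2) by linarith
  qed
qed

end

section \<open>Convergence in mean\<close>

lemma powr_add_le: "0 \<le> a \<Longrightarrow> 0 \<le> b \<Longrightarrow> 0 \<le> p \<Longrightarrow> (a + b) powr p \<le> 2 powr p * (a powr p + b powr (p :: real))"
proof -
  assume ab: "0 \<le> a" "0 \<le> b" "0 \<le> p"
  have "(a + b) powr p \<le> (2 * max a b) powr p" using ab by (intro powr_mono2) auto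
  also have "\<dots> = 2 powr p * max a b powr p" using ab by (simp add: powr_mult)
  also have "max a b powr p \<le> a powr p + b powr p" by (auto simp: max_def)
  finally show ?thesis by simp
qed

section \<open>From convergence in probability and bounded moments to convergence in mean\<close>

context prob_space
begin

text \<open>Fatou's lemma along the cut-offs |Z| <= n. For each n an approximation Y is chosen so
  close that the event where it fails costs at most 1; elsewhere |Z| <= |Y| + 1. The bound does not
  depend on n.\<close>

lemma moment_bound_limit:
  fixes Z :: "'a \<Rightarrow> 'b::{second_countable_topology, real_normed_vector}" and p C :: real
  assumes Z [measurable]: "Z \<in> borel_measurable M" and p: "0 < p" and C: "0 \<le> C"
    and Y: "\<And>e. 0 < e \<Longrightarrow> \<exists>Y \<in> borel_measurable M. prob {\<omega> \<in> space M. 1 < norm (Z \<omega> - Y \<omega>)} \<le> e \<and>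
        (\<integral>\<^sup>+ \<omega>. ennreal (norm (Y \<omega>) powr p) \<partial>M) \<le> ennreal C"
  shows "(\<integral>\<^sup>+ \<omega>. ennreal (norm (Z \<omega>) powr p) \<partial>M) \<le> ennreal (2 powr p * (C + 1) + 1)"
proof -
  let ?f = "\<lambda>n \<omega>. ennreal (norm (Z \<omega>) powr p) * indicator {\<omega>. norm (Z \<omega>) \<le> real n} \<omega>"
  have bound: "(\<integral>\<^sup>+ \<omega>. ?f n \<omega> \<partial>M) \<le> ennreal (2 powr p * (C + 1) + 1)" for n
  proof -
    \<comment> \<open>On the cut-off the integrand is at most n^p, so a failure probability of this
      size contributes at most 1.\<close>
    define e where "e = inverse (real n powr p + 1)"
    have e: "0 < e" "real n powr p * e \<le> 1" by (auto simp: e_def field_simps add_pos_nonneg)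
    obtain Y where [measurable]: "Y \<in> borel_measurable M"
      and pr: "prob {\<omega> \<in> space M. 1 < norm (Z \<omega> - Y \<omega>)} \<le> e" and mom: "(\<integral>\<^sup>+ \<omega>. ennreal (norm (Y \<omega>) powr p) \<partial>M) \<le> ennreal C"
      using Y[OF e(1)] by blast
    let ?A = "{\<omega> \<in> space M. 1 < norm (Z \<omega> - Y \<omega>)}"
    have "(\<integral>\<^sup>+ \<omega>. ?f n \<omega> \<partial>M) \<le> (\<integral>\<^sup>+ \<omega>. ennreal (real n powr p) * indicator ?A \<omega> + ennreal (2 powr p) * (ennreal (norm (Y \<omega>) powr p) + 1) \<partial>M)"
    proof (rule nn_integral_mono)
      fix \<omega> assume \<omega>: "\<omega> \<in> space M"
      show "?f n \<omega> \<le> ennreal (real n powr p) * indicator ?A \<omega> + ennreal (2 powr p) * (ennreal (norm (Y \<omega>) powr p) + 1)"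
      proof (cases "\<omega> \<in> ?A")
        case True
        have "?f n \<omega> \<le> ennreal (real n powr p)"
          using p by (auto split: split_indicator intro!: ennreal_leI powr_mono2)
        then show ?thesis using True by (simp add: add_increasing2)
      next
        case False
        then have "norm (Z \<omega>) \<le> norm (Y \<omega>) + 1"
          using \<omega> norm_triangle_sub[of "Z \<omega>" "Y \<omega>"] by (simp add: not_less)
        then have "norm (Z \<omega>) powr p \<le> (norm (Y \<omega>) + 1) powr p" using p by (intro powr_mono2) auto
        also have "\<dots> \<le> 2 powr p * (norm (Y \<omega>) powr p + 1)"
          using powr_add_le[of "norm (Y \<omega>)" 1 p] p by simp
        finally have "ennreal (norm (Z \<omega>) powr p) \<le> ennreal (2 powr p * (norm (Y \<omega>) powr p + 1))"
          by (rule ennreal_leI)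
        also have "\<dots> = ennreal (2 powr p) * (ennreal (norm (Y \<omega>) powr p) + 1)"
          by (simp add: ennreal_mult)
        finally show ?thesis using False by (auto split: split_indicator)
      qed
    qed
    also have "\<dots> = ennreal (real n powr p) * emeasure M ?A + ennreal (2 powr p) * ((\<integral>\<^sup>+ \<omega>. ennreal (norm (Y \<omega>) powr p) \<partial>M) + 1)"
      using emeasure_space_1 by (simp add: nn_integral_add nn_integral_cmult)
    also have "\<dots> \<le> ennreal (real n powr p) * ennreal e + ennreal (2 powr p) * (ennreal C + 1)"
      using pr by (intro add_mono mult_left_mono mom order_refl) (auto simp: emeasure_eq_measure intro: ennreal_leI)
    also have "\<dots> = ennreal (real n powr p * e + 2 powr p * (C + 1))"
    proof -
      have "ennreal C + 1 = ennreal (C + 1)" using C by simp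
      then show ?thesis using e(1) C by (simp add: ennreal_mult)
    qed
    also have "\<dots> \<le> ennreal (2 powr p * (C + 1) + 1)" using e(2) by (intro ennreal_leI) simp
    finally show ?thesis .
  qed
  have "(\<integral>\<^sup>+ \<omega>. ennreal (norm (Z \<omega>) powr p) \<partial>M) = (\<integral>\<^sup>+ \<omega>. liminf (\<lambda>n. ?f n \<omega>) \<partial>M)"
  proof (rule nn_integral_cong)
    fix \<omega>
    obtain m where m: "norm (Z \<omega>) \<le> real m" using real_arch_simple by blast
    have "\<forall>\<^sub>F n in sequentially. ?f n \<omega> = ennreal (norm (Z \<omega>) powr p)"
      using eventually_ge_at_top[of m] by eventually_elim (use m in \<open>auto split: split_indicator\<close>)
    then have "(\<lambda>n. ?f n \<omega>) \<longlonglongrightarrow> ennreal (norm (Z \<omega>) powr p)" by (rule tendsto_eventually)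
    then show "ennreal (norm (Z \<omega>) powr p) = liminf (\<lambda>n. ?f n \<omega>)"
      by (simp add: lim_imp_Liminf)
  qed
  also have "\<dots> \<le> liminf (\<lambda>n. \<integral>\<^sup>+ \<omega>. ?f n \<omega> \<partial>M)"
    by (rule nn_integral_liminf) measurable
  also have "\<dots> \<le> liminf (\<lambda>n::nat. ennreal (2 powr p * (C + 1) + 1))"
    by (intro Liminf_mono always_eventually allI bound)
  also have "\<dots> = ennreal (2 powr p * (C + 1) + 1)" by (simp add: Liminf_const)
  finally show ?thesis .
qed

text \<open>The range of D is split at \<eta> and \<Lambda>. The middle part is paid for by the
  probability, and above \<Lambda> one has D^q <= \<Lambda>^(q-p) D^p because q < p.\<close>

lemma moment_split_bound:
  fixes D :: "'a \<Rightarrow> real"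
  assumes D [measurable]: "D \<in> borel_measurable M" and nn: "\<And>\<omega>. 0 \<le> D \<omega>" and pq: "0 < q" "q < p"
    and mom: "(\<integral>\<^sup>+ \<omega>. ennreal (D \<omega> powr p) \<partial>M) \<le> ennreal C" and C: "0 \<le> C" and \<eta>: "0 < \<eta>" and \<Lambda>: "0 < \<Lambda>"
  shows "(\<integral>\<^sup>+ \<omega>. ennreal (D \<omega> powr q) \<partial>M) \<le>
    ennreal (\<eta> powr q + \<Lambda> powr q * prob {\<omega> \<in> space M. \<eta> < D \<omega>} + \<Lambda> powr (q - p) * C)"
proof -
  let ?A = "{\<omega> \<in> space M. \<eta> < D \<omega>}"
  have "(\<integral>\<^sup>+ \<omega>. ennreal (D \<omega> powr q) \<partial>M) \<le>
    (\<integral>\<^sup>+ \<omega>. ennreal (\<eta> powr q) + ennreal (\<Lambda> powr q) * indicator ?A \<omega> + ennreal (\<Lambda> powr (q - p)) * ennreal (D \<omega> powr p) \<partial>M)"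
  proof (rule nn_integral_mono)
    fix \<omega> assume \<omega>: "\<omega> \<in> space M"
    consider "D \<omega> \<le> \<eta>" | "\<eta> < D \<omega>" "D \<omega> \<le> \<Lambda>" | "\<Lambda> < D \<omega>" by linarith
    then show "ennreal (D \<omega> powr q) \<le> ennreal (\<eta> powr q) + ennreal (\<Lambda> powr q) * indicator ?A \<omega> + ennreal (\<Lambda> powr (q - p)) * ennreal (D \<omega> powr p)"
    proof cases
      case 1
      then have "ennreal (D \<omega> powr q) \<le> ennreal (\<eta> powr q)" using nn pq by (intro ennreal_leI powr_mono2) auto
      then show ?thesis by (simp add: add_increasing2 add.assoc)
    next
      case 2
      then have "ennreal (D \<omega> powr q) \<le> ennreal (\<Lambda> powr q)" using nn pq by (intro ennreal_leI powr_mono2) auto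
      then show ?thesis using 2 \<omega> by (simp add: add_increasing add_increasing2)
    next
      case 3
      have "D \<omega> powr q = D \<omega> powr (q - p) * D \<omega> powr p" by (simp add: powr_add[symmetric])
      also have "\<dots> \<le> \<Lambda> powr (q - p) * D \<omega> powr p"
        using 3 \<Lambda> pq by (intro mult_right_mono powr_mono2') auto
      finally have "ennreal (D \<omega> powr q) \<le> ennreal (\<Lambda> powr (q - p)) * ennreal (D \<omega> powr p)"
        by (simp add: ennreal_mult[symmetric])
      then show ?thesis by (simp add: add_increasing)
    qed
  qed
  also have "\<dots> = ennreal (\<eta> powr q) + ennreal (\<Lambda> powr q) * emeasure M ?A + ennreal (\<Lambda> powr (q - p)) * (\<integral>\<^sup>+ \<omega>. ennreal (D \<omega> powr p) \<partial>M)"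
    using emeasure_space_1 by (simp add: nn_integral_add nn_integral_cmult)
  also have "\<dots> \<le> ennreal (\<eta> powr q) + ennreal (\<Lambda> powr q) * ennreal (prob ?A) + ennreal (\<Lambda> powr (q - p)) * ennreal C"
    by (intro add_mono mult_left_mono mom order_refl) (auto simp: emeasure_eq_measure)
  also have "\<dots> = ennreal (\<eta> powr q + \<Lambda> powr q * prob ?A + \<Lambda> powr (q - p) * C)"
    using C by (simp add: ennreal_mult)
  finally show ?thesis .
qed

text \<open>Vitali's argument with uniform integrability supplied by the moment of order p > q. The
  limit Z gets that moment from the approximations themselves.\<close>

lemma Lq_convergence_at_right:
  fixes Z :: "'a \<Rightarrow> 'b::{second_countable_topology, real_normed_vector}" and Y :: "real \<Rightarrow> 'a \<Rightarrow> 'b"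
  assumes Z [measurable]: "Z \<in> borel_measurable M" and Y: "\<And>\<Delta>. 0 < \<Delta> \<Longrightarrow> Y \<Delta> \<in> borel_measurable M"
    and pq: "0 < q" "q < p" and C: "0 \<le> C" and \<Delta>0: "0 < \<Delta>0"
    and mom: "\<And>\<Delta>. 0 < \<Delta> \<Longrightarrow> \<Delta> \<le> \<Delta>0 \<Longrightarrow> (\<integral>\<^sup>+ \<omega>. ennreal (norm (Y \<Delta> \<omega>) powr p) \<partial>M) \<le> ennreal C"
    and conv: "\<And>\<eta> e. 0 < \<eta> \<Longrightarrow> 0 < e \<Longrightarrow> \<exists>d>0. \<forall>\<Delta>. 0 < \<Delta> \<longrightarrow> \<Delta> < d \<longrightarrow> prob {\<omega> \<in> space M. \<eta> < norm (Z \<omega> - Y \<Delta> \<omega>)} \<le> e"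
  shows "((\<lambda>\<Delta>. \<integral>\<^sup>+ \<omega>. ennreal (norm (Z \<omega> - Y \<Delta> \<omega>) powr q) \<partial>M) \<longlongrightarrow> 0) (at_right 0)"
proof -
  have p: "0 < p" using pq by simp
  define CZ where "CZ = 2 powr p * (C + 1) + 1"
  have CZ: "0 \<le> CZ" using C by (simp add: CZ_def)
  have momZ: "(\<integral>\<^sup>+ \<omega>. ennreal (norm (Z \<omega>) powr p) \<partial>M) \<le> ennreal CZ"
    unfolding CZ_def
  proof (rule moment_bound_limit[OF Z p C])
    fix e :: real assume "0 < e"
    then obtain d where d: "0 < d" "\<And>\<Delta>. 0 < \<Delta> \<Longrightarrow> \<Delta> < d \<Longrightarrow> prob {\<omega> \<in> space M. 1 < norm (Z \<omega> - Y \<Delta> \<omega>)} \<le> e"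
      using conv[of 1 e] by auto
    let ?\<Delta> = "min (d / 2) \<Delta>0"
    have "0 < ?\<Delta>" "?\<Delta> < d" "?\<Delta> \<le> \<Delta>0" using d(1) \<Delta>0 by auto
    then show "\<exists>Y\<in>borel_measurable M. prob {\<omega> \<in> space M. 1 < norm (Z \<omega> - Y \<omega>)} \<le> e \<and> (\<integral>\<^sup>+ \<omega>. ennreal (norm (Y \<omega>) powr p) \<partial>M) \<le> ennreal C"
      using Y d(2) mom by (intro bexI[of _ "Y ?\<Delta>"]) auto
  qed
  define C3 where "C3 = 2 powr p * (CZ + C)"
  have C3: "0 \<le> C3" using C CZ by (simp add: C3_def)
  have momD: "(\<integral>\<^sup>+ \<omega>. ennreal (norm (Z \<omega> - Y \<Delta> \<omega>) powr p) \<partial>M) \<le> ennreal C3" if \<Delta>: "0 < \<Delta>" "\<Delta> \<le> \<Delta>0" for \<Delta>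
  proof -
    note [measurable] = Y[OF \<Delta>(1)]
    have "(\<integral>\<^sup>+ \<omega>. ennreal (norm (Z \<omega> - Y \<Delta> \<omega>) powr p) \<partial>M) \<le> (\<integral>\<^sup>+ \<omega>. ennreal (2 powr p) * (ennreal (norm (Z \<omega>) powr p) + ennreal (norm (Y \<Delta> \<omega>) powr p)) \<partial>M)"
    proof (rule nn_integral_mono)
      fix \<omega>
      have "norm (Z \<omega> - Y \<Delta> \<omega>) powr p \<le> (norm (Z \<omega>) + norm (Y \<Delta> \<omega>)) powr p"
        using p by (intro powr_mono2 norm_triangle_ineq4) auto
      also have "\<dots> \<le> 2 powr p * (norm (Z \<omega>) powr p + norm (Y \<Delta> \<omega>) powr p)" using p by (intro powr_add_le) auto
      finally have "ennreal (norm (Z \<omega> - Y \<Delta> \<omega>) powr p) \<le> ennreal (2 powr p * (norm (Z \<omega>) powr p + norm (Y \<Delta> \<omega>) powr p))"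
        by (rule ennreal_leI)
      then show "ennreal (norm (Z \<omega> - Y \<Delta> \<omega>) powr p) \<le> ennreal (2 powr p) * (ennreal (norm (Z \<omega>) powr p) + ennreal (norm (Y \<Delta> \<omega>) powr p))"
        by (simp add: ennreal_mult)
    qed
    also have "\<dots> = ennreal (2 powr p) * ((\<integral>\<^sup>+ \<omega>. ennreal (norm (Z \<omega>) powr p) \<partial>M) + (\<integral>\<^sup>+ \<omega>. ennreal (norm (Y \<Delta> \<omega>) powr p) \<partial>M))"
      by (simp add: nn_integral_add nn_integral_cmult)
    also have "\<dots> \<le> ennreal (2 powr p) * (ennreal CZ + ennreal C)"
      by (intro mult_left_mono add_mono momZ mom \<Delta>) auto
    also have "\<dots> = ennreal C3" using CZ C by (simp add: C3_def ennreal_mult)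
    finally show ?thesis .
  qed
  show ?thesis
  proof (rule order_tendstoI)
    fix a :: ennreal assume "0 < a"
    then obtain b where b: "0 < b" "b < a" using dense by blast
    \<comment> \<open>The level a may be infinite, so a smaller finite one is extracted as a real
      number.\<close>
    define \<epsilon> where "\<epsilon> = enn2real b"
    have bt: "b < top" using b(2) by (rule less_le_trans) simp
    have \<epsilon>: "0 < \<epsilon>" "ennreal \<epsilon> < a"
      using b bt by (auto simp: \<epsilon>_def enn2real_positive_iff)
    define \<eta> where "\<eta> = (\<epsilon> / 3) powr (1 / q)"
    have \<eta>: "0 < \<eta>" "\<eta> powr q = \<epsilon> / 3" using \<epsilon> pq by (auto simp: \<eta>_def powr_powr)
    \<comment> \<open>Fixed before the stepsize: the tail contributes at most \<epsilon> / 3, as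
      does \<eta>, and only then is \<Delta> taken so small that the probability multiplied by
      \<Lambda>^q is at most \<epsilon> / 3.\<close>
    define \<Lambda> where "\<Lambda> = (\<epsilon> / 3 / (C3 + 1)) powr (1 / (q - p))"
    have \<Lambda>: "0 < \<Lambda>" "\<Lambda> powr (q - p) = \<epsilon> / 3 / (C3 + 1)" using \<epsilon> pq C3 by (auto simp: \<Lambda>_def powr_powr)
    have \<Lambda>C: "\<Lambda> powr (q - p) * C3 \<le> \<epsilon> / 3"
      unfolding \<Lambda>(2) using \<epsilon> C3 by (simp add: divide_simps)
    have "0 < \<epsilon> / 3 / \<Lambda> powr q" using \<epsilon> \<Lambda> by simp
    from conv[OF \<eta>(1) this] obtain d where d: "0 < d"
      "\<And>\<Delta>. 0 < \<Delta> \<Longrightarrow> \<Delta> < d \<Longrightarrow> prob {\<omega> \<in> space M. \<eta> < norm (Z \<omega> - Y \<Delta> \<omega>)} \<le> \<epsilon> / 3 / \<Lambda> powr q" by auto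
    have "(\<integral>\<^sup>+ \<omega>. ennreal (norm (Z \<omega> - Y \<Delta> \<omega>) powr q) \<partial>M) < a" if \<Delta>: "0 < \<Delta>" "\<Delta> < min d \<Delta>0" for \<Delta>
    proof -
      note [measurable] = Y[OF \<Delta>(1)]
      have "(\<integral>\<^sup>+ \<omega>. ennreal (norm (Z \<omega> - Y \<Delta> \<omega>) powr q) \<partial>M) \<le>
        ennreal (\<eta> powr q + \<Lambda> powr q * prob {\<omega> \<in> space M. \<eta> < norm (Z \<omega> - Y \<Delta> \<omega>)} + \<Lambda> powr (q - p) * C3)"
        using \<Delta> by (intro moment_split_bound[where p = p] pq momD C3 \<eta> \<Lambda>) auto
      also have "\<dots> \<le> ennreal \<epsilon>"
      proof (rule ennreal_leI)
        have "\<Lambda> powr q * prob {\<omega> \<in> space M. \<eta> < norm (Z \<omega> - Y \<Delta> \<omega>)} \<le> \<Lambda> powr q * (\<epsilon> / 3 / \<Lambda> powr q)"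
          using \<Delta> d(2)[of \<Delta>] by (intro mult_left_mono) auto
        also have "\<dots> = \<epsilon> / 3" using \<Lambda>(1) by simp
        finally show "\<eta> powr q + \<Lambda> powr q * prob {\<omega> \<in> space M. \<eta> < norm (Z \<omega> - Y \<Delta> \<omega>)} + \<Lambda> powr (q - p) * C3 \<le> \<epsilon>"
          using \<eta>(2) \<Lambda>C by linarith
      qed
      also note \<epsilon>(2)
      finally show ?thesis .
    qed
    then show "\<forall>\<^sub>F \<Delta> in at_right 0. (\<integral>\<^sup>+ \<omega>. ennreal (norm (Z \<omega> - Y \<Delta> \<omega>) powr q) \<partial>M) < a"
      unfolding eventually_at_right_field using d(1) \<Delta>0 by (intro exI[of _ "min d \<Delta>0"]) auto
  qed simp
qed

end

text \<open>A convex function vanishing at 0 lies below its chord, so \<kappa>(1) <= \<kappa>(u) / u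
  for u >= 1: it grows at least linearly. This turns the lower bound on V^\<rho> into a bound for
  the moment of order pbar.\<close>

lemma class_K_convex_linear_bound:
  assumes \<kappa>: "\<kappa> \<in> class_K_convex" and u: "0 \<le> u"
  shows "u \<le> 1 + \<kappa> u / \<kappa> 1"
proof (cases "u \<le> 1")
  case True
  have "0 \<le> \<kappa> u" "0 < \<kappa> 1"
    using \<kappa> u by (cases "u = 0", auto simp: class_K_convex_def class_K_def less_imp_le)
  then show ?thesis using True by (simp add: add_increasing2)
next
  case False
  have k1: "0 < \<kappa> 1" and k0: "\<kappa> 0 = 0" and conv: "convex_on {0..} \<kappa>"
    using \<kappa> by (auto simp: class_K_convex_def class_K_def)
  have "\<kappa> ((1 - 1 / u) *\<^sub>R 0 + (1 / u) *\<^sub>R u) \<le> (1 - 1 / u) * \<kappa> 0 + (1 / u) * \<kappa> u"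
    using False by (intro convex_onD[OF conv]) auto
  then have "\<kappa> 1 \<le> \<kappa> u / u" using False k0 by simp
  then have "u \<le> \<kappa> u / \<kappa> 1" using False k1 by (simp add: field_simps)
  then show ?thesis by simp
qed

text \<open>A bound on a real supremum says something about the values only if they are bounded
  above; continuity on the compact ball ensures this.\<close>

lemma coefficient_bounds_on_cball:
  fixes f :: "real ^ 'd::finite \<Rightarrow> real ^ 'd" and g :: "real ^ 'd \<Rightarrow> real ^ 'm::finite ^ 'd"
  assumes f: "continuous_on UNIV f" and g: "continuous_on UNIV g"
    and V: "continuous_on UNIV V" "\<And>x. 0 \<le> V x"
    and SUP_le: "(SUP x\<in>cball 0 r. max (norm (f x) / (1 + V x) powr \<delta>) ((norm (g x))\<^sup>2 / (1 + V x) powr (2 * \<delta>))) \<le> b"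
    and y: "norm y \<le> r"
  shows "norm (f y) \<le> b * (1 + V y) powr \<delta>" "(norm (g y))\<^sup>2 \<le> b * ((1 + V y) powr \<delta>)\<^sup>2"
proof -
  let ?h = "\<lambda>x. max (norm (f x) / (1 + V x) powr \<delta>) ((norm (g x))\<^sup>2 / (1 + V x) powr (2 * \<delta>))"
  have pos: "0 < 1 + V x" for x using V(2)[of x] by linarith
  have nz: "1 + V x \<noteq> 0" for x using pos[of x] by linarith
  have "continuous_on UNIV ?h"
    using nz by (intro continuous_on_max continuous_on_divide continuous_on_norm continuous_on_power continuous_on_powr
      continuous_on_add continuous_on_const f g V) auto
  then have "continuous_on (cball 0 r) ?h" by (rule continuous_on_subset) simp
  then have "compact (?h ` cball 0 r)" by (intro compact_continuous_image compact_cball)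
  then have "bdd_above (?h ` cball 0 r)" by (intro bounded_imp_bdd_above compact_imp_bounded)
  then have "?h y \<le> (SUP x\<in>cball 0 r. ?h x)" using y by (intro cSUP_upper) auto
  then have "?h y \<le> b" using SUP_le by linarith
  then have "norm (f y) / (1 + V y) powr \<delta> \<le> b" "(norm (g y))\<^sup>2 / (1 + V y) powr (2 * \<delta>) \<le> b" by auto
  moreover have "(1 + V y) powr (2 * \<delta>) = ((1 + V y) powr \<delta>)\<^sup>2"
    using pos[of y] by (simp add: power2_eq_square powr_add[symmetric])
  ultimately show "norm (f y) \<le> b * (1 + V y) powr \<delta>" "(norm (g y))\<^sup>2 \<le> b * ((1 + V y) powr \<delta>)\<^sup>2"
    using pos[of y] by (simp_all add: divide_le_eq)
qed

theorem theorem3p8: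
  fixes M :: "'a measure" and F :: "real \<Rightarrow> 'a measure"
    and B :: "real \<Rightarrow> 'a \<Rightarrow> real ^ 'm::finite"
    and f :: "real ^ 'd::finite \<Rightarrow> real ^ 'd" and g :: "real ^ 'd \<Rightarrow> real ^ 'm ^ 'd"
    and x0 :: "real ^ 'd" and X :: "real \<Rightarrow> 'a \<Rightarrow> real ^ 'd"
    and V :: "real ^ 'd \<Rightarrow> real" and \<phi> \<kappa> :: "real \<Rightarrow> real"
    and \<delta> \<rho> lam \<theta> \<Delta>max K pbar q T :: real
  assumes space: "usual_filtered_prob_space M F"
    and B: "brownian_motion M F B"
    and f: "locally_lipschitz f" and g: "locally_lipschitz g"
    and X: "sde_solution M F B f g x0 X"
    \<comment> \<open>Lyapunov condition\<close>
    and \<delta>: "1 / \<delta> \<in> \<int>" "1 / \<delta> \<ge> 4"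
    and V: "V \<in> lyapunov_class 4 \<delta>"
    and \<rho>: "\<rho> > 0" and lam: "lam > 0"
    and Khasminskii: "\<And>x. \<rho> / 2 * (1 + V x) powr (\<rho> - 2) *
          (2 * (1 + V x) * sde_generator f g V x + (\<rho> - 1) * (norm (gradient V x v* g x))\<^sup>2)
        \<le> lam * (1 + V x powr \<rho>)"
    and V_scale: "\<And>x \<epsilon>. 0 < \<epsilon> \<Longrightarrow> \<epsilon> \<le> 1 \<Longrightarrow> V (\<epsilon> *\<^sub>R x) \<le> V x"
    and \<kappa>: "\<kappa> \<in> class_K_convex" and pbar: "pbar > 0"
    and \<kappa>_le: "\<And>x. \<kappa> (norm x powr pbar) \<le> V x powr \<rho>"
    \<comment> \<open>choice of the parameters of the scheme\<close>
    and \<phi>: "continuous_on {0..} \<phi>" "strict_mono_on {0..} \<phi>" "\<And>u. u \<ge> 0 \<Longrightarrow> \<phi> u \<ge> 0"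
      "filterlim \<phi> at_top at_top"
    and \<phi>_bound: "\<And>u. u \<ge> 1 \<Longrightarrow>
        (SUP x\<in>cball 0 u. max (norm (f x) / (1 + V x) powr \<delta>)
                              ((norm (g x))\<^sup>2 / (1 + V x) powr (2 * \<delta>))) \<le> \<phi> u"
    and \<theta>: "0 < \<theta>" "\<theta> \<le> 1 / 2"
    and \<Delta>max: "0 < \<Delta>max" "\<Delta>max \<le> 1"
    and K: "K > 0" "K * \<Delta>max powr (- \<theta>) \<ge> \<phi> (max (norm x0) 1)"
    and q: "0 < q" "q < pbar"
    and T: "T \<ge> 0"
  shows "((\<lambda>\<Delta>. \<integral>\<^sup>+ \<omega>. ennreal
             (norm (X T \<omega> - truncated_EM_process B f g x0 \<phi> K \<theta> \<Delta> T \<omega>) powr q) \<partial>M)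
           \<longlongrightarrow> 0) (at_right 0)"
proof -
  interpret sde M F B f g x0 X
    by (intro sde.intro brownian.intro brownian_axioms.intro sde_axioms.intro space B f g X)
  \<comment> \<open>1 / \<delta> >= 4 also excludes \<delta> = 0, where the quotient is 0 by
    convention.\<close>
  have "0 < \<delta>"
  proof (rule ccontr)
    assume "\<not> 0 < \<delta>"
    then have "1 / \<delta> \<le> 0" by simp
    then show False using \<delta>(2) by linarith
  qed
  moreover obtain c where "0 < c" "\<And>n x. n \<in> {1..4} \<Longrightarrow> norm_deriv n V x \<le> c * (1 + V x) powr (1 - real n * \<delta>)"
    using V unfolding lyapunov_class_def by blast
  moreover have "cont_diff 4 V" "\<And>x. 0 \<le> V x" using V by (auto simp: lyapunov_class_def)
  ultimately interpret lyapunov_power V \<delta> c \<rho>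
    using \<rho> by (intro lyapunov_power.intro lyapunov.intro lyapunov_power_axioms.intro)
  let ?rad = "\<lambda>\<Delta>. the_inv_into {0..} \<phi> (K * \<Delta> powr (- \<theta>))"
  let ?Y = "\<lambda>\<Delta>. truncated_EM B f g x0 \<phi> K \<theta> \<Delta>"
  have V_cont: "continuous_on UNIV V"
    using smooth by (intro differentiable_imp_continuous_on) (simp add: eval_nat_numeral)
  \<comment> \<open>The factor 2 arises because 1 and V^\<rho> are each at most W.\<close>
  have gen: "\<rho> / 2 * U x powr (\<rho> - 2) * (2 * U x * sde_generator f g V x + (\<rho> - 1) * (norm (gradient V x v* g x))\<^sup>2)
      \<le> (2 * lam) * W x" for x
  proof -
    have "V x powr \<rho> \<le> W x" unfolding W_def U_def using \<rho> V_nonneg[of x] by (intro powr_mono2) auto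
    moreover have "1 \<le> W x" unfolding W_def using \<rho> U_ge_1[of x] by (intro ge_one_powr_ge_zero) auto
    ultimately have "lam * (1 + V x powr \<rho>) \<le> lam * (2 * W x)" using lam by (intro mult_left_mono) auto
    then show ?thesis using Khasminskii[of x] unfolding U_def by simp
  qed
  obtain C where C: "0 \<le> C" and step: "\<And>r y. 0 < r \<Longrightarrow> r \<le> 1 \<Longrightarrow> norm (f y) * r \<le> K * u y \<Longrightarrow> (norm (g y))\<^sup>2 * r \<le> K * (u y)\<^sup>2 \<Longrightarrow>
     (\<integral>\<^sup>+ \<xi>. ennreal (W (y + r\<^sup>2 *\<^sub>R f y + g y *v \<xi>)) \<partial>gauss (r\<^sup>2)) \<le> ennreal ((1 + C * r\<^sup>2) * W y)"
    using one_step_moment[OF gen _ K(1)] lam by auto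
  have moment: "(\<integral>\<^sup>+ \<omega>. ennreal (W (?Y \<Delta> k \<omega>)) \<partial>M) \<le> ennreal (exp (C * (real k * \<Delta>)) * W x0)"
    if \<Delta>: "0 < \<Delta>" "\<Delta> \<le> \<Delta>max" for \<Delta> k
  proof -
    have \<Delta>1: "\<Delta> \<le> 1" using \<Delta> \<Delta>max by linarith
    have "\<Delta>max powr (- \<theta>) \<le> \<Delta> powr (- \<theta>)" using \<Delta> \<theta> by (intro powr_mono2') auto
    then have "\<phi> (max (norm x0) 1) \<le> K * \<Delta> powr (- \<theta>)"
      using K by (meson less_imp_le mult_left_mono order_trans)
    note inv = the_inv_into_ge[OF \<phi>(1,2,4) _ this]
    \<comment> \<open>The part |x0| of the maximum places the initial value in the ball; the part 1
      lets the growth bound be used at the radius itself, where \<phi> takes the value K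
      \<Delta>^(-\<theta>).\<close>
    have rad: "max (norm x0) 1 \<le> ?rad \<Delta>" "\<phi> (?rad \<Delta>) = K * \<Delta> powr (- \<theta>)" using inv by auto
    then have pos: "0 < ?rad \<Delta>" by linarith
    show ?thesis
    proof (rule truncated_EM_moment[where S = "cball 0 (?rad \<Delta>)", OF f_cont g_cont \<Delta>(1) C continuous_W])
      show "0 \<le> W x" for x using W_pos[of x] by simp
      show "W (truncation \<phi> K \<theta> \<Delta> x) \<le> W x" for x
        unfolding W_def U_def using truncation_decreasing[OF pos, of V x] V_scale V_nonneg \<rho>
        by (intro powr_mono2) auto
      show "?Y \<Delta> k \<omega> \<in> cball 0 (?rad \<Delta>)" for k \<omega>
        using rad(1) by (cases k) (auto simp: Let_def norm_truncation[OF pos])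
      fix y :: "real ^ 'd" assume "y \<in> cball 0 (?rad \<Delta>)"
      then have y: "norm y \<le> ?rad \<Delta>" by simp
      have "1 \<le> ?rad \<Delta>" using rad(1) by simp
      from coefficient_bounds_on_cball[OF f_cont g_cont V_cont V_nonneg \<phi>_bound[OF this] y]
      have fb: "norm (f y) \<le> K * \<Delta> powr (- \<theta>) * u y" and gb: "(norm (g y))\<^sup>2 \<le> K * \<Delta> powr (- \<theta>) * (u y)\<^sup>2"
        unfolding rad(2) U_def by auto
      \<comment> \<open>Here \<theta> <= 1/2 enters: the square root of the stepsize absorbs the
        growth \<Delta>^(-\<theta>) of the coefficients, as required with r =
        \<open>sqrt \<Delta>\<close> in \<open>one_step_moment\<close>.\<close>
      have "\<Delta> powr (- \<theta>) * sqrt \<Delta> = \<Delta> powr (1 / 2 - \<theta>)"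
        using \<Delta> by (simp add: powr_half_sqrt[symmetric] powr_add[symmetric])
      also have "\<dots> \<le> 1" using \<Delta> \<Delta>1 \<theta> by (intro powr_le1) auto
      finally have le1: "\<Delta> powr (- \<theta>) * sqrt \<Delta> \<le> 1" .
      have absorb: "x * sqrt \<Delta> \<le> K * z" if "x \<le> K * \<Delta> powr (- \<theta>) * z" "0 \<le> z" for x z
      proof -
        have "x * sqrt \<Delta> \<le> (K * \<Delta> powr (- \<theta>) * z) * sqrt \<Delta>" using that \<Delta> by (intro mult_right_mono) auto
        also have "\<dots> = (K * z) * (\<Delta> powr (- \<theta>) * sqrt \<Delta>)" by simp
        also have "\<dots> \<le> (K * z) * 1" using that K by (intro mult_left_mono le1) auto
        finally show ?thesis by simp
      qed
      show "(\<integral>\<^sup>+ \<xi>. ennreal (W (y + \<Delta> *\<^sub>R f y + g y *v \<xi>)) \<partial>gauss \<Delta>) \<le> ennreal ((1 + C * \<Delta>) * W y)"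
        using step[of "sqrt \<Delta>" y, OF _ _ absorb[OF fb] absorb[OF gb]] \<Delta> \<Delta>1 by simp
    qed
  qed
  have k1: "0 < \<kappa> 1" using \<kappa> by (simp add: class_K_convex_def class_K_def)
  have norm_le_W: "norm x powr pbar \<le> (1 + 1 / \<kappa> 1) * W x" for x
  proof -
    have VW: "V x powr \<rho> \<le> W x" unfolding W_def U_def using \<rho> V_nonneg[of x] by (intro powr_mono2) auto
    have W1: "1 \<le> W x" unfolding W_def using \<rho> U_ge_1[of x] by (intro ge_one_powr_ge_zero) auto
    have "norm x powr pbar \<le> 1 + \<kappa> (norm x powr pbar) / \<kappa> 1"
      by (rule class_K_convex_linear_bound[OF \<kappa>]) simp
    also have "\<dots> \<le> W x + W x / \<kappa> 1"
      using \<kappa>_le[of x] VW W1 k1 by (intro add_mono divide_right_mono) auto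
    also have "\<dots> = (1 + 1 / \<kappa> 1) * W x" by (simp add: algebra_simps)
    finally show ?thesis .
  qed
  let ?C = "(1 + 1 / \<kappa> 1) * (exp (C * T) * W x0)"
  have Ym: "?Y \<Delta> k \<in> borel_measurable M" if "0 < \<Delta>" for \<Delta> k
    by (rule measurable_F_M[OF truncated_EM_measurable[OF f_cont g_cont that]]) (use that in simp)
  show ?thesis
  proof (rule Lq_convergence_at_right[OF X_measurable[OF T] _ q _ \<Delta>max(1), where C = ?C])
    show "0 \<le> ?C" using k1 W_pos[of x0] by simp
    show "truncated_EM_process B f g x0 \<phi> K \<theta> \<Delta> T \<in> borel_measurable M" if "0 < \<Delta>" for \<Delta>
      unfolding truncated_EM_process_def by (rule Ym[OF that])
    show "(\<integral>\<^sup>+ \<omega>. ennreal (norm (truncated_EM_process B f g x0 \<phi> K \<theta> \<Delta> T \<omega>) powr pbar) \<partial>M) \<le> ennreal ?C"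
      if \<Delta>: "0 < \<Delta>" "\<Delta> \<le> \<Delta>max" for \<Delta>
    proof -
      let ?k = "nat \<lfloor>T / \<Delta>\<rfloor>"
      note [measurable] = Ym[OF \<Delta>(1)]
      have "real ?k \<le> T / \<Delta>" using T \<Delta> by simp
      then have kT: "real ?k * \<Delta> \<le> T" using \<Delta> by (simp add: field_simps)
      have "(\<integral>\<^sup>+ \<omega>. ennreal (norm (truncated_EM_process B f g x0 \<phi> K \<theta> \<Delta> T \<omega>) powr pbar) \<partial>M) \<le>
        (\<integral>\<^sup>+ \<omega>. ennreal (1 + 1 / \<kappa> 1) * ennreal (W (?Y \<Delta> ?k \<omega>)) \<partial>M)"
        unfolding truncated_EM_process_def using norm_le_W k1 W_pos
        by (intro nn_integral_mono) (simp add: ennreal_mult[symmetric] less_imp_le del: ennreal_plus)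
      also have "\<dots> = ennreal (1 + 1 / \<kappa> 1) * (\<integral>\<^sup>+ \<omega>. ennreal (W (?Y \<Delta> ?k \<omega>)) \<partial>M)"
        by (rule nn_integral_cmult) measurable
      also have "\<dots> \<le> ennreal (1 + 1 / \<kappa> 1) * ennreal (exp (C * T) * W x0)"
      proof (rule mult_left_mono)
        have "exp (C * (real ?k * \<Delta>)) * W x0 \<le> exp (C * T) * W x0"
          using kT C W_pos[of x0] by (intro mult_right_mono) (auto intro: mult_left_mono)
        then show "(\<integral>\<^sup>+ \<omega>. ennreal (W (?Y \<Delta> ?k \<omega>)) \<partial>M) \<le> ennreal (exp (C * T) * W x0)"
          using moment[OF \<Delta>, of ?k] by (meson ennreal_leI order_trans)
      qed simp
      also have "\<dots> = ennreal ?C"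
        using k1 W_pos[of x0] by (intro ennreal_mult[symmetric]) (auto simp: less_imp_le)
      finally show ?thesis .
    qed
    fix \<eta> e :: real assume \<eta>: "0 < \<eta>" and e: "0 < e"
    have "\<exists>d>0. \<forall>\<Delta>. 0 < \<Delta> \<longrightarrow> \<Delta> < d \<longrightarrow> a \<le> ?rad \<Delta>" if "0 \<le> a" for a
      by (rule truncation_radius_ge[OF \<phi>(1,2,4) \<theta>(1) K(1) that]) blast
    from truncated_EM_converges_in_prob[OF this T \<eta> e]
    show "\<exists>d>0. \<forall>\<Delta>. 0 < \<Delta> \<longrightarrow> \<Delta> < d \<longrightarrow>
        prob {\<omega> \<in> space M. \<eta> < norm (X T \<omega> - truncated_EM_process B f g x0 \<phi> K \<theta> \<Delta> T \<omega>)} \<le> e"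
      by blast
  qed
qed

end
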